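(* Let $X$ be an $\Omega$-$\omega$-polygraph with a fixed unital section $\iota$. Then $X$ is a polygraphic resolution of $\overline X$ if, and only if, it admits a right and bracketed $\iota$-contraction.
   Context: $\mathbf k$ is a field of characteristic zero, $\Omega$ is a set, algebras are associative and unital over $\mathbf k$. An $\Omega$-algebra is an algebra $A$ with $\mathbf k$-linear maps $\mathcal T_\tau:A\to A$, $\tau\in\Omega$; morphisms are algebra morphisms commuting with the operators. For a set $Z$, the free $\Omega$-monoid $Z^\Omega$ is the union of $Z^\Omega_0=Z^*\subset Z^\Omega_1\subset\cdots$, $Z_n^\Omega=(Z\sqcup\{\lfloor u\rfloor_\tau: u\in Z^\Omega_{n-1},\tau\in\Omega\})^*$, with operators $u\mapsto\lfloor u\rfloor_\tau$; $\mathscr A_\Omega(Z)$ is its $\mathbf k$-linear span (free $\Omega$-algebra). For $n\in\mathbb N\cup\{\omega\}$, an $n$-algebra is a strict $n$-category internal to $\Omega$-algebras: $\Omega$-algebras $A_k$ of $k$-cells, with source, target, identity maps and compositions $\star_k$, all morphisms of $\Omega$-algebras ($a\star_k b$ is defined when $t_k(a)=s_k(b)$, with $s_k,t_k$ the $k$-source and $k$-target). Lower cells are identified with their identities. A cellular extension of an $n$-algebra $A$ is a set $Y$ with maps $s,t:Y\to A_n$ such that $s(y),t(y)$ are parallel (same source and target, if $n\ge1$); $A[Y]$ is the $(n+1)$-algebra obtained by freely adjoining each $y\in Y$ as an $(n+1)$-cell $s(y)\to t(y)$. An $\Omega$-$\omega$-polygraph is a sequence $X=(Z,X_1,X_2,\ldots)$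 with $Z=X_0$ a set, $X_1$ a cellular extension of $\mathscr A_\Omega(Z)$, and $X_{n+1}$ a cellular extension of the free $n$-algebra $\mathscr A_\Omega(X_0,\ldots,X_n)=\mathscr A_\Omega(X_0,\ldots,X_{n-1})[X_n]$; $\mathscr A_\Omega(X)$ is the resulting free $\omega$-algebra. By standing convention the underlying $\Omega$-$1$-polygraph $(Z,X_1)$ is left-monomial: for $\alpha\in X_1$, $s(\alpha)\in Z^\Omega$ is not in the support of $t(\alpha)$. $\overline X$ is the quotient of $\mathscr A_\Omega(Z)$ by the $\Omega$-ideal generated by $s(\alpha)-t(\alpha)$, $\alpha\in X_1$, also seen as an $\omega$-algebra with only identity $n$-cells for $n\ge1$; $\pi:\mathscr A_\Omega(X)\to\overline X$ is the projection. $X$ is a polygraphic resolution of an $\Omega$-algebra $A$ if $\overline X\cong A$ and, for each $n\ge1$ and each pair $(f,g)$ of parallel $n$-cells of $\mathscr A_\Omega(X_0,\dots,X_n)$, there is an $(n+1)$-cell $f\to g$ in $\mathscr A_\Omega(X_0,\ldots,X_{n+1})$. A unital section of $X$ is a linear map $\iota:\overline X\to\mathscr A_\Omega(X)$ (compatible with sources, targets and identities) with $\pi\iota=\mathrm{id}$ and $\iota(1)=1$; write $\widehat a=\iota\pi(a)$. An $\iota$-contraction $\sigma$ of $X$ is a homotopy from $\mathrm{id}$ to $\iota\pi$: linear maps $a\mapsto\sigma_a$ from $k$-cells to $(k+1)$-cells of $\mathscr A_\Omega(X)$, $k\ge0$, such that $\sigma_a:a\to\widehat a$ for $0$-cells $a$;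 for each $n$-cell $a$, $n\ge1$, $s(\sigma_a)=a\star_0\sigma_{t_0(a)}\star_1\cdots\star_{n-1}\sigma_{t_{n-1}(a)}$ (bracketed from the left) and $t(\sigma_a)=\sigma_{s_{n-1}(a)}\star_{n-1}\cdots\star_1\sigma_{s_0(a)}\star_0\widehat a$ (bracketed from the right); $\sigma_{1_a}=1_{\sigma_a}$; and $\sigma_a=1_a$ for every cell $a$ in the image of $\iota$ or of $\sigma$. It is right and bracketed if for all $n\ge0$, all $n$-cells $f,g,h$ with $0$-sources $a,b,c$, all $v\in Z^\Omega$ and all $\tau\in\Omega$: $\sigma_{fg}=a\sigma_g\star_0\sigma_{f\widehat b}$ and $\sigma_{\lfloor h\rfloor_\tau v}=\lfloor\sigma_h\rfloor_\tau v\star_0\sigma_{\lfloor\widehat c\rfloor_\tau v}$. *)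

theory Defs
  imports "HOL-Library.Poly_Mapping" "HOL-Algebra.Module" "HOL-Algebra.QuotRing"
begin

section \<open>Free \<open>\<Omega>\<close>-monoids\<close>

datatype ('z, 'o) letter = Var 'z | Br 'o "('z, 'o) omon"
  and ('z, 'o) omon = Word "('z, 'o) letter list"

primrec letters :: "('z, 'o) omon \<Rightarrow> ('z, 'o) letter list" where
  "letters (Word w) = w"

text \<open>Concatenation is written additively, so that \<open>omon \<Rightarrow>\<^sub>0 'k\<close> with the convolution product
  of \<^theory>\<open>HOL-Library.Poly_Mapping\<close> is the monoid algebra.\<close>

instantiation omon :: (type, type) monoid_add
begin

definition zero_omon :: "('z, 'o) omon" where
  "zero_omon = Word []"

definition plus_omon :: "('z, 'o) omon \<Rightarrow> ('z, 'o) omon \<Rightarrow> ('z, 'o) omon" where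
  "plus_omon u v = Word (letters u @ letters v)"

instance
proof
  fix a b c :: "('z, 'o) omon"
  show "a + b + c = a + (b + c)" by (simp add: plus_omon_def)
  show "0 + a = a" by (cases a) (simp add: plus_omon_def zero_omon_def)
  show "a + 0 = a" by (cases a) (simp add: plus_omon_def zero_omon_def)
qed

end

definition bracket :: "'o \<Rightarrow> ('z, 'o) omon \<Rightarrow> ('z, 'o) omon" where
  "bracket \<tau> u = Word [Br \<tau> u]"

primrec omon_upto :: "'z set \<Rightarrow> 'o set \<Rightarrow> nat \<Rightarrow> ('z, 'o) omon set" where
  "omon_upto Z \<Omega> 0 = {Word w | w. set w \<subseteq> Var ` Z}"
| "omon_upto Z \<Omega> (Suc n) =
     {Word w | w. set w \<subseteq> Var ` Z \<union> {Br \<tau> u | \<tau> u. \<tau> \<in> \<Omega> \<and> u \<in> omon_upto Z \<Omega> n}}"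

definition free_omon :: "'z set \<Rightarrow> 'o set \<Rightarrow> ('z, 'o) omon set" where
  "free_omon Z \<Omega> = (\<Union>n. omon_upto Z \<Omega> n)"

definition lin_bracket ::
    "'o \<Rightarrow> (('z, 'o) omon \<Rightarrow>\<^sub>0 'k) \<Rightarrow> (('z, 'o) omon \<Rightarrow>\<^sub>0 'k::comm_monoid_add)" where
  "lin_bracket \<tau> p = (\<Sum>u\<in>Poly_Mapping.keys p.
     Poly_Mapping.single (bracket \<tau> u) (Poly_Mapping.lookup p u))"


section \<open>\<open>\<Omega>\<close>-algebras\<close>

record ('k, 'a, 'o) omega_alg = "('k, 'a) module" +
  oper :: "'o \<Rightarrow> 'a \<Rightarrow> 'a"

definition linear_map ::
    "('k, 'a, 'm) module_scheme \<Rightarrow> ('k, 'b, 'n) module_scheme \<Rightarrow> ('a \<Rightarrow> 'b) \<Rightarrow> bool" where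
  "linear_map A B f \<longleftrightarrow>
     (\<forall>a\<in>carrier A. f a \<in> carrier B) \<and>
     (\<forall>a\<in>carrier A. \<forall>b\<in>carrier A. f (a \<oplus>\<^bsub>A\<^esub> b) = f a \<oplus>\<^bsub>B\<^esub> f b) \<and>
     (\<forall>c. \<forall>a\<in>carrier A. f (c \<odot>\<^bsub>A\<^esub> a) = c \<odot>\<^bsub>B\<^esub> f a)"

definition omega_isomorphic ::
    "'o set \<Rightarrow> ('k, 'a, 'o) omega_alg \<Rightarrow> ('k, 'b, 'o) omega_alg \<Rightarrow> bool" where
  "omega_isomorphic \<Omega> A B \<longleftrightarrow>
     (\<exists>\<phi>\<in>ring_iso A B. linear_map A B \<phi> \<and>
        (\<forall>\<tau>\<in>\<Omega>. \<forall>a\<in>carrier A. \<phi> (oper A \<tau> a) = oper B \<tau> (\<phi> a)))"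

definition omega_ideal :: "'o set \<Rightarrow> ('k, 'a, 'o) omega_alg \<Rightarrow> 'a set \<Rightarrow> bool" where
  "omega_ideal \<Omega> A I \<longleftrightarrow> ideal I A \<and>
     (\<forall>c. \<forall>a\<in>I. c \<odot>\<^bsub>A\<^esub> a \<in> I) \<and> (\<forall>\<tau>\<in>\<Omega>. \<forall>a\<in>I. oper A \<tau> a \<in> I)"

definition gen_omega_ideal :: "'o set \<Rightarrow> ('k, 'a, 'o) omega_alg \<Rightarrow> 'a set \<Rightarrow> 'a set" where
  "gen_omega_ideal \<Omega> A S = \<Inter>{I. omega_ideal \<Omega> A I \<and> S \<subseteq> I}"

definition omega_quot ::
    "('k, 'a, 'o) omega_alg \<Rightarrow> 'a set \<Rightarrow> ('k, 'a set, 'o) omega_alg" where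
  "omega_quot A I =
     \<lparr>carrier = carrier (A Quot I), mult = mult (A Quot I), one = one (A Quot I),
      zero = zero (A Quot I), add = add (A Quot I),
      smult = (\<lambda>c C. \<Union>a\<in>C. I +>\<^bsub>A\<^esub> (c \<odot>\<^bsub>A\<^esub> a)),
      oper = (\<lambda>\<tau> C. \<Union>a\<in>C. I +>\<^bsub>A\<^esub> (oper A \<tau> a))\<rparr>"


section \<open>Strict higher categories internal to \<open>\<Omega>\<close>-algebras\<close>

text \<open>\<open>level A k\<close> is the \<open>\<Omega>\<close>-algebra of \<open>k\<close>-cells, \<open>src A k\<close> and \<open>tgt A k\<close> map \<open>(k+1)\<close>-cells to
  \<open>k\<close>-cells, \<open>idt A k\<close> maps \<open>k\<close>-cells to their identity \<open>(k+1)\<close>-cells, and \<open>cmp A m k\<close> is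
  the composition \<open>\<star>\<^sub>k\<close> of \<open>m\<close>-cells, for \<open>k < m\<close>.  The record is used both for \<open>\<omega>\<close>-algebras and
  for \<open>n\<close>-algebras; in the latter case only the components concerning cells of dimension at most
  \<open>n\<close> are meaningful.\<close>

record ('k, 'a, 'o) higher_alg =
  level :: "nat \<Rightarrow> ('k, 'a, 'o) omega_alg"
  src :: "nat \<Rightarrow> 'a \<Rightarrow> 'a"
  tgt :: "nat \<Rightarrow> 'a \<Rightarrow> 'a"
  idt :: "nat \<Rightarrow> 'a \<Rightarrow> 'a"
  cmp :: "nat \<Rightarrow> nat \<Rightarrow> 'a \<Rightarrow> 'a \<Rightarrow> 'a"

abbreviation cells :: "('k, 'a, 'o) higher_alg \<Rightarrow> nat \<Rightarrow> 'a set" where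
  "cells A k \<equiv> carrier (level A k)"

text \<open>For an \<open>m\<close>-cell \<open>a\<close> and \<open>k \<le> m\<close>, \<open>ksrc A k m a\<close> and \<open>ktgt A k m a\<close> are its \<open>k\<close>-source
  and \<open>k\<close>-target; for a \<open>k\<close>-cell \<open>a\<close>, \<open>lift A k m a\<close> is the iterated identity of dimension \<open>m\<close>.\<close>

primrec ksrc :: "('k, 'a, 'o) higher_alg \<Rightarrow> nat \<Rightarrow> nat \<Rightarrow> 'a \<Rightarrow> 'a" where
  "ksrc A k 0 = (\<lambda>a. a)"
| "ksrc A k (Suc m) = (\<lambda>a. if k \<le> m then ksrc A k m (src A m a) else a)"

primrec ktgt :: "('k, 'a, 'o) higher_alg \<Rightarrow> nat \<Rightarrow> nat \<Rightarrow> 'a \<Rightarrow> 'a" where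
  "ktgt A k 0 = (\<lambda>a. a)"
| "ktgt A k (Suc m) = (\<lambda>a. if k \<le> m then ktgt A k m (tgt A m a) else a)"

primrec lift :: "('k, 'a, 'o) higher_alg \<Rightarrow> nat \<Rightarrow> nat \<Rightarrow> 'a \<Rightarrow> 'a" where
  "lift A k 0 = (\<lambda>a. a)"
| "lift A k (Suc m) = (\<lambda>a. if k \<le> m then idt A m (lift A k m a) else a)"

definition parallel :: "('k, 'a, 'o) higher_alg \<Rightarrow> nat \<Rightarrow> 'a \<Rightarrow> 'a \<Rightarrow> bool" where
  "parallel A n f g \<longleftrightarrow>
     (\<forall>m. n = Suc m \<longrightarrow> src A m f = src A m g \<and> tgt A m f = tgt A m g)"

definition cellular_extension ::
    "nat \<Rightarrow> ('k, 'a, 'o) higher_alg \<Rightarrow> 'y set \<Rightarrow> ('y \<Rightarrow> 'a) \<Rightarrow> ('y \<Rightarrow> 'a) \<Rightarrow> bool" where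
  "cellular_extension n A Y s t \<longleftrightarrow>
     (\<forall>y\<in>Y. s y \<in> cells A n \<and> t y \<in> cells A n \<and> parallel A n (s y) (t y))"

text \<open>An \<open>\<Omega>\<close>-algebra seen as an \<open>\<omega>\<close>-algebra all of whose higher cells are identities.\<close>

definition discrete :: "('k, 'a, 'o) omega_alg \<Rightarrow> ('k, 'a, 'o) higher_alg" where
  "discrete B = \<lparr>level = (\<lambda>k. B), src = (\<lambda>k a. a), tgt = (\<lambda>k a. a), idt = (\<lambda>k a. a),
     cmp = (\<lambda>m k a b. a)\<rparr>"

definition globular_linear_map ::
    "('k, 'a, 'o) higher_alg \<Rightarrow> ('k, 'b, 'o) higher_alg \<Rightarrow> (nat \<Rightarrow> 'a \<Rightarrow> 'b) \<Rightarrow> bool" where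
  "globular_linear_map A B f \<longleftrightarrow>
     (\<forall>n. linear_map (level A n) (level B n) (f n)) \<and>
     (\<forall>n. \<forall>a\<in>cells A (Suc n). src B n (f (Suc n) a) = f n (src A n a)) \<and>
     (\<forall>n. \<forall>a\<in>cells A (Suc n). tgt B n (f (Suc n) a) = f n (tgt A n a)) \<and>
     (\<forall>n. \<forall>a\<in>cells A n. f (Suc n) (idt A n a) = idt B n (f n a))"


section \<open>Free extensions\<close>

text \<open>All cells of all the free \<open>n\<close>-algebras below live in the single type \<open>('z, 'o, 'k, 'x) cell\<close>:
  a \<open>0\<close>-cell is a singleton \<open>{Pol p}\<close> with \<open>p\<close> a linear combination of monomials, and an
  \<open>(n+1)\<close>-cell is an equivalence class of terms, where \<open>Idt u\<close> stands for the identity of the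
  \<open>n\<close>-cell to which the term \<open>u\<close> belongs, and \<open>Gen y\<close> for a generating \<open>(n+1)\<close>-cell.\<close>

datatype ('p, 'o, 'k, 'x) raw_tm =
    Pol 'p
  | Idt "('p, 'o, 'k, 'x) raw_tm"
  | Gen 'x
  | Add "('p, 'o, 'k, 'x) raw_tm" "('p, 'o, 'k, 'x) raw_tm"
  | Scl 'k "('p, 'o, 'k, 'x) raw_tm"
  | Mul "('p, 'o, 'k, 'x) raw_tm" "('p, 'o, 'k, 'x) raw_tm"
  | Opr 'o "('p, 'o, 'k, 'x) raw_tm"
  | Cmp nat "('p, 'o, 'k, 'x) raw_tm" "('p, 'o, 'k, 'x) raw_tm"

type_synonym ('z, 'o, 'k, 'x) tm = "(('z, 'o) omon \<Rightarrow>\<^sub>0 'k, 'o, 'k, 'x) raw_tm"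

type_synonym ('z, 'o, 'k, 'x) cell = "('z, 'o, 'k, 'x) tm set"

definition pol_cell :: "(('z, 'o) omon \<Rightarrow>\<^sub>0 'k::zero) \<Rightarrow> ('z, 'o, 'k, 'x) cell" where
  "pol_cell p = {Pol p}"

definition mon_cell :: "('z, 'o) omon \<Rightarrow> ('z, 'o, 'k::zero_neq_one, 'x) cell" where
  "mon_cell u = pol_cell (Poly_Mapping.single u 1)"

definition free_omega_alg ::
    "'z set \<Rightarrow> 'o set \<Rightarrow> ('k::field_char_0, ('z, 'o, 'k, 'x) cell, 'o) omega_alg" where
  "free_omega_alg Z \<Omega> =
     \<lparr>carrier = {pol_cell p | p. Poly_Mapping.keys p \<subseteq> free_omon Z \<Omega>},
      mult = (\<lambda>a b. {Pol (p * q) | p q. Pol p \<in> a \<and> Pol q \<in> b}),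
      one = mon_cell 0,
      zero = pol_cell 0,
      add = (\<lambda>a b. {Pol (p + q) | p q. Pol p \<in> a \<and> Pol q \<in> b}),
      smult = (\<lambda>c a. {Pol (Poly_Mapping.map ((*) c) p) | p. Pol p \<in> a}),
      oper = (\<lambda>\<tau> a. {Pol (lin_bracket \<tau> p) | p. Pol p \<in> a})\<rparr>"

text \<open>The free \<open>(n+1)\<close>-algebra \<open>A[Y]\<close> on an \<open>n\<close>-algebra \<open>A\<close> with a cellular extension \<open>Y\<close>, whose
  boundary maps are \<open>s\<close> and \<open>t\<close>: cells of dimension at most \<open>n\<close> are those of \<open>A\<close>, and \<open>(n+1)\<close>-cells
  are the well-formed terms modulo the least congruence imposing the axioms of an
  \<open>(n+1)\<close>-algebra.\<close>

context
  fixes \<Omega> :: "'o set" and n :: nat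
    and A :: "('k::field_char_0, ('z, 'o, 'k, 'x) cell, 'o) higher_alg"
    and Y :: "'x set" and s t :: "'x \<Rightarrow> ('z, 'o, 'k, 'x) cell"
begin

definition cell_of :: "('z, 'o, 'k, 'x) tm \<Rightarrow> ('z, 'o, 'k, 'x) cell" where
  "cell_of u = (THE a. a \<in> cells A n \<and> u \<in> a)"

text \<open>The \<open>n\<close>-source and \<open>n\<close>-target in \<open>A\<close> of the \<open>(n+1)\<close>-cell denoted by a term.\<close>

primrec tm_src :: "('z, 'o, 'k, 'x) tm \<Rightarrow> ('z, 'o, 'k, 'x) cell" where
  "tm_src (Pol p) = {}"
| "tm_src (Idt u) = cell_of u"
| "tm_src (Gen y) = s y"
| "tm_src (Add f g) = tm_src f \<oplus>\<^bsub>level A n\<^esub> tm_src g"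
| "tm_src (Scl c f) = c \<odot>\<^bsub>level A n\<^esub> tm_src f"
| "tm_src (Mul f g) = tm_src f \<otimes>\<^bsub>level A n\<^esub> tm_src g"
| "tm_src (Opr \<tau> f) = oper (level A n) \<tau> (tm_src f)"
| "tm_src (Cmp k f g) = (if k = n then tm_src f else cmp A n k (tm_src f) (tm_src g))"

primrec tm_tgt :: "('z, 'o, 'k, 'x) tm \<Rightarrow> ('z, 'o, 'k, 'x) cell" where
  "tm_tgt (Pol p) = {}"
| "tm_tgt (Idt u) = cell_of u"
| "tm_tgt (Gen y) = t y"
| "tm_tgt (Add f g) = tm_tgt f \<oplus>\<^bsub>level A n\<^esub> tm_tgt g"
| "tm_tgt (Scl c f) = c \<odot>\<^bsub>level A n\<^esub> tm_tgt f"
| "tm_tgt (Mul f g) = tm_tgt f \<otimes>\<^bsub>level A n\<^esub> tm_tgt g"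
| "tm_tgt (Opr \<tau> f) = oper (level A n) \<tau> (tm_tgt f)"
| "tm_tgt (Cmp k f g) = (if k = n then tm_tgt g else cmp A n k (tm_tgt f) (tm_tgt g))"

primrec tm_ok :: "('z, 'o, 'k, 'x) tm \<Rightarrow> bool" where
  "tm_ok (Pol p) \<longleftrightarrow> False"
| "tm_ok (Idt u) \<longleftrightarrow> (\<exists>a\<in>cells A n. u \<in> a)"
| "tm_ok (Gen y) \<longleftrightarrow> y \<in> Y"
| "tm_ok (Add f g) \<longleftrightarrow> tm_ok f \<and> tm_ok g"
| "tm_ok (Scl c f) \<longleftrightarrow> tm_ok f"
| "tm_ok (Mul f g) \<longleftrightarrow> tm_ok f \<and> tm_ok g"
| "tm_ok (Opr \<tau> f) \<longleftrightarrow> \<tau> \<in> \<Omega> \<and> tm_ok f"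
| "tm_ok (Cmp k f g) \<longleftrightarrow> tm_ok f \<and> tm_ok g \<and> k \<le> n \<and>
     ktgt A k n (tm_tgt f) = ksrc A k n (tm_src g)"

inductive tm_eq :: "('z, 'o, 'k, 'x) tm \<Rightarrow> ('z, 'o, 'k, 'x) tm \<Rightarrow> bool"  (infix \<open>\<approx>\<close> 50) where
  refl: "tm_ok f \<Longrightarrow> f \<approx> f"
| sym: "f \<approx> g \<Longrightarrow> g \<approx> f"
| trans: "f \<approx> g \<Longrightarrow> g \<approx> h \<Longrightarrow> f \<approx> h"
  \<comment> \<open>congruence\<close>
| cong_add: "f \<approx> f' \<Longrightarrow> g \<approx> g' \<Longrightarrow> Add f g \<approx> Add f' g'"
| cong_scl: "f \<approx> f' \<Longrightarrow> Scl c f \<approx> Scl c f'"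
| cong_mul: "f \<approx> f' \<Longrightarrow> g \<approx> g' \<Longrightarrow> Mul f g \<approx> Mul f' g'"
| cong_opr: "\<tau> \<in> \<Omega> \<Longrightarrow> f \<approx> f' \<Longrightarrow> Opr \<tau> f \<approx> Opr \<tau> f'"
| cong_cmp: "f \<approx> f' \<Longrightarrow> g \<approx> g' \<Longrightarrow> tm_ok (Cmp k f g) \<Longrightarrow> tm_ok (Cmp k f' g') \<Longrightarrow>
    Cmp k f g \<approx> Cmp k f' g'"
  \<comment> \<open>taking identities is a well-defined morphism compatible with the compositions of \<open>A\<close>\<close>
| idt_eq: "a \<in> cells A n \<Longrightarrow> u \<in> a \<Longrightarrow> v \<in> a \<Longrightarrow> Idt u \<approx> Idt v"
| idt_add: "a \<in> cells A n \<Longrightarrow> b \<in> cells A n \<Longrightarrow> u \<in> a \<Longrightarrow> v \<in> b \<Longrightarrow>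
    w \<in> a \<oplus>\<^bsub>level A n\<^esub> b \<Longrightarrow> Add (Idt u) (Idt v) \<approx> Idt w"
| idt_scl: "a \<in> cells A n \<Longrightarrow> u \<in> a \<Longrightarrow> w \<in> c \<odot>\<^bsub>level A n\<^esub> a \<Longrightarrow> Scl c (Idt u) \<approx> Idt w"
| idt_mul: "a \<in> cells A n \<Longrightarrow> b \<in> cells A n \<Longrightarrow> u \<in> a \<Longrightarrow> v \<in> b \<Longrightarrow>
    w \<in> a \<otimes>\<^bsub>level A n\<^esub> b \<Longrightarrow> Mul (Idt u) (Idt v) \<approx> Idt w"
| idt_opr: "\<tau> \<in> \<Omega> \<Longrightarrow> a \<in> cells A n \<Longrightarrow> u \<in> a \<Longrightarrow> w \<in> oper (level A n) \<tau> a \<Longrightarrow>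
    Opr \<tau> (Idt u) \<approx> Idt w"
| idt_cmp: "k < n \<Longrightarrow> a \<in> cells A n \<Longrightarrow> b \<in> cells A n \<Longrightarrow> ktgt A k n a = ksrc A k n b \<Longrightarrow>
    u \<in> a \<Longrightarrow> v \<in> b \<Longrightarrow> w \<in> cmp A n k a b \<Longrightarrow> Cmp k (Idt u) (Idt v) \<approx> Idt w"
  \<comment> \<open>\<open>\<Omega>\<close>-algebra axioms\<close>
| add_assoc: "tm_ok f \<Longrightarrow> tm_ok g \<Longrightarrow> tm_ok h \<Longrightarrow> Add (Add f g) h \<approx> Add f (Add g h)"
| add_comm: "tm_ok f \<Longrightarrow> tm_ok g \<Longrightarrow> Add f g \<approx> Add g f"
| add_zero: "tm_ok f \<Longrightarrow> u \<in> \<zero>\<^bsub>level A n\<^esub> \<Longrightarrow> Add f (Idt u) \<approx> f"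
| add_neg: "tm_ok f \<Longrightarrow> u \<in> \<zero>\<^bsub>level A n\<^esub> \<Longrightarrow> Add f (Scl (- 1) f) \<approx> Idt u"
| scl_add_right: "tm_ok f \<Longrightarrow> tm_ok g \<Longrightarrow> Scl c (Add f g) \<approx> Add (Scl c f) (Scl c g)"
| scl_add_left: "tm_ok f \<Longrightarrow> Scl (c + d) f \<approx> Add (Scl c f) (Scl d f)"
| scl_scl: "tm_ok f \<Longrightarrow> Scl (c * d) f \<approx> Scl c (Scl d f)"
| scl_one: "tm_ok f \<Longrightarrow> Scl 1 f \<approx> f"
| mul_assoc: "tm_ok f \<Longrightarrow> tm_ok g \<Longrightarrow> tm_ok h \<Longrightarrow> Mul (Mul f g) h \<approx> Mul f (Mul g h)"
| mul_one_left: "tm_ok f \<Longrightarrow> u \<in> \<one>\<^bsub>level A n\<^esub> \<Longrightarrow> Mul (Idt u) f \<approx> f"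
| mul_one_right: "tm_ok f \<Longrightarrow> u \<in> \<one>\<^bsub>level A n\<^esub> \<Longrightarrow> Mul f (Idt u) \<approx> f"
| mul_add_left: "tm_ok f \<Longrightarrow> tm_ok g \<Longrightarrow> tm_ok h \<Longrightarrow> Mul (Add f g) h \<approx> Add (Mul f h) (Mul g h)"
| mul_add_right: "tm_ok f \<Longrightarrow> tm_ok g \<Longrightarrow> tm_ok h \<Longrightarrow> Mul f (Add g h) \<approx> Add (Mul f g) (Mul f h)"
| mul_scl_left: "tm_ok f \<Longrightarrow> tm_ok g \<Longrightarrow> Mul (Scl c f) g \<approx> Scl c (Mul f g)"
| mul_scl_right: "tm_ok f \<Longrightarrow> tm_ok g \<Longrightarrow> Mul f (Scl c g) \<approx> Scl c (Mul f g)"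
| opr_add: "\<tau> \<in> \<Omega> \<Longrightarrow> tm_ok f \<Longrightarrow> tm_ok g \<Longrightarrow> Opr \<tau> (Add f g) \<approx> Add (Opr \<tau> f) (Opr \<tau> g)"
| opr_scl: "\<tau> \<in> \<Omega> \<Longrightarrow> tm_ok f \<Longrightarrow> Opr \<tau> (Scl c f) \<approx> Scl c (Opr \<tau> f)"
  \<comment> \<open>category axioms\<close>
| cmp_idt_left: "tm_ok f \<Longrightarrow> k \<le> n \<Longrightarrow> u \<in> lift A k n (ksrc A k n (tm_src f)) \<Longrightarrow>
    Cmp k (Idt u) f \<approx> f"
| cmp_idt_right: "tm_ok f \<Longrightarrow> k \<le> n \<Longrightarrow> u \<in> lift A k n (ktgt A k n (tm_tgt f)) \<Longrightarrow>
    Cmp k f (Idt u) \<approx> f"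
| cmp_assoc: "tm_ok (Cmp k (Cmp k f g) h) \<Longrightarrow> tm_ok (Cmp k f (Cmp k g h)) \<Longrightarrow>
    Cmp k (Cmp k f g) h \<approx> Cmp k f (Cmp k g h)"
| exchange: "l < k \<Longrightarrow> tm_ok (Cmp l (Cmp k f g) (Cmp k f' g')) \<Longrightarrow>
    tm_ok (Cmp k (Cmp l f f') (Cmp l g g')) \<Longrightarrow>
    Cmp l (Cmp k f g) (Cmp k f' g') \<approx> Cmp k (Cmp l f f') (Cmp l g g')"
  \<comment> \<open>compositions are morphisms of \<open>\<Omega>\<close>-algebras\<close>
| cmp_add: "tm_ok (Cmp k f g) \<Longrightarrow> tm_ok (Cmp k f' g') \<Longrightarrow> tm_ok (Cmp k (Add f f') (Add g g')) \<Longrightarrow>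
    Cmp k (Add f f') (Add g g') \<approx> Add (Cmp k f g) (Cmp k f' g')"
| cmp_scl: "tm_ok (Cmp k f g) \<Longrightarrow> tm_ok (Cmp k (Scl c f) (Scl c g)) \<Longrightarrow>
    Cmp k (Scl c f) (Scl c g) \<approx> Scl c (Cmp k f g)"
| cmp_mul: "tm_ok (Cmp k f g) \<Longrightarrow> tm_ok (Cmp k f' g') \<Longrightarrow> tm_ok (Cmp k (Mul f f') (Mul g g')) \<Longrightarrow>
    Cmp k (Mul f f') (Mul g g') \<approx> Mul (Cmp k f g) (Cmp k f' g')"
| cmp_opr: "\<tau> \<in> \<Omega> \<Longrightarrow> tm_ok (Cmp k f g) \<Longrightarrow> tm_ok (Cmp k (Opr \<tau> f) (Opr \<tau> g)) \<Longrightarrow>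
    Cmp k (Opr \<tau> f) (Opr \<tau> g) \<approx> Opr \<tau> (Cmp k f g)"

definition tm_class :: "('z, 'o, 'k, 'x) tm \<Rightarrow> ('z, 'o, 'k, 'x) cell" where
  "tm_class f = {g. f \<approx> g}"

definition new_level :: "('k, ('z, 'o, 'k, 'x) cell, 'o) omega_alg" where
  "new_level =
     \<lparr>carrier = {tm_class f | f. tm_ok f},
      mult = (\<lambda>a b. \<Union>f\<in>a. \<Union>g\<in>b. tm_class (Mul f g)),
      one = (\<Union>u\<in>\<one>\<^bsub>level A n\<^esub>. tm_class (Idt u)),
      zero = (\<Union>u\<in>\<zero>\<^bsub>level A n\<^esub>. tm_class (Idt u)),
      add = (\<lambda>a b. \<Union>f\<in>a. \<Union>g\<in>b. tm_class (Add f g)),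
      smult = (\<lambda>c a. \<Union>f\<in>a. tm_class (Scl c f)),
      oper = (\<lambda>\<tau> a. \<Union>f\<in>a. tm_class (Opr \<tau> f))\<rparr>"

definition adjoin :: "('k, ('z, 'o, 'k, 'x) cell, 'o) higher_alg" where
  "adjoin =
     \<lparr>level = (level A)(Suc n := new_level),
      src = (src A)(n := (\<lambda>a. tm_src (SOME f. f \<in> a))),
      tgt = (tgt A)(n := (\<lambda>a. tm_tgt (SOME f. f \<in> a))),
      idt = (idt A)(n := (\<lambda>a. \<Union>u\<in>a. tm_class (Idt u))),
      cmp = (cmp A)(Suc n := (\<lambda>k a b. \<Union>f\<in>a. \<Union>g\<in>b. tm_class (Cmp k f g)))\<rparr>"

end


section \<open>Polygraphs\<close>

text \<open>\<open>gens P n\<close> is the set \<open>X\<^sub>n\<close> of generating \<open>n\<close>-cells, for \<open>n \<ge> 1\<close>, with boundary maps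
  \<open>gsrc P n\<close> and \<open>gtgt P n\<close> into the \<open>(n-1)\<close>-cells; the values at \<open>n = 0\<close> are irrelevant.\<close>

record ('z, 'x, 'c) raw_polygraph =
  gens0 :: "'z set"
  gens :: "nat \<Rightarrow> 'x set"
  gsrc :: "nat \<Rightarrow> 'x \<Rightarrow> 'c"
  gtgt :: "nat \<Rightarrow> 'x \<Rightarrow> 'c"

type_synonym ('z, 'o, 'k, 'x) polygraph = "('z, 'x, ('z, 'o, 'k, 'x) cell) raw_polygraph"

primrec free_n_alg :: "'o set \<Rightarrow> ('z, 'o, 'k::field_char_0, 'x) polygraph \<Rightarrow> nat \<Rightarrow>
    ('k, ('z, 'o, 'k, 'x) cell, 'o) higher_alg" where
  "free_n_alg \<Omega> P 0 = discrete (free_omega_alg (gens0 P) \<Omega>)"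
| "free_n_alg \<Omega> P (Suc n) =
     adjoin \<Omega> n (free_n_alg \<Omega> P n) (gens P (Suc n)) (gsrc P (Suc n)) (gtgt P (Suc n))"

definition free_\<omega>_alg :: "'o set \<Rightarrow> ('z, 'o, 'k::field_char_0, 'x) polygraph \<Rightarrow>
    ('k, ('z, 'o, 'k, 'x) cell, 'o) higher_alg" where
  "free_\<omega>_alg \<Omega> P =
     \<lparr>level = (\<lambda>k. level (free_n_alg \<Omega> P k) k),
      src = (\<lambda>k. src (free_n_alg \<Omega> P (Suc k)) k),
      tgt = (\<lambda>k. tgt (free_n_alg \<Omega> P (Suc k)) k),
      idt = (\<lambda>k. idt (free_n_alg \<Omega> P (Suc k)) k),
      cmp = (\<lambda>m. cmp (free_n_alg \<Omega> P m) m)\<rparr>"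

definition left_monomial :: "'o set \<Rightarrow> ('z, 'o, 'k::field_char_0, 'x) polygraph \<Rightarrow> bool" where
  "left_monomial \<Omega> P \<longleftrightarrow>
     (\<forall>\<alpha>\<in>gens P 1. \<exists>u\<in>free_omon (gens0 P) \<Omega>. \<exists>p.
        gsrc P 1 \<alpha> = mon_cell u \<and> gtgt P 1 \<alpha> = pol_cell p \<and> u \<notin> Poly_Mapping.keys p)"

text \<open>Polygraphs are left-monomial by convention.\<close>

definition omega_polygraph :: "'o set \<Rightarrow> ('z, 'o, 'k::field_char_0, 'x) polygraph \<Rightarrow> bool" where
  "omega_polygraph \<Omega> P \<longleftrightarrow>
     (\<forall>n. cellular_extension n (free_n_alg \<Omega> P n)
            (gens P (Suc n)) (gsrc P (Suc n)) (gtgt P (Suc n))) \<and>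
     left_monomial \<Omega> P"

definition rel_ideal ::
    "'o set \<Rightarrow> ('z, 'o, 'k::field_char_0, 'x) polygraph \<Rightarrow> ('z, 'o, 'k, 'x) cell set" where
  "rel_ideal \<Omega> P =
     (let A0 = free_omega_alg (gens0 P) \<Omega>
      in gen_omega_ideal \<Omega> A0 {gsrc P 1 \<alpha> \<ominus>\<^bsub>A0\<^esub> gtgt P 1 \<alpha> | \<alpha>. \<alpha> \<in> gens P 1})"

definition presented_alg :: "'o set \<Rightarrow> ('z, 'o, 'k::field_char_0, 'x) polygraph \<Rightarrow>
    ('k, ('z, 'o, 'k, 'x) cell set, 'o) omega_alg" where
  "presented_alg \<Omega> P = omega_quot (free_omega_alg (gens0 P) \<Omega>) (rel_ideal \<Omega> P)"

text \<open>The projection onto \<open>discrete (presented_alg \<Omega> P)\<close>: compatibility with sources forces the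
  image of an \<open>n\<close>-cell to be (the identity of) the class of its \<open>0\<close>-source.\<close>

definition proj :: "'o set \<Rightarrow> ('z, 'o, 'k::field_char_0, 'x) polygraph \<Rightarrow> nat \<Rightarrow>
    ('z, 'o, 'k, 'x) cell \<Rightarrow> ('z, 'o, 'k, 'x) cell set" where
  "proj \<Omega> P n a =
     rel_ideal \<Omega> P +>\<^bsub>free_omega_alg (gens0 P) \<Omega>\<^esub> ksrc (free_\<omega>_alg \<Omega> P) 0 n a"

definition polygraphic_resolution :: "'o set \<Rightarrow> ('z, 'o, 'k::field_char_0, 'x) polygraph \<Rightarrow>
    ('k, 'b, 'o) omega_alg \<Rightarrow> bool" where
  "polygraphic_resolution \<Omega> P B \<longleftrightarrow>
     omega_isomorphic \<Omega> (presented_alg \<Omega> P) B \<and>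
     (\<forall>n\<ge>1. \<forall>f\<in>cells (free_n_alg \<Omega> P n) n. \<forall>g\<in>cells (free_n_alg \<Omega> P n) n.
        parallel (free_n_alg \<Omega> P n) n f g \<longrightarrow>
        (\<exists>F\<in>cells (free_n_alg \<Omega> P (Suc n)) (Suc n).
           src (free_n_alg \<Omega> P (Suc n)) n F = f \<and> tgt (free_n_alg \<Omega> P (Suc n)) n F = g))"


section \<open>Unital sections and contractions\<close>

definition unital_section :: "'o set \<Rightarrow> ('z, 'o, 'k::field_char_0, 'x) polygraph \<Rightarrow>
    (nat \<Rightarrow> ('z, 'o, 'k, 'x) cell set \<Rightarrow> ('z, 'o, 'k, 'x) cell) \<Rightarrow> bool" where
  "unital_section \<Omega> P \<iota> \<longleftrightarrow>
     globular_linear_map (discrete (presented_alg \<Omega> P)) (free_\<omega>_alg \<Omega> P) \<iota> \<and>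
     (\<forall>n. \<forall>x\<in>carrier (presented_alg \<Omega> P). proj \<Omega> P n (\<iota> n x) = x) \<and>
     \<iota> 0 \<one>\<^bsub>presented_alg \<Omega> P\<^esub> = \<one>\<^bsub>level (free_\<omega>_alg \<Omega> P) 0\<^esub>"

definition hat :: "'o set \<Rightarrow> ('z, 'o, 'k::field_char_0, 'x) polygraph \<Rightarrow>
    (nat \<Rightarrow> ('z, 'o, 'k, 'x) cell set \<Rightarrow> ('z, 'o, 'k, 'x) cell) \<Rightarrow>
    nat \<Rightarrow> ('z, 'o, 'k, 'x) cell \<Rightarrow> ('z, 'o, 'k, 'x) cell" where
  "hat \<Omega> P \<iota> n a = \<iota> n (proj \<Omega> P n a)"

text \<open>For an \<open>n\<close>-cell \<open>a\<close>: \<open>left_whisker A \<sigma> n a n\<close> is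
  \<open>(\<dots>(a \<star>\<^sub>0 \<sigma>\<^bsub>t\<^sub>0(a)\<^esub>) \<star>\<^sub>1 \<dots>) \<star>\<^bsub>n-1\<^esub> \<sigma>\<^bsub>t\<^sub>n\<^sub>-\<^sub>1(a)\<^esub>\<close> and \<open>right_whisker A \<sigma> n a b n\<close> is
  \<open>\<sigma>\<^bsub>s\<^sub>n\<^sub>-\<^sub>1(a)\<^esub> \<star>\<^bsub>n-1\<^esub> (\<dots> \<star>\<^sub>1 (\<sigma>\<^bsub>s\<^sub>0(a)\<^esub> \<star>\<^sub>0 b)\<dots>)\<close>.\<close>

primrec left_whisker :: "('k, 'a, 'o) higher_alg \<Rightarrow> (nat \<Rightarrow> 'a \<Rightarrow> 'a) \<Rightarrow> nat \<Rightarrow> 'a \<Rightarrow> nat \<Rightarrow> 'a"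
  where
  "left_whisker A \<sigma> n a 0 = a"
| "left_whisker A \<sigma> n a (Suc k) =
     cmp A n k (left_whisker A \<sigma> n a k) (lift A (Suc k) n (\<sigma> k (ktgt A k n a)))"

primrec right_whisker ::
    "('k, 'a, 'o) higher_alg \<Rightarrow> (nat \<Rightarrow> 'a \<Rightarrow> 'a) \<Rightarrow> nat \<Rightarrow> 'a \<Rightarrow> 'a \<Rightarrow> nat \<Rightarrow> 'a" where
  "right_whisker A \<sigma> n a b 0 = b"
| "right_whisker A \<sigma> n a b (Suc k) =
     cmp A n k (lift A (Suc k) n (\<sigma> k (ksrc A k n a))) (right_whisker A \<sigma> n a b k)"

text \<open>For \<open>n = 0\<close> the two boundary conditions below read \<open>\<sigma>\<^sub>a : a \<rightarrow> hat a\<close>.\<close>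

definition contraction :: "'o set \<Rightarrow> ('z, 'o, 'k::field_char_0, 'x) polygraph \<Rightarrow>
    (nat \<Rightarrow> ('z, 'o, 'k, 'x) cell set \<Rightarrow> ('z, 'o, 'k, 'x) cell) \<Rightarrow>
    (nat \<Rightarrow> ('z, 'o, 'k, 'x) cell \<Rightarrow> ('z, 'o, 'k, 'x) cell) \<Rightarrow> bool" where
  "contraction \<Omega> P \<iota> \<sigma> \<longleftrightarrow>
     (let A = free_\<omega>_alg \<Omega> P in
     (\<forall>n. linear_map (level A n) (level A (Suc n)) (\<sigma> n)) \<and>
     (\<forall>n. \<forall>a\<in>cells A n. src A n (\<sigma> n a) = left_whisker A \<sigma> n a n) \<and>
     (\<forall>n. \<forall>a\<in>cells A n. tgt A n (\<sigma> n a) = right_whisker A \<sigma> n a (hat \<Omega> P \<iota> n a) n) \<and>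
     (\<forall>n. \<forall>a\<in>cells A n. \<sigma> (Suc n) (idt A n a) = idt A (Suc n) (\<sigma> n a)) \<and>
     (\<forall>n. \<forall>x\<in>carrier (presented_alg \<Omega> P). \<sigma> n (\<iota> n x) = idt A n (\<iota> n x)) \<and>
     (\<forall>n. \<forall>a\<in>cells A n. \<sigma> (Suc n) (\<sigma> n a) = idt A (Suc n) (\<sigma> n a)))"

definition right_contraction :: "'o set \<Rightarrow> ('z, 'o, 'k::field_char_0, 'x) polygraph \<Rightarrow>
    (nat \<Rightarrow> ('z, 'o, 'k, 'x) cell set \<Rightarrow> ('z, 'o, 'k, 'x) cell) \<Rightarrow>
    (nat \<Rightarrow> ('z, 'o, 'k, 'x) cell \<Rightarrow> ('z, 'o, 'k, 'x) cell) \<Rightarrow> bool" where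
  "right_contraction \<Omega> P \<iota> \<sigma> \<longleftrightarrow>
     (let A = free_\<omega>_alg \<Omega> P in
     \<forall>n. \<forall>f\<in>cells A n. \<forall>g\<in>cells A n.
       \<sigma> n (f \<otimes>\<^bsub>level A n\<^esub> g) =
         cmp A (Suc n) 0
           (lift A 0 (Suc n) (ksrc A 0 n f) \<otimes>\<^bsub>level A (Suc n)\<^esub> \<sigma> n g)
           (\<sigma> n (f \<otimes>\<^bsub>level A n\<^esub> lift A 0 n (hat \<Omega> P \<iota> 0 (ksrc A 0 n g)))))"

definition bracketed_contraction :: "'o set \<Rightarrow> ('z, 'o, 'k::field_char_0, 'x) polygraph \<Rightarrow>
    (nat \<Rightarrow> ('z, 'o, 'k, 'x) cell set \<Rightarrow> ('z, 'o, 'k, 'x) cell) \<Rightarrow>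
    (nat \<Rightarrow> ('z, 'o, 'k, 'x) cell \<Rightarrow> ('z, 'o, 'k, 'x) cell) \<Rightarrow> bool" where
  "bracketed_contraction \<Omega> P \<iota> \<sigma> \<longleftrightarrow>
     (let A = free_\<omega>_alg \<Omega> P in
     \<forall>n. \<forall>h\<in>cells A n. \<forall>v\<in>free_omon (gens0 P) \<Omega>. \<forall>\<tau>\<in>\<Omega>.
       \<sigma> n (oper (level A n) \<tau> h \<otimes>\<^bsub>level A n\<^esub> lift A 0 n (mon_cell v)) =
         cmp A (Suc n) 0
           (oper (level A (Suc n)) \<tau> (\<sigma> n h) \<otimes>\<^bsub>level A (Suc n)\<^esub>
              lift A 0 (Suc n) (mon_cell v))
           (lift A 1 (Suc n)
              (\<sigma> 0 (oper (level A 0) \<tau> (hat \<Omega> P \<iota> 0 (ksrc A 0 n h)) \<otimes>\<^bsub>level A 0\<^esub>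
                 mon_cell v))))"

end

theory Submission
  imports Defs "HOL-Library.Extended_Nat"
begin

text \<open>
  Everything rests on the fact that the cells of each dimension form an algebra for which the
  compositions are morphisms.  Linearity alone forces
  \<open>f \<star>\<^sub>k g = f - 1\<^bsub>t\<^sub>k(f)\<^esub> + g\<close> (\<open>cmp_formula\<close>), so a composite is determined by sums, and a cell
  \<open>f \<rightarrow> g\<close> amounts to a cell \<open>0 \<rightarrow> g - f\<close>.  Multiplicativity forces \<open>x y = y x = 0\<close> whenever \<open>x\<close> has
  zero \<open>0\<close>-source and \<open>y\<close> has zero \<open>0\<close>-target (\<open>peiffer\<close>).  That the free algebras on a polygraph,
  which are built from terms modulo a congruence, satisfy the axioms of higher algebras is
  \<open>adjoin_higher_algebra\<close>.

  A contraction fills every sphere (\<open>contraction_imp_resolution\<close>).  If \<open>f\<close> and \<open>g\<close> are parallel, the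
  cells whiskered onto \<open>f\<close> in the source of \<open>\<sigma>\<^sub>f\<close> depend only on the boundary, so the sources of
  \<open>\<sigma>\<^sub>f\<close> and \<open>\<sigma>\<^sub>g\<close> differ by \<open>f - g\<close>, while their targets agree.  Hence
  \<open>\<sigma>\<^sub>f - \<sigma>\<^sub>g + 1\<^sub>g\<close> is a cell \<open>f \<rightarrow> g\<close>.

  For the converse, write \<open>\<sigma>\<^sub>a = 1\<^bsub>s(\<sigma>\<^sub>a)\<^esub> + \<delta> a\<close>.  The source of \<open>\<sigma>\<^sub>a\<close> is prescribed by the values of
  \<open>\<sigma>\<close> in lower dimensions, so only \<open>\<delta>\<close> has to be found, and the axioms of a right and bracketed
  contraction become linear conditions (\<open>reduced_contraction\<close>): \<open>\<delta> a\<close> has source \<open>0\<close>; its target is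
  \<open>hat a - a\<close> for a \<open>0\<close>-cell and \<open>1\<^bsub>s(a)\<^esub> - a + \<delta>(s(a) - t(a))\<close> in higher dimensions; \<open>\<delta>\<close> vanishes on
  identities, on the image of \<open>\<iota>\<close> and on its own values; and
  \<open>\<delta>(f g) = s\<^sub>0(f) \<delta>(g) + \<delta>(f hat(s\<^sub>0(g)))\<close>, with a similar formula for brackets.

  On \<open>0\<close>-cells, the targets of the \<open>1\<close>-cells with source \<open>0\<close> are exactly the relations
  (\<open>I_boundary\<close>, \<open>boundary_diff_I\<close>), so some \<open>1\<close>-cell \<open>0 \<rightarrow> hat u - u\<close> exists for every monomial \<open>u\<close>.  These are
  assembled into a multiplicative choice by recursion on the letters of words (\<open>zero_homotopy\<close>).

  In dimension \<open>n + 1\<close> the prescribed target \<open>D a\<close> is a cycle, and \<open>D\<close> satisfies by itself the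
  formulas required of \<open>\<delta>\<close> for products and brackets (\<open>D_mult\<close>, \<open>D_oper\<close>).  A resolution provides fillers
  of \<open>D(y u)\<close> for generating cells \<open>y\<close> and monomials \<open>u\<close>, and the product formula dictates the value on
  every other term.  This respects the congruence defining the cells (\<open>\<Delta>_eqv\<close>), the point being
  that two \<open>0\<close>-cells joined by a \<open>1\<close>-cell act in the same way on cells with zero \<open>0\<close>-source and
  \<open>0\<close>-target (\<open>I_kills\<close>).  The resulting map need not vanish on the values of \<open>\<delta>\<close>; since \<open>D\<close>
  kills them and \<open>D D = - D\<close>, replacing \<open>\<delta>' a\<close> by \<open>- \<delta>'(D a)\<close> repairs this without changing targets.
\<close>

section \<open>Algebras with operators\<close>

context ring
begin

text \<open>A normal form for identities in a ring: the rules collected below in \<open>group_simps\<close>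
  move all negative terms to the other side of the equation; both sides are then sums of products, which
  associative-commutative rewriting compares.\<close>

lemma diff_simps:
  assumes "x \<in> carrier R" "y \<in> carrier R" "z \<in> carrier R"
  shows "(x \<ominus> y) \<oplus> z = (x \<oplus> z) \<ominus> y" "x \<oplus> (y \<ominus> z) = (x \<oplus> y) \<ominus> z"
    "(x \<ominus> y) \<ominus> z = x \<ominus> (y \<oplus> z)" "x \<ominus> (y \<ominus> z) = (x \<oplus> z) \<ominus> y"
    "(x \<ominus> y) \<otimes> z = x \<otimes> z \<ominus> y \<otimes> z" "z \<otimes> (x \<ominus> y) = z \<otimes> x \<ominus> z \<otimes> y"
  using assms by algebra+

lemma diff_eq_iff:
  assumes "x \<in> carrier R" "y \<in> carrier R" "z \<in> carrier R"
  shows "x \<ominus> y = z \<longleftrightarrow> x = z \<oplus> y" "z = x \<ominus> y \<longleftrightarrow> z \<oplus> y = x"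
proof -
  have 1: "(x \<ominus> y) \<oplus> y = x" "(z \<oplus> y) \<ominus> y = z" using assms by algebra+
  then show "x \<ominus> y = z \<longleftrightarrow> x = z \<oplus> y" "z = x \<ominus> y \<longleftrightarrow> z \<oplus> y = x" by metis+
qed

lemma minus_as_diff: "x \<in> carrier R \<Longrightarrow> \<ominus> x = \<zero> \<ominus> x"
  by algebra

lemmas group_simps = diff_simps diff_eq_iff minus_as_diff l_distr r_distr m_assoc a_assoc a_comm a_lcomm

lemma add_diff_diff:
  "a \<in> carrier R \<Longrightarrow> b \<in> carrier R \<Longrightarrow> c \<in> carrier R \<Longrightarrow> d \<in> carrier R \<Longrightarrow>
    (a \<ominus> b) \<oplus> (c \<ominus> d) = (a \<oplus> c) \<ominus> (b \<oplus> d)"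
  by (simp add: group_simps)

end

locale omega_algebra = ring A
  for A :: "('k::field_char_0, 'a, 'o) omega_alg" (structure) +
  fixes \<Omega> :: "'o set"
  assumes smult_closed: "a \<in> carrier A \<Longrightarrow> c \<odot> a \<in> carrier A"
    and smult_r_distr: "a \<in> carrier A \<Longrightarrow> b \<in> carrier A \<Longrightarrow> c \<odot> (a \<oplus> b) = c \<odot> a \<oplus> c \<odot> b"
    and smult_l_distr: "a \<in> carrier A \<Longrightarrow> (c + d) \<odot> a = c \<odot> a \<oplus> d \<odot> a"
    and smult_assoc: "a \<in> carrier A \<Longrightarrow> (c * d) \<odot> a = c \<odot> (d \<odot> a)"
    and smult_one: "a \<in> carrier A \<Longrightarrow> 1 \<odot> a = a"
    and smult_mult_l: "a \<in> carrier A \<Longrightarrow> b \<in> carrier A \<Longrightarrow> (c \<odot> a) \<otimes> b = c \<odot> (a \<otimes> b)"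
    and smult_mult_r: "a \<in> carrier A \<Longrightarrow> b \<in> carrier A \<Longrightarrow> a \<otimes> (c \<odot> b) = c \<odot> (a \<otimes> b)"
    and oper_closed: "\<tau> \<in> \<Omega> \<Longrightarrow> a \<in> carrier A \<Longrightarrow> oper A \<tau> a \<in> carrier A"
    and oper_add: "\<tau> \<in> \<Omega> \<Longrightarrow> a \<in> carrier A \<Longrightarrow> b \<in> carrier A \<Longrightarrow>
          oper A \<tau> (a \<oplus> b) = oper A \<tau> a \<oplus> oper A \<tau> b"
    and oper_smult: "\<tau> \<in> \<Omega> \<Longrightarrow> a \<in> carrier A \<Longrightarrow> oper A \<tau> (c \<odot> a) = c \<odot> oper A \<tau> a"
begin

lemma smult_zero_left: "a \<in> carrier A \<Longrightarrow> 0 \<odot> a = \<zero>"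
  by (metis add.l_cancel_one add_0 smult_closed smult_l_distr)

lemma smult_zero_right: "c \<odot> \<zero> = \<zero>"
  by (metis mult_zero_right smult_assoc smult_zero_left zero_closed)

lemma a_inv_eq_smult: "a \<in> carrier A \<Longrightarrow> \<ominus> a = (- 1) \<odot> a"
proof -
  assume a: "a \<in> carrier A"
  have "(- 1) \<odot> a \<oplus> a = (- 1 + 1) \<odot> a"
    using smult_l_distr[OF a, of "- 1" 1] a by (simp add: smult_one)
  then have "(- 1) \<odot> a \<oplus> a = \<zero>" using a by (simp add: smult_zero_left)
  then show ?thesis using a by (simp add: minus_equality smult_closed)
qed

lemma smult_minus_right: "a \<in> carrier A \<Longrightarrow> c \<odot> (\<ominus> a) = \<ominus> (c \<odot> a)"
  by (metis a_inv_eq_smult mult.commute smult_assoc smult_closed)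

lemma oper_diff:
  assumes "\<tau> \<in> \<Omega>" "a \<in> carrier A" "b \<in> carrier A"
  shows "oper A \<tau> (a \<ominus> b) = oper A \<tau> a \<ominus> oper A \<tau> b"
  using assms by (simp add: a_minus_def a_inv_eq_smult oper_closed smult_closed oper_add oper_smult)

lemma oper_zero: "\<tau> \<in> \<Omega> \<Longrightarrow> oper A \<tau> \<zero> = \<zero>"
  using oper_smult[of \<tau> \<zero> 0] by (simp add: smult_zero_left oper_closed)

lemma smult_diff:
  "a \<in> carrier A \<Longrightarrow> b \<in> carrier A \<Longrightarrow> c \<odot> (a \<ominus> b) = c \<odot> a \<ominus> c \<odot> b"
  by (simp add: a_minus_def smult_r_distr smult_minus_right)

end

lemma omega_algebraI:
  fixes A :: "('k::field_char_0, 'a, 'o) omega_alg" (structure)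
  assumes "\<And>a b. a \<in> carrier A \<Longrightarrow> b \<in> carrier A \<Longrightarrow> a \<oplus> b \<in> carrier A"
    and "\<zero> \<in> carrier A"
    and "\<And>a b c. a \<in> carrier A \<Longrightarrow> b \<in> carrier A \<Longrightarrow> c \<in> carrier A \<Longrightarrow> a \<oplus> b \<oplus> c = a \<oplus> (b \<oplus> c)"
    and comm: "\<And>a b. a \<in> carrier A \<Longrightarrow> b \<in> carrier A \<Longrightarrow> a \<oplus> b = b \<oplus> a"
    and "\<And>a. a \<in> carrier A \<Longrightarrow> a \<oplus> \<zero> = a"
    and neg: "\<And>a. a \<in> carrier A \<Longrightarrow> a \<oplus> (- 1) \<odot> a = \<zero>"
    and "\<And>a b. a \<in> carrier A \<Longrightarrow> b \<in> carrier A \<Longrightarrow> a \<otimes> b \<in> carrier A"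
    and "\<one> \<in> carrier A"
    and "\<And>a b c. a \<in> carrier A \<Longrightarrow> b \<in> carrier A \<Longrightarrow> c \<in> carrier A \<Longrightarrow> a \<otimes> b \<otimes> c = a \<otimes> (b \<otimes> c)"
    and "\<And>a. a \<in> carrier A \<Longrightarrow> \<one> \<otimes> a = a"
    and "\<And>a. a \<in> carrier A \<Longrightarrow> a \<otimes> \<one> = a"
    and "\<And>a b c. a \<in> carrier A \<Longrightarrow> b \<in> carrier A \<Longrightarrow> c \<in> carrier A \<Longrightarrow>
           (a \<oplus> b) \<otimes> c = a \<otimes> c \<oplus> b \<otimes> c"
    and "\<And>a b c. a \<in> carrier A \<Longrightarrow> b \<in> carrier A \<Longrightarrow> c \<in> carrier A \<Longrightarrow>
           c \<otimes> (a \<oplus> b) = c \<otimes> a \<oplus> c \<otimes> b"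
    and smult: "\<And>a c. a \<in> carrier A \<Longrightarrow> c \<odot> a \<in> carrier A"
    and "\<And>a b c. a \<in> carrier A \<Longrightarrow> b \<in> carrier A \<Longrightarrow> c \<odot> (a \<oplus> b) = c \<odot> a \<oplus> c \<odot> b"
    and "\<And>a c d. a \<in> carrier A \<Longrightarrow> (c + d) \<odot> a = c \<odot> a \<oplus> d \<odot> a"
    and "\<And>a c d. a \<in> carrier A \<Longrightarrow> (c * d) \<odot> a = c \<odot> (d \<odot> a)"
    and "\<And>a. a \<in> carrier A \<Longrightarrow> 1 \<odot> a = a"
    and "\<And>a b c. a \<in> carrier A \<Longrightarrow> b \<in> carrier A \<Longrightarrow> (c \<odot> a) \<otimes> b = c \<odot> (a \<otimes> b)"
    and "\<And>a b c. a \<in> carrier A \<Longrightarrow> b \<in> carrier A \<Longrightarrow> a \<otimes> (c \<odot> b) = c \<odot> (a \<otimes> b)"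
    and "\<And>\<tau> a. \<tau> \<in> \<Omega> \<Longrightarrow> a \<in> carrier A \<Longrightarrow> oper A \<tau> a \<in> carrier A"
    and "\<And>\<tau> a b. \<tau> \<in> \<Omega> \<Longrightarrow> a \<in> carrier A \<Longrightarrow> b \<in> carrier A \<Longrightarrow>
          oper A \<tau> (a \<oplus> b) = oper A \<tau> a \<oplus> oper A \<tau> b"
    and "\<And>\<tau> a c. \<tau> \<in> \<Omega> \<Longrightarrow> a \<in> carrier A \<Longrightarrow> oper A \<tau> (c \<odot> a) = c \<odot> oper A \<tau> a"
  shows "omega_algebra A \<Omega>"
proof (rule omega_algebra.intro)
  show "ring A"
  proof (rule ringI)
    show "abelian_group A"
    proof (rule abelian_groupI)
      fix x assume x: "x \<in> carrier A"
      show "\<exists>y\<in>carrier A. y \<oplus> x = \<zero>"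
        using neg[OF x] comm[OF x smult[OF x, of "- 1"]] smult[OF x, of "- 1"] by auto
    qed (use assms in auto)
    show "monoid A" by (rule monoidI) (use assms in auto)
  qed (use assms in auto)
  show "omega_algebra_axioms A \<Omega>"
    by unfold_locales (use assms in auto)
qed

lemma linear_mapD:
  assumes "linear_map A B f"
  shows "a \<in> carrier A \<Longrightarrow> f a \<in> carrier B"
    and "a \<in> carrier A \<Longrightarrow> b \<in> carrier A \<Longrightarrow> f (a \<oplus>\<^bsub>A\<^esub> b) = f a \<oplus>\<^bsub>B\<^esub> f b"
    and "a \<in> carrier A \<Longrightarrow> f (c \<odot>\<^bsub>A\<^esub> a) = c \<odot>\<^bsub>B\<^esub> f a"
  using assms unfolding linear_map_def by auto

lemma linear_map_minus:
  assumes f: "linear_map A B f" and A: "omega_algebra A \<Omega>" and B: "omega_algebra B \<Omega>"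
  shows "f \<zero>\<^bsub>A\<^esub> = \<zero>\<^bsub>B\<^esub>"
    and "a \<in> carrier A \<Longrightarrow> f (\<ominus>\<^bsub>A\<^esub> a) = \<ominus>\<^bsub>B\<^esub> f a"
    and "a \<in> carrier A \<Longrightarrow> b \<in> carrier A \<Longrightarrow> f (a \<ominus>\<^bsub>A\<^esub> b) = f a \<ominus>\<^bsub>B\<^esub> f b"
proof -
  interpret A: omega_algebra A \<Omega> by (rule A)
  interpret B: omega_algebra B \<Omega> by (rule B)
  show "f \<zero>\<^bsub>A\<^esub> = \<zero>\<^bsub>B\<^esub>"
    using linear_mapD(1)[OF f A.zero_closed] linear_mapD(3)[OF f A.zero_closed, of 0]
    by (simp add: A.smult_zero_left B.smult_zero_left)
  show inv: "f (\<ominus>\<^bsub>A\<^esub> a) = \<ominus>\<^bsub>B\<^esub> f a" if "a \<in> carrier A" for a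
    using that linear_mapD(1)[OF f that] linear_mapD(3)[OF f that, of "- 1"]
    by (simp add: A.a_inv_eq_smult B.a_inv_eq_smult)
  show "f (a \<ominus>\<^bsub>A\<^esub> b) = f a \<ominus>\<^bsub>B\<^esub> f b" if "a \<in> carrier A" "b \<in> carrier A"
    using that inv[of b] linear_mapD(2)[OF f, of a "\<ominus>\<^bsub>A\<^esub> b"]
    by (simp add: a_minus_def)
qed

definition omega_hom ::
    "'o set \<Rightarrow> ('k, 'a, 'o) omega_alg \<Rightarrow> ('k, 'b, 'o) omega_alg \<Rightarrow> ('a \<Rightarrow> 'b) \<Rightarrow> bool" where
  "omega_hom \<Omega> A B f \<longleftrightarrow> linear_map A B f \<and>
     (\<forall>a\<in>carrier A. \<forall>b\<in>carrier A. f (a \<otimes>\<^bsub>A\<^esub> b) = f a \<otimes>\<^bsub>B\<^esub> f b) \<and> f \<one>\<^bsub>A\<^esub> = \<one>\<^bsub>B\<^esub> \<and>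
     (\<forall>\<tau>\<in>\<Omega>. \<forall>a\<in>carrier A. f (oper A \<tau> a) = oper B \<tau> (f a))"

lemma omega_homD:
  assumes "omega_hom \<Omega> A B f"
  shows "linear_map A B f" "f \<one>\<^bsub>A\<^esub> = \<one>\<^bsub>B\<^esub>"
    and "a \<in> carrier A \<Longrightarrow> f a \<in> carrier B"
    and "a \<in> carrier A \<Longrightarrow> b \<in> carrier A \<Longrightarrow> f (a \<oplus>\<^bsub>A\<^esub> b) = f a \<oplus>\<^bsub>B\<^esub> f b"
    and "a \<in> carrier A \<Longrightarrow> f (c \<odot>\<^bsub>A\<^esub> a) = c \<odot>\<^bsub>B\<^esub> f a"
    and "a \<in> carrier A \<Longrightarrow> b \<in> carrier A \<Longrightarrow> f (a \<otimes>\<^bsub>A\<^esub> b) = f a \<otimes>\<^bsub>B\<^esub> f b"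
    and "\<tau> \<in> \<Omega> \<Longrightarrow> a \<in> carrier A \<Longrightarrow> f (oper A \<tau> a) = oper B \<tau> (f a)"
  using assms unfolding omega_hom_def linear_map_def by auto

lemma omega_hom_comp:
  assumes "omega_hom \<Omega> A B f" "omega_hom \<Omega> B C g"
  shows "omega_hom \<Omega> A C (\<lambda>a. g (f a))"
  using assms unfolding omega_hom_def linear_map_def by auto

lemma omega_hom_id: "omega_hom \<Omega> A A (\<lambda>a. a)"
  unfolding omega_hom_def linear_map_def by auto

section \<open>Higher categories internal to algebras\<close>

definition composable :: "('k, 'a, 'o) higher_alg \<Rightarrow> nat \<Rightarrow> nat \<Rightarrow> 'a \<Rightarrow> 'a \<Rightarrow> bool" where
  "composable A m k a b \<longleftrightarrow> k < m \<and> a \<in> cells A m \<and> b \<in> cells A m \<and> ktgt A k m a = ksrc A k m b"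

text \<open>Strict \<open>N\<close>-categories internal to algebras. The bound is an extended natural number
  so that the finite stages \<open>F n\<close> and the free \<open>\<omega>\<close>-algebra are instances of
  one notion.\<close>

locale higher_algebra =
  fixes \<Omega> :: "'o set" and N :: enat and A :: "('k::field_char_0, 'a, 'o) higher_alg"
  assumes level_alg: "enat m \<le> N \<Longrightarrow> omega_algebra (level A m) \<Omega>"
    and src_hom: "enat (Suc m) \<le> N \<Longrightarrow> omega_hom \<Omega> (level A (Suc m)) (level A m) (src A m)"
    and tgt_hom: "enat (Suc m) \<le> N \<Longrightarrow> omega_hom \<Omega> (level A (Suc m)) (level A m) (tgt A m)"
    and idt_hom: "enat (Suc m) \<le> N \<Longrightarrow> omega_hom \<Omega> (level A m) (level A (Suc m)) (idt A m)"
    and glob_src: "enat (Suc (Suc m)) \<le> N \<Longrightarrow> a \<in> cells A (Suc (Suc m)) \<Longrightarrow>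
          src A m (src A (Suc m) a) = src A m (tgt A (Suc m) a)"
    and glob_tgt: "enat (Suc (Suc m)) \<le> N \<Longrightarrow> a \<in> cells A (Suc (Suc m)) \<Longrightarrow>
          tgt A m (src A (Suc m) a) = tgt A m (tgt A (Suc m) a)"
    and src_idt: "enat (Suc m) \<le> N \<Longrightarrow> a \<in> cells A m \<Longrightarrow> src A m (idt A m a) = a"
    and tgt_idt: "enat (Suc m) \<le> N \<Longrightarrow> a \<in> cells A m \<Longrightarrow> tgt A m (idt A m a) = a"
    and cmp_closed: "enat m \<le> N \<Longrightarrow> composable A m k a b \<Longrightarrow> cmp A m k a b \<in> cells A m"
    and src_cmp_top: "enat (Suc m) \<le> N \<Longrightarrow> composable A (Suc m) m a b \<Longrightarrow>
          src A m (cmp A (Suc m) m a b) = src A m a"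
    and tgt_cmp_top: "enat (Suc m) \<le> N \<Longrightarrow> composable A (Suc m) m a b \<Longrightarrow>
          tgt A m (cmp A (Suc m) m a b) = tgt A m b"
    and src_cmp: "enat (Suc m) \<le> N \<Longrightarrow> k < m \<Longrightarrow> composable A (Suc m) k a b \<Longrightarrow>
          src A m (cmp A (Suc m) k a b) = cmp A m k (src A m a) (src A m b)"
    and tgt_cmp: "enat (Suc m) \<le> N \<Longrightarrow> k < m \<Longrightarrow> composable A (Suc m) k a b \<Longrightarrow>
          tgt A m (cmp A (Suc m) k a b) = cmp A m k (tgt A m a) (tgt A m b)"
    and cmp_idt: "enat (Suc m) \<le> N \<Longrightarrow> composable A m k a b \<Longrightarrow>
          cmp A (Suc m) k (idt A m a) (idt A m b) = idt A m (cmp A m k a b)"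
    and unit_left: "enat m \<le> N \<Longrightarrow> k < m \<Longrightarrow> a \<in> cells A m \<Longrightarrow>
          cmp A m k (lift A k m (ksrc A k m a)) a = a"
    and unit_right: "enat m \<le> N \<Longrightarrow> k < m \<Longrightarrow> a \<in> cells A m \<Longrightarrow>
          cmp A m k a (lift A k m (ktgt A k m a)) = a"
    and cmp_assoc: "enat m \<le> N \<Longrightarrow> composable A m k a b \<Longrightarrow> composable A m k b b' \<Longrightarrow>
          cmp A m k (cmp A m k a b) b' = cmp A m k a (cmp A m k b b')"
    and cmp_exchange: "enat m \<le> N \<Longrightarrow> l < k \<Longrightarrow> composable A m k a b \<Longrightarrow> composable A m k a' b' \<Longrightarrow>
          composable A m l a a' \<Longrightarrow> composable A m l b b' \<Longrightarrow>
          cmp A m l (cmp A m k a b) (cmp A m k a' b') = cmp A m k (cmp A m l a a') (cmp A m l b b')"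
    and cmp_add: "enat m \<le> N \<Longrightarrow> composable A m k a b \<Longrightarrow> composable A m k a' b' \<Longrightarrow>
          cmp A m k (a \<oplus>\<^bsub>level A m\<^esub> a') (b \<oplus>\<^bsub>level A m\<^esub> b') =
            cmp A m k a b \<oplus>\<^bsub>level A m\<^esub> cmp A m k a' b'"
    and cmp_smult: "enat m \<le> N \<Longrightarrow> composable A m k a b \<Longrightarrow>
          cmp A m k (c \<odot>\<^bsub>level A m\<^esub> a) (c \<odot>\<^bsub>level A m\<^esub> b) = c \<odot>\<^bsub>level A m\<^esub> cmp A m k a b"
    and cmp_mult: "enat m \<le> N \<Longrightarrow> composable A m k a b \<Longrightarrow> composable A m k a' b' \<Longrightarrow>
          cmp A m k (a \<otimes>\<^bsub>level A m\<^esub> a') (b \<otimes>\<^bsub>level A m\<^esub> b') =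
            cmp A m k a b \<otimes>\<^bsub>level A m\<^esub> cmp A m k a' b'"
    and cmp_oper: "enat m \<le> N \<Longrightarrow> composable A m k a b \<Longrightarrow> \<tau> \<in> \<Omega> \<Longrightarrow>
          cmp A m k (oper (level A m) \<tau> a) (oper (level A m) \<tau> b) = oper (level A m) \<tau> (cmp A m k a b)"
begin

lemma dim_le: "enat m \<le> N \<Longrightarrow> k \<le> m \<Longrightarrow> enat k \<le> N"
  by (meson enat_ord_simps(1) order_trans)

lemma dim_Suc: "enat (Suc m) \<le> N \<Longrightarrow> enat m \<le> N"
  by (rule dim_le) auto

lemma ksrc_hom: "enat m \<le> N \<Longrightarrow> k \<le> m \<Longrightarrow> omega_hom \<Omega> (level A m) (level A k) (ksrc A k m)"
proof (induction m)
  case (Suc m)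
  show ?case
  proof (cases "k \<le> m")
    case True
    then show ?thesis
      using omega_hom_comp[OF src_hom[OF Suc.prems(1)] Suc.IH] Suc.prems dim_Suc by simp
  qed (use Suc.prems omega_hom_id in \<open>auto simp: not_less_eq_eq dest: le_antisym\<close>)
qed (simp add: omega_hom_id)

lemma ktgt_hom: "enat m \<le> N \<Longrightarrow> k \<le> m \<Longrightarrow> omega_hom \<Omega> (level A m) (level A k) (ktgt A k m)"
proof (induction m)
  case (Suc m)
  show ?case
  proof (cases "k \<le> m")
    case True
    then show ?thesis
      using omega_hom_comp[OF tgt_hom[OF Suc.prems(1)] Suc.IH] Suc.prems dim_Suc by simp
  qed (use Suc.prems omega_hom_id in \<open>auto simp: not_less_eq_eq dest: le_antisym\<close>)
qed (simp add: omega_hom_id)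

lemma lift_hom: "enat m \<le> N \<Longrightarrow> k \<le> m \<Longrightarrow> omega_hom \<Omega> (level A k) (level A m) (lift A k m)"
proof (induction m)
  case (Suc m)
  show ?case
  proof (cases "k \<le> m")
    case True
    then show ?thesis
      using omega_hom_comp[OF Suc.IH idt_hom[OF Suc.prems(1)]] Suc.prems dim_Suc by simp
  qed (use Suc.prems omega_hom_id in \<open>auto simp: not_less_eq_eq dest: le_antisym\<close>)
qed (simp add: omega_hom_id)

end

lemma ksrc_self [simp]: "ksrc A m m a = a" and ktgt_self [simp]: "ktgt A m m a = a"
  and lift_self [simp]: "lift A m m a = a"
  by (cases m; simp)+

lemma ksrc_Suc: "ksrc A m (Suc m) a = src A m a" and ktgt_Suc: "ktgt A m (Suc m) a = tgt A m a"
  and lift_Suc: "lift A m (Suc m) a = idt A m a"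
  by simp_all

context higher_algebra
begin

lemma ksrc_lift: "enat m \<le> N \<Longrightarrow> k \<le> m \<Longrightarrow> a \<in> cells A k \<Longrightarrow> ksrc A k m (lift A k m a) = a"
proof (induction m)
  case (Suc m)
  then show ?case
    by (cases "k \<le> m") (auto simp: src_idt omega_homD(3)[OF lift_hom] dim_Suc not_less_eq_eq dest!: le_antisym)
qed auto

lemma ktgt_lift: "enat m \<le> N \<Longrightarrow> k \<le> m \<Longrightarrow> a \<in> cells A k \<Longrightarrow> ktgt A k m (lift A k m a) = a"
proof (induction m)
  case (Suc m)
  then show ?case
    by (cases "k \<le> m") (auto simp: tgt_idt omega_homD(3)[OF lift_hom] dim_Suc not_less_eq_eq dest!: le_antisym)
qed auto

lemma ksrc_ksrc: "j \<le> k \<Longrightarrow> k \<le> m \<Longrightarrow> ksrc A j k (ksrc A k m a) = ksrc A j m a"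
  by (induction m arbitrary: a) (auto simp: le_Suc_eq)

lemma ktgt_ktgt: "j \<le> k \<Longrightarrow> k \<le> m \<Longrightarrow> ktgt A j k (ktgt A k m a) = ktgt A j m a"
  by (induction m arbitrary: a) (auto simp: le_Suc_eq)

lemma lift_lift: "j \<le> k \<Longrightarrow> k \<le> m \<Longrightarrow> lift A k m (lift A j k a) = lift A j m a"
  by (induction m) (auto simp: le_Suc_eq)

lemma ksrc_parallel:
  assumes "enat (Suc m) \<le> N" "k < m" "a \<in> cells A (Suc m)"
  shows "ksrc A k m (tgt A m a) = ksrc A k m (src A m a)"
    and "ktgt A k m (src A m a) = ktgt A k m (tgt A m a)"
proof -
  obtain m' where m: "m = Suc m'" using assms(2) by (cases m) auto
  show "ksrc A k m (tgt A m a) = ksrc A k m (src A m a)"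
    and "ktgt A k m (src A m a) = ktgt A k m (tgt A m a)"
    using assms unfolding m by (auto simp: glob_src glob_tgt)
qed

lemma ksrc_ktgt: "enat m \<le> N \<Longrightarrow> j < k \<Longrightarrow> k \<le> m \<Longrightarrow> a \<in> cells A m \<Longrightarrow>
    ksrc A j k (ktgt A k m a) = ksrc A j m a"
  and ktgt_ksrc: "enat m \<le> N \<Longrightarrow> j < k \<Longrightarrow> k \<le> m \<Longrightarrow> a \<in> cells A m \<Longrightarrow>
    ktgt A j k (ksrc A k m a) = ktgt A j m a"
proof (induction m arbitrary: a)
  case (Suc m)
  { case 1
    show ?case
    proof (cases "k = Suc m")
      case False
      then show ?thesis
        using 1 Suc.IH(1)[OF dim_Suc[OF 1(1)], of "tgt A m a"] ksrc_parallel[of m j a]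
          omega_homD(3)[OF tgt_hom[OF 1(1)]] by simp
    qed simp
  next
    case 2
    show ?case
    proof (cases "k = Suc m")
      case False
      then show ?thesis
        using 2 Suc.IH(2)[OF dim_Suc[OF 2(1)], of "src A m a"] ksrc_parallel[of m j a]
          omega_homD(3)[OF src_hom[OF 2(1)]] by simp
    qed simp }
qed simp_all

lemma composable_src_tgt:
  assumes "enat (Suc m) \<le> N" "k < m" "composable A (Suc m) k a b"
  shows "composable A m k (src A m a) (src A m b)" "composable A m k (tgt A m a) (tgt A m b)"
  using assms ksrc_parallel[OF assms(1,2), of a] ksrc_parallel[OF assms(1,2), of b]
    omega_homD(3)[OF src_hom[OF assms(1)]] omega_homD(3)[OF tgt_hom[OF assms(1)]]
  unfolding composable_def by simp_all

lemma ksrc_cmp_high: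
  "enat m \<le> N \<Longrightarrow> k < j \<Longrightarrow> j \<le> m \<Longrightarrow> composable A m k a b \<Longrightarrow>
    ksrc A j m (cmp A m k a b) = cmp A j k (ksrc A j m a) (ksrc A j m b)"
proof (induction m arbitrary: a b)
  case (Suc m)
  then show ?case
    by (cases "j = Suc m") (simp_all add: src_cmp composable_src_tgt dim_Suc)
qed simp

lemma ktgt_cmp_high:
  "enat m \<le> N \<Longrightarrow> k < j \<Longrightarrow> j \<le> m \<Longrightarrow> composable A m k a b \<Longrightarrow>
    ktgt A j m (cmp A m k a b) = cmp A j k (ktgt A j m a) (ktgt A j m b)"
proof (induction m arbitrary: a b)
  case (Suc m)
  then show ?case
    by (cases "j = Suc m") (simp_all add: tgt_cmp composable_src_tgt dim_Suc)
qed simp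

lemma ksrc_cmp_low:
  "enat m \<le> N \<Longrightarrow> j \<le> k \<Longrightarrow> composable A m k a b \<Longrightarrow> ksrc A j m (cmp A m k a b) = ksrc A j m a"
proof (induction m arbitrary: a b)
  case (Suc m)
  then have "k \<le> m" by (simp add: composable_def)
  then show ?case using Suc
    by (cases "k = m") (simp_all add: src_cmp src_cmp_top composable_src_tgt dim_Suc)
qed (simp add: composable_def)

lemma ktgt_cmp_low:
  "enat m \<le> N \<Longrightarrow> j \<le> k \<Longrightarrow> composable A m k a b \<Longrightarrow> ktgt A j m (cmp A m k a b) = ktgt A j m b"
proof (induction m arbitrary: a b)
  case (Suc m)
  then have "k \<le> m" by (simp add: composable_def)
  then show ?case using Suc
    by (cases "k = m") (simp_all add: tgt_cmp tgt_cmp_top composable_src_tgt dim_Suc)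
qed (simp add: composable_def)

text \<open>Let \<open>e\<close> be the identity on the common boundary. Both \<open>a \<star> e = a\<close>
  and \<open>e \<star> b = b\<close>, and \<open>e \<star> e = e\<close>; linearity of the composition
  applied to \<open>(a, b) = (a, e) - (e, e) + (e, b)\<close> gives the formula.\<close>

lemma cmp_formula:
  assumes m: "enat m \<le> N" and c: "composable A m k a b"
  shows "cmp A m k a b = (a \<ominus>\<^bsub>level A m\<^esub> lift A k m (ktgt A k m a)) \<oplus>\<^bsub>level A m\<^esub> b"
proof -
  interpret L: omega_algebra "level A m" \<Omega> using m by (rule level_alg)
  define e where "e = lift A k m (ktgt A k m a)"
  have k: "k < m" and a: "a \<in> cells A m" and b: "b \<in> cells A m" and ab: "ktgt A k m a = ksrc A k m b"
    using c by (auto simp: composable_def)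
  have ta: "ktgt A k m a \<in> cells A k" using omega_homD(3)[OF ktgt_hom[OF m] a] k by simp
  have e: "e \<in> cells A m" unfolding e_def using omega_homD(3)[OF lift_hom[OF m] ta] k by simp
  have te: "ktgt A k m e = ktgt A k m a" "ksrc A k m e = ktgt A k m a"
    unfolding e_def using m k ta by (simp_all add: ktgt_lift ksrc_lift)
  have ae: "composable A m k a e" and ee: "composable A m k e e" and eb: "composable A m k e b"
    using k a b e te ab by (simp_all add: composable_def)
  have 1: "cmp A m k a e = a" unfolding e_def using m k a by (rule unit_right)
  have 2: "cmp A m k e e = e" using unit_right[OF m k e] te by (simp add: e_def)
  have 3: "cmp A m k e b = b" unfolding e_def ab using m k b by (rule unit_left)
  have 4: "cmp A m k (\<ominus>\<^bsub>level A m\<^esub> e) (\<ominus>\<^bsub>level A m\<^esub> e) = \<ominus>\<^bsub>level A m\<^esub> e"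
    using cmp_smult[OF m ee, of "- 1"] e 2 by (simp add: L.a_inv_eq_smult)
  have n: "composable A m k (\<ominus>\<^bsub>level A m\<^esub> e) (\<ominus>\<^bsub>level A m\<^esub> e)"
    using k e te omega_homD(1)[OF ktgt_hom[OF m, of k]] omega_homD(1)[OF ksrc_hom[OF m, of k]]
    by (simp add: composable_def L.a_inv_eq_smult L.smult_closed linear_mapD(3))
  have an: "composable A m k (a \<oplus>\<^bsub>level A m\<^esub> \<ominus>\<^bsub>level A m\<^esub> e) (e \<oplus>\<^bsub>level A m\<^esub> \<ominus>\<^bsub>level A m\<^esub> e)"
    using ae n omega_homD(4)[OF ktgt_hom[OF m, of k]] omega_homD(4)[OF ksrc_hom[OF m, of k]]
    by (simp add: composable_def)
  have "cmp A m k (a \<oplus>\<^bsub>level A m\<^esub> \<ominus>\<^bsub>level A m\<^esub> e \<oplus>\<^bsub>level A m\<^esub> e) (e \<oplus>\<^bsub>level A m\<^esub> \<ominus>\<^bsub>level A m\<^esub> e \<oplus>\<^bsub>level A m\<^esub> b)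
      = a \<oplus>\<^bsub>level A m\<^esub> \<ominus>\<^bsub>level A m\<^esub> e \<oplus>\<^bsub>level A m\<^esub> b"
    unfolding cmp_add[OF m an eb] cmp_add[OF m ae n] 1 3 4 ..
  moreover have "a \<oplus>\<^bsub>level A m\<^esub> \<ominus>\<^bsub>level A m\<^esub> e \<oplus>\<^bsub>level A m\<^esub> e = a" using a e by algebra
  moreover have "e \<oplus>\<^bsub>level A m\<^esub> \<ominus>\<^bsub>level A m\<^esub> e \<oplus>\<^bsub>level A m\<^esub> b = b" using b e by algebra
  ultimately show ?thesis by (simp add: e_def a_minus_def)
qed

text \<open>The exchange of product and composition: \<open>y = y \<star>\<^sub>0 0\<close> and \<open>x = 0
  \<star>\<^sub>0 x\<close> are defined, so \<open>y x = (y \<star>\<^sub>0 0)(0 \<star>\<^sub>0 x) = (y 0)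
  \<star>\<^sub>0 (0 x) = 0\<close>, and likewise for \<open>x y\<close>.\<close>

lemma peiffer:
  assumes m: "enat m \<le> N" "0 < m" and x: "x \<in> cells A m" and y: "y \<in> cells A m"
    and sx: "ksrc A 0 m x = \<zero>\<^bsub>level A 0\<^esub>" and ty: "ktgt A 0 m y = \<zero>\<^bsub>level A 0\<^esub>"
  shows "x \<otimes>\<^bsub>level A m\<^esub> y = \<zero>\<^bsub>level A m\<^esub>" "y \<otimes>\<^bsub>level A m\<^esub> x = \<zero>\<^bsub>level A m\<^esub>"
proof -
  interpret L: omega_algebra "level A m" \<Omega> using m(1) by (rule level_alg)
  have al0: "omega_algebra (level A 0) \<Omega>" using m(1) level_alg dim_le by blast
  have z: "lift A 0 m \<zero>\<^bsub>level A 0\<^esub> = \<zero>\<^bsub>level A m\<^esub>" "ksrc A 0 m \<zero>\<^bsub>level A m\<^esub> = \<zero>\<^bsub>level A 0\<^esub>"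
    "ktgt A 0 m \<zero>\<^bsub>level A m\<^esub> = \<zero>\<^bsub>level A 0\<^esub>"
    using linear_map_minus(1)[OF omega_homD(1)[OF lift_hom[OF m(1), of 0]] al0 L.omega_algebra_axioms]
      linear_map_minus(1)[OF omega_homD(1)[OF ksrc_hom[OF m(1), of 0]] L.omega_algebra_axioms al0]
      linear_map_minus(1)[OF omega_homD(1)[OF ktgt_hom[OF m(1), of 0]] L.omega_algebra_axioms al0]
    by simp_all
  have y0: "composable A m 0 y \<zero>\<^bsub>level A m\<^esub>" and x0: "composable A m 0 \<zero>\<^bsub>level A m\<^esub> x"
    using assms z by (simp_all add: composable_def)
  have 1: "cmp A m 0 y \<zero>\<^bsub>level A m\<^esub> = y" using unit_right[OF m y] ty z by simp
  have 2: "cmp A m 0 \<zero>\<^bsub>level A m\<^esub> x = x" using unit_left[OF m x] sx z by simp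
  have 3: "cmp A m 0 \<zero>\<^bsub>level A m\<^esub> \<zero>\<^bsub>level A m\<^esub> = \<zero>\<^bsub>level A m\<^esub>"
    using unit_right[OF m L.zero_closed] z by simp
  show "y \<otimes>\<^bsub>level A m\<^esub> x = \<zero>\<^bsub>level A m\<^esub>" using cmp_mult[OF m(1) y0 x0] 1 2 3 x y by simp
  show "x \<otimes>\<^bsub>level A m\<^esub> y = \<zero>\<^bsub>level A m\<^esub>" using cmp_mult[OF m(1) x0 y0] 1 2 3 x y by simp
qed

end

section \<open>Free extensions\<close>

text \<open>The cells of \<open>A\<close> are required to be nonempty and pairwise disjoint sets of terms
  because a term \<open>Idt u\<close> names the identity of the one cell that contains \<open>u\<close>. The
  new cells have the same property, so the construction can be iterated.\<close>

locale free_extension = higher_algebra \<Omega> "enat n" A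
  for \<Omega> :: "'o set" and n :: nat
    and A :: "('k::field_char_0, ('z, 'o, 'k, 'x) cell, 'o) higher_alg" +
  fixes Y :: "'x set" and s t :: "'x \<Rightarrow> ('z, 'o, 'k, 'x) cell"
  assumes ext: "cellular_extension n A Y s t"
    and cell_nonempty: "a \<in> cells A n \<Longrightarrow> a \<noteq> {}"
    and cell_disjoint: "a \<in> cells A n \<Longrightarrow> b \<in> cells A n \<Longrightarrow> u \<in> a \<Longrightarrow> u \<in> b \<Longrightarrow> a = b"
begin

abbreviation ok where "ok \<equiv> tm_ok \<Omega> n A Y s t"
abbreviation sc where "sc \<equiv> tm_src n A s"
abbreviation tg where "tg \<equiv> tm_tgt n A t"
abbreviation eqv (infix \<open>\<approx>\<close> 50) where "eqv \<equiv> tm_eq \<Omega> n A Y s t"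
abbreviation cls where "cls \<equiv> tm_class \<Omega> n A Y s t"
abbreviation A' where "A' \<equiv> adjoin \<Omega> n A Y s t"
abbreviation B where "B \<equiv> level A' (Suc n)"

sublocale L: omega_algebra "level A n" \<Omega>
  by (rule level_alg) simp

lemma cell_of_eq: "a \<in> cells A n \<Longrightarrow> u \<in> a \<Longrightarrow> cell_of n A u = a"
  unfolding cell_of_def by (rule the_equality) (auto dest: cell_disjoint)

lemma parallel_ksrc: "parallel A n f g \<Longrightarrow> k < n \<Longrightarrow> ksrc A k n f = ksrc A k n g"
  and parallel_ktgt: "parallel A n f g \<Longrightarrow> k < n \<Longrightarrow> ktgt A k n f = ktgt A k n g"
  unfolding parallel_def by (cases n; simp)+

lemma src_n: "n = Suc m \<Longrightarrow> omega_hom \<Omega> (level A n) (level A m) (src A m)"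
  and tgt_n: "n = Suc m \<Longrightarrow> omega_hom \<Omega> (level A n) (level A m) (tgt A m)"
  using src_hom[of m] tgt_hom[of m] by simp_all

lemma parallel_add:
  assumes "a \<in> cells A n" "a' \<in> cells A n" "b \<in> cells A n" "b' \<in> cells A n"
    and "parallel A n a a'" "parallel A n b b'"
  shows "parallel A n (a \<oplus>\<^bsub>level A n\<^esub> b) (a' \<oplus>\<^bsub>level A n\<^esub> b')"
  unfolding parallel_def
proof (intro allI impI)
  fix m assume n: "n = Suc m"
  show "src A m (a \<oplus>\<^bsub>level A n\<^esub> b) = src A m (a' \<oplus>\<^bsub>level A n\<^esub> b') \<and>
    tgt A m (a \<oplus>\<^bsub>level A n\<^esub> b) = tgt A m (a' \<oplus>\<^bsub>level A n\<^esub> b')"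
    using assms n omega_homD(4)[OF src_n[OF n]] omega_homD(4)[OF tgt_n[OF n]]
    by (simp add: parallel_def)
qed

lemma parallel_mult:
  assumes "a \<in> cells A n" "a' \<in> cells A n" "b \<in> cells A n" "b' \<in> cells A n"
    and "parallel A n a a'" "parallel A n b b'"
  shows "parallel A n (a \<otimes>\<^bsub>level A n\<^esub> b) (a' \<otimes>\<^bsub>level A n\<^esub> b')"
  unfolding parallel_def
proof (intro allI impI)
  fix m assume n: "n = Suc m"
  show "src A m (a \<otimes>\<^bsub>level A n\<^esub> b) = src A m (a' \<otimes>\<^bsub>level A n\<^esub> b') \<and>
    tgt A m (a \<otimes>\<^bsub>level A n\<^esub> b) = tgt A m (a' \<otimes>\<^bsub>level A n\<^esub> b')"
    using assms n omega_homD(6)[OF src_n[OF n]] omega_homD(6)[OF tgt_n[OF n]]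
    by (simp add: parallel_def)
qed

lemma parallel_smult:
  assumes "a \<in> cells A n" "a' \<in> cells A n" "parallel A n a a'"
  shows "parallel A n (c \<odot>\<^bsub>level A n\<^esub> a) (c \<odot>\<^bsub>level A n\<^esub> a')"
  unfolding parallel_def
proof (intro allI impI)
  fix m assume n: "n = Suc m"
  show "src A m (c \<odot>\<^bsub>level A n\<^esub> a) = src A m (c \<odot>\<^bsub>level A n\<^esub> a') \<and>
    tgt A m (c \<odot>\<^bsub>level A n\<^esub> a) = tgt A m (c \<odot>\<^bsub>level A n\<^esub> a')"
    using assms n omega_homD(5)[OF src_n[OF n]] omega_homD(5)[OF tgt_n[OF n]]
    by (simp add: parallel_def)
qed

lemma parallel_oper:
  assumes "\<tau> \<in> \<Omega>" "a \<in> cells A n" "a' \<in> cells A n" "parallel A n a a'"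
  shows "parallel A n (oper (level A n) \<tau> a) (oper (level A n) \<tau> a')"
  unfolding parallel_def
proof (intro allI impI)
  fix m assume n: "n = Suc m"
  show "src A m (oper (level A n) \<tau> a) = src A m (oper (level A n) \<tau> a') \<and>
    tgt A m (oper (level A n) \<tau> a) = tgt A m (oper (level A n) \<tau> a')"
    using assms n omega_homD(7)[OF src_n[OF n]] omega_homD(7)[OF tgt_n[OF n]]
    by (simp add: parallel_def)
qed

text \<open>Globularity of the new cells. In the composite case with \<open>k < n\<close>, the source and
  the target are themselves composites in \<open>A\<close> of parallel pairs.\<close>

lemma tm_boundary:
  "ok f \<Longrightarrow> sc f \<in> cells A n \<and> tg f \<in> cells A n \<and> parallel A n (sc f) (tg f)"
proof (induction f)
  case (Idt u)
  then show ?case by (auto simp: cell_of_eq parallel_def)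
next
  case (Gen y)
  then show ?case using ext by (auto simp: cellular_extension_def)
next
  case (Add f g)
  then show ?case by (simp add: parallel_add)
next
  case (Scl c f)
  then show ?case by (simp add: L.smult_closed parallel_smult)
next
  case (Mul f g)
  then show ?case by (simp add: parallel_mult)
next
  case (Opr \<tau> f)
  then show ?case by (simp add: L.oper_closed parallel_oper)
next
  case (Cmp k f g)
  then have f: "sc f \<in> cells A n" "tg f \<in> cells A n" "parallel A n (sc f) (tg f)"
    and g: "sc g \<in> cells A n" "tg g \<in> cells A n" "parallel A n (sc g) (tg g)"
    and k: "k \<le> n" "ktgt A k n (tg f) = ksrc A k n (sc g)"
    by auto
  show ?case
  proof (cases "k = n")
    case True
    then show ?thesis using f g k by (auto simp: parallel_def)
  next
    case False
    then have "k < n" using k by simp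
    then obtain m where n: "n = Suc m" by (cases n) auto
    have c: "composable A n k (sc f) (sc g)" "composable A n k (tg f) (tg g)"
      using f g k \<open>k < n\<close> by (auto simp: composable_def parallel_ksrc parallel_ktgt)
    have "src A m (cmp A n k (sc f) (sc g)) = src A m (cmp A n k (tg f) (tg g))
      \<and> tgt A m (cmp A n k (sc f) (sc g)) = tgt A m (cmp A n k (tg f) (tg g))"
    proof (cases "k = m")
      case True
      then show ?thesis
        using c f(3) g(3) src_cmp_top[of m] tgt_cmp_top[of m] by (simp add: n parallel_def)
    next
      case False
      then have "k < m" using \<open>k < n\<close> n by simp
      then show ?thesis
        using c f(3) g(3) src_cmp[of m] tgt_cmp[of m] by (simp add: n parallel_def)
    qed
    then show ?thesis
      using False c cmp_closed[of n] by (simp add: parallel_def n)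
  qed
qed simp

lemma sc_closed: "ok f \<Longrightarrow> sc f \<in> cells A n" and tg_closed: "ok f \<Longrightarrow> tg f \<in> cells A n"
  and sc_tg_parallel: "ok f \<Longrightarrow> parallel A n (sc f) (tg f)"
  using tm_boundary by auto

lemma composable_boundary:
  assumes "ok (Cmp k f g)" "k \<noteq> n"
  shows "composable A n k (sc f) (sc g)" "composable A n k (tg f) (tg g)"
proof -
  have f: "ok f" and g: "ok g" and k: "k < n" "ktgt A k n (tg f) = ksrc A k n (sc g)"
    using assms by auto
  show "composable A n k (sc f) (sc g)" "composable A n k (tg f) (tg g)"
    unfolding composable_def
    using k sc_closed[OF f] sc_closed[OF g] tg_closed[OF f] tg_closed[OF g]
      parallel_ktgt[OF sc_tg_parallel[OF f] k(1)] parallel_ksrc[OF sc_tg_parallel[OF g] k(1)]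
    by simp_all
qed

text \<open>Each rule of the congruence is an identity that holds in every higher algebra, so both sides
  have the same boundary in \<open>A\<close>. This makes the source, the target and composability of classes
  of terms well defined.\<close>

lemma eqv_sound: "f \<approx> g \<Longrightarrow> (ok f \<and> ok g) \<and> sc f = sc g \<and> tg f = tg g"
proof (induction rule: tm_eq.induct)
  case (cong_cmp f f' g g' k)
  then show ?case by (simp add: composable_boundary)
next
  case (idt_eq a u v)
  then show ?case using cell_of_eq[of a u] cell_of_eq[of a v] by simp blast
next
  case (idt_add a b u v w)
  note c = L.a_closed[OF idt_add(1,2)]
  from idt_add c show ?case
    using cell_of_eq[of a u] cell_of_eq[of b v] cell_of_eq[OF c, of w] by simp blast
next
  case (idt_scl a u w c)
  note c = L.smult_closed[OF idt_scl(1), of c]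
  from idt_scl c show ?case
    using cell_of_eq[of a u] cell_of_eq[OF c, of w] by simp blast
next
  case (idt_mul a b u v w)
  note c = L.m_closed[OF idt_mul(1,2)]
  from idt_mul c show ?case
    using cell_of_eq[of a u] cell_of_eq[of b v] cell_of_eq[OF c, of w] by simp blast
next
  case (idt_opr \<tau> a u w)
  note c = L.oper_closed[OF idt_opr(1,2)]
  from idt_opr c show ?case
    using cell_of_eq[of a u] cell_of_eq[OF c, of w] by simp blast
next
  case (idt_cmp k a b u v w)
  then have c: "composable A n k a b" by (simp add: composable_def)
  with cmp_closed[OF _ c] have "cmp A n k a b \<in> cells A n" by simp
  with idt_cmp show ?case by (simp add: cell_of_eq) blast
next
  case (add_assoc f g h)
  then show ?case by (simp add: L.a_assoc sc_closed tg_closed)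
next
  case (add_comm f g)
  then show ?case by (simp add: L.a_comm sc_closed tg_closed)
next
  case (add_zero f u)
  then show ?case
    using L.zero_closed by (simp add: cell_of_eq[OF L.zero_closed] sc_closed tg_closed) blast
next
  case (add_neg f u)
  then show ?case
    using L.zero_closed
    by (simp add: cell_of_eq[OF L.zero_closed] sc_closed tg_closed L.a_inv_eq_smult[symmetric] L.r_neg)
      blast
next
  case (mul_one_left f u)
  then show ?case
    using L.one_closed by (simp add: cell_of_eq[OF L.one_closed] sc_closed tg_closed) blast
next
  case (mul_one_right f u)
  then show ?case
    using L.one_closed by (simp add: cell_of_eq[OF L.one_closed] sc_closed tg_closed) blast
next
  case (cmp_idt_left f k u)
  have c: "lift A k n (ksrc A k n (sc f)) \<in> cells A n"
    using cmp_idt_left omega_homD(3)[OF lift_hom] omega_homD(3)[OF ksrc_hom] sc_closed by simp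
  have u: "cell_of n A u = lift A k n (ksrc A k n (sc f))"
    using cell_of_eq[OF c] cmp_idt_left by simp
  have "ktgt A k n (cell_of n A u) = ksrc A k n (sc f)"
    using cmp_idt_left omega_homD(3)[OF ksrc_hom] sc_closed unfolding u by (simp add: ktgt_lift)
  moreover have "cmp A n k (lift A k n (ksrc A k n (sc f))) (sc f) = sc f
    \<and> cmp A n k (lift A k n (ksrc A k n (sc f))) (tg f) = tg f" if "k < n"
    using unit_left[of n k "sc f"] unit_left[of n k "tg f"] cmp_idt_left that sc_closed tg_closed
      parallel_ksrc[OF sc_tg_parallel] by simp
  ultimately show ?case using cmp_idt_left c u by (simp add: sc_closed tg_closed) blast
next
  case (cmp_idt_right f k u)
  have c: "lift A k n (ktgt A k n (tg f)) \<in> cells A n"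
    using cmp_idt_right omega_homD(3)[OF lift_hom] omega_homD(3)[OF ktgt_hom] tg_closed by simp
  have u: "cell_of n A u = lift A k n (ktgt A k n (tg f))"
    using cell_of_eq[OF c] cmp_idt_right by simp
  have "ktgt A k n (tg f) = ksrc A k n (cell_of n A u)"
    using cmp_idt_right omega_homD(3)[OF ktgt_hom] tg_closed unfolding u by (simp add: ksrc_lift)
  moreover have "cmp A n k (sc f) (lift A k n (ktgt A k n (tg f))) = sc f
    \<and> cmp A n k (tg f) (lift A k n (ktgt A k n (tg f))) = tg f" if "k < n"
    using unit_right[of n k "sc f"] unit_right[of n k "tg f"] cmp_idt_right that sc_closed tg_closed
      parallel_ktgt[OF sc_tg_parallel] by simp
  ultimately show ?case using cmp_idt_right c u by (simp add: sc_closed tg_closed) blast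
next
  case (cmp_assoc k f g h)
  then have "ok (Cmp k f g)" "ok (Cmp k g h)" by auto
  with cmp_assoc higher_algebra.cmp_assoc[OF higher_algebra_axioms, of n k] show ?case
    by (simp add: composable_boundary)
next
  case (exchange l k f g f' g')
  then have "ok (Cmp k f g)" "ok (Cmp k f' g')" "ok (Cmp l f f')" "ok (Cmp l g g')" "l \<noteq> n" by auto
  with exchange cmp_exchange[of n l k] show ?case
    by (simp add: composable_boundary)
next
  case (cmp_add k f g f' g')
  with higher_algebra.cmp_add[OF higher_algebra_axioms, of n k] show ?case
    by (simp add: composable_boundary)
next
  case (cmp_scl k f g c)
  with higher_algebra.cmp_smult[OF higher_algebra_axioms, of n k] show ?case
    by (simp add: composable_boundary)
next
  case (cmp_mul k f g f' g')
  with higher_algebra.cmp_mult[OF higher_algebra_axioms, of n k] show ?case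
    by (simp add: composable_boundary)
next
  case (cmp_opr \<tau> k f g)
  with higher_algebra.cmp_oper[OF higher_algebra_axioms, of n k] show ?case
    by (simp add: composable_boundary)
qed (simp_all add: cell_of_eq sc_closed tg_closed L.smult_closed L.oper_closed L.smult_r_distr
  L.smult_l_distr L.smult_assoc L.smult_one L.m_assoc L.l_distr L.r_distr L.smult_mult_l L.smult_mult_r
  L.oper_add L.oper_smult)

lemma cls_eq: "f \<approx> g \<Longrightarrow> cls f = cls g"
  unfolding tm_class_def by (auto intro: tm_eq.trans tm_eq.sym)

lemma in_cls: "ok f \<Longrightarrow> f \<in> cls f"
  unfolding tm_class_def by (simp add: tm_eq.refl)

lemma eqv_cls: "g \<in> cls f \<Longrightarrow> f \<approx> g"
  unfolding tm_class_def by simp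

text \<open>The operations on classes are written as unions over all representatives; for a map that
  respects the congruence, such a union is its value at any one of them.\<close>

lemma UN_cls2:
  assumes "ok f" "ok g" "\<And>f' g'. f \<approx> f' \<Longrightarrow> g \<approx> g' \<Longrightarrow> F f' g' = F f g"
  shows "(\<Union>f'\<in>cls f. \<Union>g'\<in>cls g. F f' g') = F f g"
proof -
  have "(\<Union>f'\<in>cls f. \<Union>g'\<in>cls g. F f' g') = (\<Union>f'\<in>cls f. \<Union>g'\<in>cls g. F f g)"
    using assms(3) eqv_cls by (intro SUP_cong HOL.refl) simp
  also have "\<dots> = F f g" using in_cls[OF assms(1)] in_cls[OF assms(2)] by (simp add: SUP_constant) blast
  finally show ?thesis .
qed

lemma UN_cls:
  assumes "ok f" "\<And>g. f \<approx> g \<Longrightarrow> F g = F f"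
  shows "(\<Union>g\<in>cls f. F g) = F f"
proof -
  have "(\<Union>g\<in>cls f. F g) = (\<Union>g\<in>cls f. F f)"
    using assms(2) eqv_cls by (intro SUP_cong HOL.refl) simp
  also have "\<dots> = F f" using in_cls[OF assms(1)] by (simp add: SUP_constant) blast
  finally show ?thesis .
qed

lemma level_new: "B = new_level \<Omega> n A Y s t"
  and level_old: "m \<le> n \<Longrightarrow> level A' m = level A m"
  by (simp_all add: adjoin_def)

lemma cells_new: "carrier B = {cls f | f. ok f}"
  by (simp add: level_new new_level_def)

lemma cls_cell: "ok f \<Longrightarrow> cls f \<in> carrier B"
  by (auto simp: cells_new)

lemma new_cellE:
  assumes "a \<in> carrier B"
  obtains f where "ok f" "a = cls f"
  using assms by (auto simp: cells_new)

lemma new_add: "ok f \<Longrightarrow> ok g \<Longrightarrow> cls f \<oplus>\<^bsub>B\<^esub> cls g = cls (Add f g)"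
  unfolding level_new new_level_def
  by (simp add: UN_cls2 cls_eq[OF tm_eq.cong_add] tm_eq.sym)

lemma new_mult: "ok f \<Longrightarrow> ok g \<Longrightarrow> cls f \<otimes>\<^bsub>B\<^esub> cls g = cls (Mul f g)"
  unfolding level_new new_level_def
  by (simp add: UN_cls2 cls_eq[OF tm_eq.cong_mul] tm_eq.sym)

lemma new_smult: "ok f \<Longrightarrow> c \<odot>\<^bsub>B\<^esub> cls f = cls (Scl c f)"
  unfolding level_new new_level_def
  by (simp add: UN_cls[of f] cls_eq[OF tm_eq.cong_scl] tm_eq.sym)

lemma new_oper: "\<tau> \<in> \<Omega> \<Longrightarrow> ok f \<Longrightarrow> oper B \<tau> (cls f) = cls (Opr \<tau> f)"
  unfolding level_new new_level_def
  by (simp add: UN_cls[of f] cls_eq[OF tm_eq.cong_opr] tm_eq.sym)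

lemma UN_Idt: "a \<in> cells A n \<Longrightarrow> u \<in> a \<Longrightarrow> (\<Union>v\<in>a. cls (Idt v)) = cls (Idt u)"
proof -
  assume a: "a \<in> cells A n" "u \<in> a"
  have "(\<Union>v\<in>a. cls (Idt v)) = (\<Union>v\<in>a. cls (Idt u))"
    using a by (intro SUP_cong HOL.refl cls_eq tm_eq.idt_eq)
  then show ?thesis using a by auto
qed

lemma new_zero: "u \<in> \<zero>\<^bsub>level A n\<^esub> \<Longrightarrow> \<zero>\<^bsub>B\<^esub> = cls (Idt u)"
  unfolding level_new new_level_def by (simp add: UN_Idt)

lemma new_one: "u \<in> \<one>\<^bsub>level A n\<^esub> \<Longrightarrow> \<one>\<^bsub>B\<^esub> = cls (Idt u)"
  unfolding level_new new_level_def by (simp add: UN_Idt)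

lemma new_idt: "a \<in> cells A n \<Longrightarrow> u \<in> a \<Longrightarrow> idt A' n a = cls (Idt u)"
  unfolding adjoin_def by (simp add: UN_Idt)

lemma some_cls: "ok f \<Longrightarrow> f \<approx> (SOME g. g \<in> cls f)"
  using someI[of "\<lambda>g. g \<in> cls f" f] in_cls eqv_cls by blast

lemma new_src: "ok f \<Longrightarrow> src A' n (cls f) = sc f"
  and new_tgt: "ok f \<Longrightarrow> tgt A' n (cls f) = tg f"
  unfolding adjoin_def using eqv_sound[OF some_cls] by simp_all

lemma ok_Cmp_cong: "f \<approx> f' \<Longrightarrow> g \<approx> g' \<Longrightarrow> ok (Cmp k f g) \<Longrightarrow> ok (Cmp k f' g')"
  using eqv_sound by auto

lemma new_cmp:
  assumes "ok (Cmp k f g)"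
  shows "cmp A' (Suc n) k (cls f) (cls g) = cls (Cmp k f g)"
proof -
  have "cls (Cmp k f' g') = cls (Cmp k f g)" if "f \<approx> f'" "g \<approx> g'" for f' g'
    using cls_eq[OF tm_eq.cong_cmp[OF that assms ok_Cmp_cong[OF that assms]]] by (rule HOL.sym)
  then have "(\<Union>f'\<in>cls f. \<Union>g'\<in>cls g. cls (Cmp k f' g')) = cls (Cmp k f g)"
    using assms by (intro UN_cls2) auto
  then show ?thesis by (simp add: adjoin_def)
qed

lemma src_old: "m < n \<Longrightarrow> src A' m = src A m" and tgt_old: "m < n \<Longrightarrow> tgt A' m = tgt A m"
  and idt_old: "m < n \<Longrightarrow> idt A' m = idt A m" and cmp_old: "m \<le> n \<Longrightarrow> cmp A' m = cmp A m"
  by (simp_all add: adjoin_def)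

lemma ksrc_old: "m \<le> n \<Longrightarrow> ksrc A' k m = ksrc A k m"
  by (induction m) (simp_all add: src_old Suc_le_eq fun_eq_iff)

lemma ktgt_old: "m \<le> n \<Longrightarrow> ktgt A' k m = ktgt A k m"
  by (induction m) (simp_all add: tgt_old Suc_le_eq fun_eq_iff)

lemma lift_old: "m \<le> n \<Longrightarrow> lift A' k m = lift A k m"
  by (induction m) (simp_all add: idt_old Suc_le_eq fun_eq_iff)

lemma composable_old: "m \<le> n \<Longrightarrow> composable A' m = composable A m"
  unfolding composable_def by (simp add: level_old ksrc_old ktgt_old fun_eq_iff)

lemma composable_new:
  "ok f \<Longrightarrow> ok g \<Longrightarrow> composable A' (Suc n) k (cls f) (cls g) \<longleftrightarrow> ok (Cmp k f g)"
  unfolding composable_def by (auto simp: cls_cell new_src new_tgt ksrc_old ktgt_old)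

lemmas new_simps = new_add new_mult new_smult new_oper new_src new_tgt new_cmp composable_new

lemma zero_one_terms:
  obtains u v where "u \<in> \<zero>\<^bsub>level A n\<^esub>" "v \<in> \<one>\<^bsub>level A n\<^esub>"
  using cell_nonempty L.zero_closed L.one_closed by blast

lemma ok_Idt: "a \<in> cells A n \<Longrightarrow> u \<in> a \<Longrightarrow> ok (Idt u)"
  by auto

lemma level_new_alg: "omega_algebra B \<Omega>"
proof -
  obtain u v where u: "u \<in> \<zero>\<^bsub>level A n\<^esub>" and v: "v \<in> \<one>\<^bsub>level A n\<^esub>" by (rule zero_one_terms)
  note uv = ok_Idt[OF L.zero_closed u] ok_Idt[OF L.one_closed v]
  note z = new_zero[OF u] and o = new_one[OF v]
  show ?thesis
  proof (rule omega_algebraI; (elim new_cellE)?)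
    fix a b f g assume fg: "ok f" "ok g" and "a = cls f" "b = cls g"
    then have [simp]: "a = cls f" "b = cls g" by auto
    have ok: "ok (Add f g)" "ok (Mul f g)" "\<And>c. ok (Scl c f)" "\<And>c. ok (Scl c g)" using fg by auto
    show "a \<oplus>\<^bsub>B\<^esub> b \<in> carrier B"
      "a \<otimes>\<^bsub>B\<^esub> b \<in> carrier B"
      using fg ok by (simp_all only: new_add new_mult cls_cell \<open>a = cls f\<close> \<open>b = cls g\<close>)
    show "a \<oplus>\<^bsub>B\<^esub> b = b \<oplus>\<^bsub>B\<^esub> a"
      using cls_eq[OF tm_eq.add_comm[OF fg]] fg by (simp add: new_add)
    show "c \<odot>\<^bsub>B\<^esub> (a \<oplus>\<^bsub>B\<^esub> b) =
      c \<odot>\<^bsub>B\<^esub> a \<oplus>\<^bsub>B\<^esub> c \<odot>\<^bsub>B\<^esub> b" for c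
      using cls_eq[OF tm_eq.scl_add_right[OF fg]] fg ok by (simp add: new_add new_smult)
    show "(c \<odot>\<^bsub>B\<^esub> a) \<otimes>\<^bsub>B\<^esub> b =
      c \<odot>\<^bsub>B\<^esub> (a \<otimes>\<^bsub>B\<^esub> b)" for c
      using cls_eq[OF tm_eq.mul_scl_left[OF fg]] fg ok by (simp add: new_mult new_smult)
    show "a \<otimes>\<^bsub>B\<^esub> (c \<odot>\<^bsub>B\<^esub> b) =
      c \<odot>\<^bsub>B\<^esub> (a \<otimes>\<^bsub>B\<^esub> b)" for c
      using cls_eq[OF tm_eq.mul_scl_right[OF fg]] fg ok by (simp add: new_mult new_smult)
    show "oper B \<tau> (a \<oplus>\<^bsub>B\<^esub> b) =
      oper B \<tau> a \<oplus>\<^bsub>B\<^esub> oper B \<tau> b"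
      if "\<tau> \<in> \<Omega>" for \<tau>
      using cls_eq[OF tm_eq.opr_add[OF that fg]] fg ok that by (simp add: new_add new_oper)
  next
    fix a f assume f: "ok f" and "a = cls f"
    then have [simp]: "a = cls f" by auto
    have ok: "\<And>c. ok (Scl c f)" "\<And>\<tau>. \<tau> \<in> \<Omega> \<Longrightarrow> ok (Opr \<tau> f)" using f by auto
    show "a \<oplus>\<^bsub>B\<^esub> \<zero>\<^bsub>B\<^esub> = a"
      using cls_eq[OF tm_eq.add_zero[OF f u]] f uv by (simp add: new_add z del: tm_ok.simps)
    show "a \<oplus>\<^bsub>B\<^esub> (- 1) \<odot>\<^bsub>B\<^esub> a = \<zero>\<^bsub>B\<^esub>"
      using cls_eq[OF tm_eq.add_neg[OF f u]] f ok by (simp add: new_add new_smult z)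
    show "\<one>\<^bsub>B\<^esub> \<otimes>\<^bsub>B\<^esub> a = a"
      using cls_eq[OF tm_eq.mul_one_left[OF f v]] f uv by (simp add: new_mult o del: tm_ok.simps)
    show "a \<otimes>\<^bsub>B\<^esub> \<one>\<^bsub>B\<^esub> = a"
      using cls_eq[OF tm_eq.mul_one_right[OF f v]] f uv by (simp add: new_mult o del: tm_ok.simps)
    show "c \<odot>\<^bsub>B\<^esub> a \<in> carrier B" for c
      using f ok by (simp only: new_smult cls_cell \<open>a = cls f\<close>)
    show "(c + d) \<odot>\<^bsub>B\<^esub> a =
      c \<odot>\<^bsub>B\<^esub> a \<oplus>\<^bsub>B\<^esub> d \<odot>\<^bsub>B\<^esub> a" for c d
      using cls_eq[OF tm_eq.scl_add_left[OF f]] f ok by (simp add: new_add new_smult)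
    show "(c * d) \<odot>\<^bsub>B\<^esub> a =
      c \<odot>\<^bsub>B\<^esub> (d \<odot>\<^bsub>B\<^esub> a)" for c d
      using cls_eq[OF tm_eq.scl_scl[OF f]] f ok by (simp add: new_smult)
    show "1 \<odot>\<^bsub>B\<^esub> a = a"
      using cls_eq[OF tm_eq.scl_one[OF f]] f by (simp add: new_smult)
    show "oper B \<tau> a \<in> carrier B" if "\<tau> \<in> \<Omega>" for \<tau>
      using f ok that by (simp only: new_oper cls_cell \<open>a = cls f\<close>)
    show "oper B \<tau> (c \<odot>\<^bsub>B\<^esub> a) =
      c \<odot>\<^bsub>B\<^esub> oper B \<tau> a" if "\<tau> \<in> \<Omega>" for \<tau> c
      using cls_eq[OF tm_eq.opr_scl[OF that f]] f ok that by (simp add: new_smult new_oper)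
  next
    fix a b c f g h assume fgh: "ok f" "ok g" "ok h" and "a = cls f" "b = cls g" "c = cls h"
    then have [simp]: "a = cls f" "b = cls g" "c = cls h" by auto
    have ok: "ok (Add f g)" "ok (Mul f g)" "ok (Add g h)" "ok (Mul g h)" "ok (Mul f h)"
      "ok (Mul h f)" "ok (Mul h g)" using fgh by auto
    show "a \<oplus>\<^bsub>B\<^esub> b \<oplus>\<^bsub>B\<^esub> c =
      a \<oplus>\<^bsub>B\<^esub> (b \<oplus>\<^bsub>B\<^esub> c)"
      using cls_eq[OF tm_eq.add_assoc[OF fgh]] fgh ok by (simp add: new_add)
    show "a \<otimes>\<^bsub>B\<^esub> b \<otimes>\<^bsub>B\<^esub> c =
      a \<otimes>\<^bsub>B\<^esub> (b \<otimes>\<^bsub>B\<^esub> c)"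
      using cls_eq[OF tm_eq.mul_assoc[OF fgh]] fgh ok by (simp add: new_mult)
    show "(a \<oplus>\<^bsub>B\<^esub> b) \<otimes>\<^bsub>B\<^esub> c =
      a \<otimes>\<^bsub>B\<^esub> c \<oplus>\<^bsub>B\<^esub> b \<otimes>\<^bsub>B\<^esub> c"
      using cls_eq[OF tm_eq.mul_add_left[OF fgh]] fgh ok by (simp add: new_mult new_add)
    show "c \<otimes>\<^bsub>B\<^esub> (a \<oplus>\<^bsub>B\<^esub> b) =
      c \<otimes>\<^bsub>B\<^esub> a \<oplus>\<^bsub>B\<^esub> c \<otimes>\<^bsub>B\<^esub> b"
      using cls_eq[OF tm_eq.mul_add_right[OF fgh(3,1,2)]] fgh ok by (simp add: new_mult new_add)
  next
    show "\<zero>\<^bsub>B\<^esub> \<in> carrier B" using uv by (simp only: z cls_cell)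
    show "\<one>\<^bsub>B\<^esub> \<in> carrier B" using uv by (simp only: o cls_cell)
  qed
qed

lemma new_src_hom: "omega_hom \<Omega> B (level A' n) (src A' n)"
  and new_tgt_hom: "omega_hom \<Omega> B (level A' n) (tgt A' n)"
proof -
  obtain u v where u: "u \<in> \<zero>\<^bsub>level A n\<^esub>" and v: "v \<in> \<one>\<^bsub>level A n\<^esub>" by (rule zero_one_terms)
  have [simp]: "src A' n (cls (Add f g)) = sc (Add f g)" "tgt A' n (cls (Add f g)) = tg (Add f g)"
    "src A' n (cls (Mul f g)) = sc (Mul f g)" "tgt A' n (cls (Mul f g)) = tg (Mul f g)"
    "src A' n (cls (Scl c f)) = sc (Scl c f)" "tgt A' n (cls (Scl c f)) = tg (Scl c f)"
    if "ok f" "ok g" for f g c using that by (simp_all only: new_src new_tgt tm_ok.simps)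
  have [simp]: "src A' n (cls (Opr \<tau> f)) = sc (Opr \<tau> f)" "tgt A' n (cls (Opr \<tau> f)) = tg (Opr \<tau> f)"
    if "ok f" "\<tau> \<in> \<Omega>" for f \<tau> using that by (simp_all only: new_src new_tgt tm_ok.simps)
  have [simp]: "src A' n (cls (Idt v)) = \<one>\<^bsub>level A n\<^esub>" "tgt A' n (cls (Idt v)) = \<one>\<^bsub>level A n\<^esub>"
    using new_src[OF ok_Idt[OF L.one_closed v]] new_tgt[OF ok_Idt[OF L.one_closed v]]
      cell_of_eq[OF L.one_closed v] by simp_all
  show "omega_hom \<Omega> B (level A' n) (src A' n)"
    unfolding omega_hom_def linear_map_def
    by (intro conjI ballI allI; (elim new_cellE)?)
      (simp_all add: new_simps level_old sc_closed new_one[OF v])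
  show "omega_hom \<Omega> B (level A' n) (tgt A' n)"
    unfolding omega_hom_def linear_map_def
    by (intro conjI ballI allI; (elim new_cellE)?)
      (simp_all add: new_simps level_old tg_closed new_one[OF v])
qed

lemma cell_termE:
  assumes "a \<in> cells A n"
  obtains u where "u \<in> a" "ok (Idt u)" "idt A' n a = cls (Idt u)" "cell_of n A u = a"
  using cell_nonempty[OF assms] ok_Idt[OF assms] new_idt[OF assms] cell_of_eq[OF assms] that by blast

lemma new_idt_hom: "omega_hom \<Omega> (level A' n) B (idt A' n)"
  unfolding omega_hom_def linear_map_def
proof (intro conjI ballI allI)
  obtain v where v: "v \<in> \<one>\<^bsub>level A n\<^esub>" by (rule zero_one_terms)
  show "idt A' n \<one>\<^bsub>level A' n\<^esub> = \<one>\<^bsub>B\<^esub>"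
    using new_idt[OF L.one_closed v] new_one[OF v] by (simp add: level_old)
next
  fix a b assume "a \<in> cells A' n" "b \<in> cells A' n"
  then have a: "a \<in> cells A n" and b: "b \<in> cells A n" by (simp_all add: level_old)
  obtain u where u: "u \<in> a" "ok (Idt u)" "idt A' n a = cls (Idt u)" by (rule cell_termE[OF a])
  obtain v where v: "v \<in> b" "ok (Idt v)" "idt A' n b = cls (Idt v)" by (rule cell_termE[OF b])
  show "idt A' n (a \<oplus>\<^bsub>level A' n\<^esub> b) = idt A' n a \<oplus>\<^bsub>B\<^esub> idt A' n b"
  proof -
    obtain w where w: "w \<in> a \<oplus>\<^bsub>level A n\<^esub> b"
        "idt A' n (a \<oplus>\<^bsub>level A n\<^esub> b) = cls (Idt w)"
      using cell_termE[OF L.a_closed[OF a b]] by metis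
    show ?thesis
      using cls_eq[OF tm_eq.idt_add[OF a b u(1) v(1) w(1)]] w(2) u v
      by (simp add: level_old new_add del: tm_ok.simps)
  qed
  show "idt A' n (a \<otimes>\<^bsub>level A' n\<^esub> b) = idt A' n a \<otimes>\<^bsub>B\<^esub> idt A' n b"
  proof -
    obtain w where w: "w \<in> a \<otimes>\<^bsub>level A n\<^esub> b"
        "idt A' n (a \<otimes>\<^bsub>level A n\<^esub> b) = cls (Idt w)"
      using cell_termE[OF L.m_closed[OF a b]] by metis
    show ?thesis
      using cls_eq[OF tm_eq.idt_mul[OF a b u(1) v(1) w(1)]] w(2) u v
      by (simp add: level_old new_mult del: tm_ok.simps)
  qed
next
  fix a assume "a \<in> cells A' n"
  then have a: "a \<in> cells A n" by (simp_all add: level_old)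
  obtain u where u: "u \<in> a" "ok (Idt u)" "idt A' n a = cls (Idt u)" by (rule cell_termE[OF a])
  show "idt A' n a \<in> carrier B" using u by (simp add: cls_cell del: tm_ok.simps)
  show "idt A' n (c \<odot>\<^bsub>level A' n\<^esub> a) = c \<odot>\<^bsub>B\<^esub> idt A' n a" for c
  proof -
    obtain w where w: "w \<in> c \<odot>\<^bsub>level A n\<^esub> a"
        "idt A' n (c \<odot>\<^bsub>level A n\<^esub> a) = cls (Idt w)"
      using cell_termE[OF L.smult_closed[OF a]] by metis
    show ?thesis
      using cls_eq[OF tm_eq.idt_scl[OF a u(1) w(1)]] w(2) u
      by (simp add: level_old new_smult del: tm_ok.simps)
  qed
  show "idt A' n (oper (level A' n) \<tau> a) = oper B \<tau> (idt A' n a)"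
    if t: "\<tau> \<in> \<Omega>" for \<tau>
  proof -
    obtain w where w: "w \<in> oper (level A n) \<tau> a"
        "idt A' n (oper (level A n) \<tau> a) = cls (Idt w)"
      using cell_termE[OF L.oper_closed[OF t a]] by metis
    show ?thesis
      using cls_eq[OF tm_eq.idt_opr[OF t a u(1) w(1)]] w(2) u t
      by (simp add: level_old new_oper del: tm_ok.simps)
  qed
qed

lemma composable_newE:
  assumes "composable A' (Suc n) k a b"
  obtains f g where "ok (Cmp k f g)" "a = cls f" "b = cls g"
proof -
  obtain f g where "ok f" "ok g" "a = cls f" "b = cls g"
    using assms unfolding composable_def by (blast elim: new_cellE)
  then show ?thesis using that[of f g] assms composable_new[of f g k] by blast
qed

text \<open>The rules of the congruence that involve composites presuppose that both sides are well formed.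
  The next lemmas derive this from composability of the constituents alone.\<close>

lemma ok_Cmp_algebra:
  assumes fg: "ok (Cmp k f g)" and fg': "ok (Cmp k f' g')"
  shows "ok (Cmp k (Add f f') (Add g g'))" "ok (Cmp k (Mul f f') (Mul g g'))"
    "ok (Cmp k (Scl c f) (Scl c g))" "\<tau> \<in> \<Omega> \<Longrightarrow> ok (Cmp k (Opr \<tau> f) (Opr \<tau> g))"
proof -
  have ok: "ok f" "ok g" "ok f'" "ok g'" and k: "k \<le> n"
    and e: "ktgt A k n (tg f) = ksrc A k n (sc g)" "ktgt A k n (tg f') = ksrc A k n (sc g')"
    using assms by auto
  have t: "omega_hom \<Omega> (level A n) (level A k) (ktgt A k n)"
    and s: "omega_hom \<Omega> (level A n) (level A k) (ksrc A k n)"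
    using ktgt_hom[of n k] ksrc_hom[of n k] k by simp_all
  note c = sc_closed[OF ok(2)] sc_closed[OF ok(4)] tg_closed[OF ok(1)] tg_closed[OF ok(3)]
  show "ok (Cmp k (Add f f') (Add g g'))"
    using ok k e c by (simp add: omega_homD(4)[OF t] omega_homD(4)[OF s])
  show "ok (Cmp k (Mul f f') (Mul g g'))"
    using ok k e c by (simp add: omega_homD(6)[OF t] omega_homD(6)[OF s])
  show "ok (Cmp k (Scl c f) (Scl c g))"
    using ok k e c by (simp add: omega_homD(5)[OF t] omega_homD(5)[OF s])
  show "ok (Cmp k (Opr \<tau> f) (Opr \<tau> g))" if "\<tau> \<in> \<Omega>"
    using ok k e c that by (simp add: omega_homD(7)[OF t] omega_homD(7)[OF s])
qed

lemma ktgt_tg_Cmp: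
  assumes "ok (Cmp k f g)" "l \<le> k"
  shows "ktgt A l n (tg (Cmp k f g)) = ktgt A l n (tg g)" "ksrc A l n (sc (Cmp k f g)) = ksrc A l n (sc f)"
  using assms composable_boundary[OF assms(1)] ktgt_cmp_low[of n l k "tg f" "tg g"]
    ksrc_cmp_low[of n l k "sc f" "sc g"] by (cases "k = n"; simp)+

lemma ok_Cmp_assoc:
  assumes "ok (Cmp k f g)" "ok (Cmp k g h)"
  shows "ok (Cmp k (Cmp k f g) h)" "ok (Cmp k f (Cmp k g h))"
  using assms ktgt_tg_Cmp[OF assms(1), of k] ktgt_tg_Cmp[OF assms(2), of k] by (simp_all del: tm_src.simps tm_tgt.simps)

lemma ok_Cmp_exchange:
  assumes l: "l < k" and fg: "ok (Cmp k f g)" and fg': "ok (Cmp k f' g')"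
    and f: "ok (Cmp l f f')" and g: "ok (Cmp l g g')"
  shows "ok (Cmp l (Cmp k f g) (Cmp k f' g'))" "ok (Cmp k (Cmp l f f') (Cmp l g g'))"
proof -
  have k: "k \<le> n" and ok: "ok f" "ok g" "ok f'" "ok g'" using assms by auto
  have ln: "l < n" "l \<noteq> n" using l k by auto
  have "ktgt A l n (tg g) = ksrc A l n (sc g')" using g by simp
  also have "\<dots> = ksrc A l k (ksrc A k n (sc g'))" using l k by (simp add: ksrc_ksrc)
  also have "\<dots> = ksrc A l k (ktgt A k n (tg f'))" using fg' by simp
  also have "\<dots> = ksrc A l n (tg f')" using l k ok by (simp add: ksrc_ktgt tg_closed)
  also have "\<dots> = ksrc A l n (sc f')" using parallel_ksrc[OF sc_tg_parallel[OF ok(3)] ln(1)] by simp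
  finally show "ok (Cmp l (Cmp k f g) (Cmp k f' g'))"
    using ktgt_tg_Cmp[OF fg, of l] ktgt_tg_Cmp[OF fg', of l] fg fg' l k
    by (simp del: tm_src.simps tm_tgt.simps)
  have "ktgt A k n (cmp A n l (tg f) (tg f')) = ksrc A k n (cmp A n l (sc g) (sc g'))"
    using ktgt_cmp_high[OF _ l k composable_boundary(2)[OF f ln(2)]] fg fg'
      ksrc_cmp_high[OF _ l k composable_boundary(1)[OF g ln(2)]] by simp
  then show "ok (Cmp k (Cmp l f f') (Cmp l g g'))" using f g l k by simp
qed

lemma new_unit_left:
  assumes "k \<le> n" "a \<in> carrier B"
  shows "cmp A' (Suc n) k (lift A' k (Suc n) (ksrc A' k (Suc n) a)) a = a"
proof -
  obtain f where f: "ok f" "a = cls f" using assms(2) by (rule new_cellE)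
  define c where "c = lift A k n (ksrc A k n (sc f))"
  have c: "c \<in> cells A n"
    using assms(1) omega_homD(3)[OF lift_hom[of n k]] omega_homD(3)[OF ksrc_hom[of n k]] sc_closed[OF f(1)]
    by (simp add: c_def)
  obtain u where u: "u \<in> c" "ok (Idt u)" "idt A' n c = cls (Idt u)" by (rule cell_termE[OF c])
  have e: "Cmp k (Idt u) f \<approx> f" by (rule tm_eq.cmp_idt_left) (use f assms u c_def in auto)
  have "lift A' k (Suc n) (ksrc A' k (Suc n) a) = cls (Idt u)"
    using assms(1) f u by (simp add: c_def new_src lift_old ksrc_old)
  then show ?thesis using new_cmp[of k "Idt u" f] eqv_sound[OF e] cls_eq[OF e] f
    by (simp del: tm_ok.simps lift.simps ksrc.simps)
qed

lemma new_unit_right: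
  assumes "k \<le> n" "a \<in> carrier B"
  shows "cmp A' (Suc n) k a (lift A' k (Suc n) (ktgt A' k (Suc n) a)) = a"
proof -
  obtain f where f: "ok f" "a = cls f" using assms(2) by (rule new_cellE)
  define c where "c = lift A k n (ktgt A k n (tg f))"
  have c: "c \<in> cells A n"
    using assms(1) omega_homD(3)[OF lift_hom[of n k]] omega_homD(3)[OF ktgt_hom[of n k]] tg_closed[OF f(1)]
    by (simp add: c_def)
  obtain u where u: "u \<in> c" "ok (Idt u)" "idt A' n c = cls (Idt u)" by (rule cell_termE[OF c])
  have e: "Cmp k f (Idt u) \<approx> f" by (rule tm_eq.cmp_idt_right) (use f assms u c_def in auto)
  have "lift A' k (Suc n) (ktgt A' k (Suc n) a) = cls (Idt u)"
    using assms(1) f u by (simp add: c_def new_tgt lift_old ktgt_old)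
  then show ?thesis using new_cmp[of k f "Idt u"] eqv_sound[OF e] cls_eq[OF e] f
    by (simp del: tm_ok.simps lift.simps ktgt.simps)
qed

lemma new_cmp_idt:
  assumes c: "composable A n k a b"
  shows "cmp A' (Suc n) k (idt A' n a) (idt A' n b) = idt A' n (cmp A n k a b)"
proof -
  have ab: "a \<in> cells A n" "b \<in> cells A n" "k < n" "ktgt A k n a = ksrc A k n b"
    using c by (auto simp: composable_def)
  obtain u where u: "u \<in> a" "ok (Idt u)" "idt A' n a = cls (Idt u)" by (rule cell_termE[OF ab(1)])
  obtain v where v: "v \<in> b" "ok (Idt v)" "idt A' n b = cls (Idt v)" by (rule cell_termE[OF ab(2)])
  have d: "cmp A n k a b \<in> cells A n" using cmp_closed[OF _ c] by simp
  obtain w where w: "w \<in> cmp A n k a b" "idt A' n (cmp A n k a b) = cls (Idt w)"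
    using cell_termE[OF d] by metis
  have e: "Cmp k (Idt u) (Idt v) \<approx> Idt w"
    by (rule tm_eq.idt_cmp[OF ab(3,1,2,4) u(1) v(1) w(1)])
  show ?thesis using new_cmp[of k "Idt u" "Idt v"] eqv_sound[OF e] cls_eq[OF e] u v w
    by (simp del: tm_ok.simps)
qed

text \<open>In dimensions up to \<open>n\<close> the axioms are those of \<open>A\<close>; in dimension
  \<open>n + 1\<close> each of them is a rule of the congruence or follows from
  \<open>eqv_sound\<close>.\<close>

theorem adjoin_higher_algebra: "higher_algebra \<Omega> (enat (Suc n)) A'"
proof (rule higher_algebra.intro)
  note old = level_old ksrc_old ktgt_old lift_old src_old tgt_old idt_old cmp_old composable_old
  note [simp del] = tm_ok.simps tm_src.simps tm_tgt.simps ksrc.simps ktgt.simps lift.simps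
  fix m k
  { assume "enat (Suc (Suc m)) \<le> enat (Suc n)"
    then have m: "Suc m < n \<or> n = Suc m" by auto
    fix a assume a: "a \<in> cells A' (Suc (Suc m))"
    have "src A' m (src A' (Suc m) a) = src A' m (tgt A' (Suc m) a)
        \<and> tgt A' m (src A' (Suc m) a) = tgt A' m (tgt A' (Suc m) a)"
      using m
    proof
      assume "Suc m < n"
      then show ?thesis using a glob_src[of m a] glob_tgt[of m a] by (simp add: old)
    next
      assume n: "n = Suc m"
      then have "a \<in> carrier B" using a by simp
      then obtain f where f: "ok f" "a = cls f" by (rule new_cellE)
      then show ?thesis using sc_tg_parallel[OF f(1)] new_src[OF f(1)] new_tgt[OF f(1)]
        src_old[of m] tgt_old[of m] n by (simp add: parallel_def)
    qed
    then show "src A' m (src A' (Suc m) a) = src A' m (tgt A' (Suc m) a)"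
      "tgt A' m (src A' (Suc m) a) = tgt A' m (tgt A' (Suc m) a)" by blast+
  }
  { assume "enat (Suc m) \<le> enat (Suc n)"
    then have m: "m < n \<or> m = n" by auto
    show "omega_hom \<Omega> (level A' (Suc m)) (level A' m) (src A' m)"
      using m src_hom[of m] new_src_hom by (auto simp: old)
    show "omega_hom \<Omega> (level A' (Suc m)) (level A' m) (tgt A' m)"
      using m tgt_hom[of m] new_tgt_hom by (auto simp: old)
    show "omega_hom \<Omega> (level A' m) (level A' (Suc m)) (idt A' m)"
      using m idt_hom[of m] new_idt_hom by (auto simp: old)
    show "src A' m (idt A' m a) = a" "tgt A' m (idt A' m a) = a" if a: "a \<in> cells A' m" for a
    proof -
      have "src A' m (idt A' m a) = a \<and> tgt A' m (idt A' m a) = a" using m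
      proof
        assume "m < n"
        then show ?thesis using a src_idt[of m a] tgt_idt[of m a] by (simp add: old)
      next
        assume n: "m = n"
        then have "a \<in> cells A n" using a by (simp add: old)
        then obtain u where u: "ok (Idt u)" "idt A' n a = cls (Idt u)" "cell_of n A u = a"
          by (rule cell_termE)
        then show ?thesis using n new_src[OF u(1)] new_tgt[OF u(1)]
          by (simp add: tm_src.simps tm_tgt.simps)
      qed
      then show "src A' m (idt A' m a) = a" "tgt A' m (idt A' m a) = a" by blast+
    qed
    show "src A' m (cmp A' (Suc m) m a b) = src A' m a" "tgt A' m (cmp A' (Suc m) m a b) = tgt A' m b"
      if c: "composable A' (Suc m) m a b" for a b
    proof -
      have "src A' m (cmp A' (Suc m) m a b) = src A' m a \<and> tgt A' m (cmp A' (Suc m) m a b) = tgt A' m b"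
        using m
      proof
        assume "m < n"
        then show ?thesis using c src_cmp_top[of m a b] tgt_cmp_top[of m a b] by (simp add: old)
      next
        assume n: "m = n"
        then obtain f g where f: "ok (Cmp n f g)" "a = cls f" "b = cls g"
          using c composable_newE by blast
        then have "ok f" "ok g" by (simp_all add: tm_ok.simps)
        then show ?thesis using n f new_src[OF f(1)] new_tgt[OF f(1)]
          by (simp add: tm_src.simps tm_tgt.simps new_cmp new_src new_tgt)
      qed
      then show "src A' m (cmp A' (Suc m) m a b) = src A' m a"
        "tgt A' m (cmp A' (Suc m) m a b) = tgt A' m b" by blast+
    qed
    show "src A' m (cmp A' (Suc m) k a b) = cmp A' m k (src A' m a) (src A' m b)"
      "tgt A' m (cmp A' (Suc m) k a b) = cmp A' m k (tgt A' m a) (tgt A' m b)"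
      if k: "k < m" and c: "composable A' (Suc m) k a b" for a b
    proof -
      have "src A' m (cmp A' (Suc m) k a b) = cmp A' m k (src A' m a) (src A' m b)
        \<and> tgt A' m (cmp A' (Suc m) k a b) = cmp A' m k (tgt A' m a) (tgt A' m b)"
        using m
      proof
        assume "m < n"
        then show ?thesis using k c src_cmp[of m k a b] tgt_cmp[of m k a b] by (simp add: old)
      next
        assume n: "m = n"
        then obtain f g where f: "ok (Cmp k f g)" "a = cls f" "b = cls g"
          using c composable_newE by blast
        then have "ok f" "ok g" by (simp_all add: tm_ok.simps)
        then show ?thesis using n k f new_src[OF f(1)] new_tgt[OF f(1)]
          by (simp add: tm_src.simps tm_tgt.simps new_cmp new_src new_tgt old)
      qed
      then show "src A' m (cmp A' (Suc m) k a b) = cmp A' m k (src A' m a) (src A' m b)"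
        "tgt A' m (cmp A' (Suc m) k a b) = cmp A' m k (tgt A' m a) (tgt A' m b)" by blast+
    qed
    show "cmp A' (Suc m) k (idt A' m a) (idt A' m b) = idt A' m (cmp A' m k a b)"
      if c: "composable A' m k a b" for a b
      using m c cmp_idt[of m k a b] new_cmp_idt[of k a b] by (auto simp: old)
  }
  { assume "enat m \<le> enat (Suc n)"
    then have m: "m \<le> n \<or> m = Suc n" by auto
    show "omega_algebra (level A' m) \<Omega>"
      using m level_alg[of m] level_new_alg by (auto simp: old)
    show "cmp A' m k (lift A' k m (ksrc A' k m a)) a = a"
      "cmp A' m k a (lift A' k m (ktgt A' k m a)) = a" if "k < m" "a \<in> cells A' m" for a
      using m that unit_left[of m k a] unit_right[of m k a] new_unit_left[of k a] new_unit_right[of k a]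
      by (auto simp only: old enat_ord_simps less_Suc_eq_le)
    fix a b assume c: "composable A' m k a b"
    have new: "\<exists>f g. ok (Cmp k f g) \<and> a = cls f \<and> b = cls g \<and> ok f \<and> ok g" if n: "m = Suc n"
    proof -
      obtain f g where f: "ok (Cmp k f g)" "a = cls f" "b = cls g"
        using c n composable_newE by blast
      then have "ok f" "ok g" by (simp_all add: tm_ok.simps)
      with f show ?thesis by blast
    qed
    show "cmp A' m k a b \<in> cells A' m"
      using m
    proof
      assume "m = Suc n"
      with new obtain f g where "ok (Cmp k f g)" "a = cls f" "b = cls g" by metis
      then show ?thesis using \<open>m = Suc n\<close> by (simp add: new_cmp cls_cell)
    qed (use c cmp_closed[of m] in \<open>simp add: old\<close>)
    show "cmp A' m k (c \<odot>\<^bsub>level A' m\<^esub> a) (c \<odot>\<^bsub>level A' m\<^esub> b) = c \<odot>\<^bsub>level A' m\<^esub> cmp A' m k a b" for c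
      using m
    proof
      assume "m \<le> n"
      then show ?thesis using \<open>composable A' m k a b\<close> cmp_smult[of m k a b c] by (simp add: old)
    next
      assume n: "m = Suc n"
      with new obtain f g where f: "ok (Cmp k f g)" "a = cls f" "b = cls g" "ok f" "ok g" by metis
      then show ?thesis
        using n cls_eq[OF tm_eq.cmp_scl[OF f(1) ok_Cmp_algebra(3)[OF f(1) f(1)]]]
          ok_Cmp_algebra(3)[OF f(1) f(1)] by (simp add: new_smult new_cmp)
    qed
    show "cmp A' m k (oper (level A' m) \<tau> a) (oper (level A' m) \<tau> b) = oper (level A' m) \<tau> (cmp A' m k a b)"
      if t: "\<tau> \<in> \<Omega>" for \<tau>
      using m
    proof
      assume "m \<le> n"
      then show ?thesis using c t cmp_oper[of m k a b \<tau>] by (simp add: old)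
    next
      assume n: "m = Suc n"
      with new obtain f g where f: "ok (Cmp k f g)" "a = cls f" "b = cls g" "ok f" "ok g" by metis
      then show ?thesis
        using n t cls_eq[OF tm_eq.cmp_opr[OF t f(1) ok_Cmp_algebra(4)[OF f(1) f(1) t]]]
          ok_Cmp_algebra(4)[OF f(1) f(1) t] by (simp add: new_oper new_cmp)
    qed
    fix b' assume c': "composable A' m k b b'"
    show "cmp A' m k (cmp A' m k a b) b' = cmp A' m k a (cmp A' m k b b')"
      using m
    proof
      assume "m \<le> n"
      then show ?thesis using c c' cmp_assoc[of m k a b b'] by (simp add: old)
    next
      assume n: "m = Suc n"
      obtain f g h where e: "ok f" "ok g" "ok h" "a = cls f" "b = cls g" "b' = cls h"
        using c c' n unfolding composable_def by (auto elim!: new_cellE)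
      then have fg: "ok (Cmp k f g)" and gh: "ok (Cmp k g h)"
        using c c' n by (simp_all add: composable_new)
      note o = ok_Cmp_assoc[OF fg gh]
      show ?thesis using n e fg gh o cls_eq[OF tm_eq.cmp_assoc[OF o]] by (simp add: new_cmp)
    qed
  }
  { fix a b a' b' assume "enat m \<le> enat (Suc n)" and c: "composable A' m k a b" "composable A' m k a' b'"
    then have m: "m \<le> n \<or> m = Suc n" by auto
    have new: "\<exists>f g f' g'. ok f \<and> ok g \<and> ok f' \<and> ok g' \<and> a = cls f \<and> b = cls g \<and>
      a' = cls f' \<and> b' = cls g' \<and> ok (Cmp k f g) \<and> ok (Cmp k f' g')" if n: "m = Suc n"
    proof -
      have "a \<in> carrier B" "b \<in> carrier B" "a' \<in> carrier B" "b' \<in> carrier B"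
        using c n by (simp_all add: composable_def)
      then obtain f g f' g' where e: "ok f" "ok g" "ok f'" "ok g'" "a = cls f" "b = cls g"
          "a' = cls f'" "b' = cls g'"
        by (elim new_cellE) metis
      then have "ok (Cmp k f g)" "ok (Cmp k f' g')" using c n by (simp_all add: composable_new)
      with e show ?thesis by blast
    qed
    show "cmp A' m k (a \<oplus>\<^bsub>level A' m\<^esub> a') (b \<oplus>\<^bsub>level A' m\<^esub> b') =
      cmp A' m k a b \<oplus>\<^bsub>level A' m\<^esub> cmp A' m k a' b'"
      using m
    proof
      assume "m \<le> n"
      then show ?thesis using c cmp_add[of m k a b a' b'] by (simp add: old)
    next
      assume n: "m = Suc n"
      with new obtain f g f' g' where e: "ok f" "ok g" "ok f'" "ok g'" "a = cls f" "b = cls g"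
          "a' = cls f'" "b' = cls g'" "ok (Cmp k f g)" "ok (Cmp k f' g')" by metis
      note o = ok_Cmp_algebra(1)[OF e(9,10)]
      show ?thesis using n e o cls_eq[OF tm_eq.cmp_add[OF e(9,10) o]] by (simp add: new_cmp new_add)
    qed
    show "cmp A' m k (a \<otimes>\<^bsub>level A' m\<^esub> a') (b \<otimes>\<^bsub>level A' m\<^esub> b') =
      cmp A' m k a b \<otimes>\<^bsub>level A' m\<^esub> cmp A' m k a' b'"
      using m
    proof
      assume "m \<le> n"
      then show ?thesis using c cmp_mult[of m k a b a' b'] by (simp add: old)
    next
      assume n: "m = Suc n"
      with new obtain f g f' g' where e: "ok f" "ok g" "ok f'" "ok g'" "a = cls f" "b = cls g"
          "a' = cls f'" "b' = cls g'" "ok (Cmp k f g)" "ok (Cmp k f' g')" by metis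
      note o = ok_Cmp_algebra(2)[OF e(9,10)]
      show ?thesis using n e o cls_eq[OF tm_eq.cmp_mul[OF e(9,10) o]] by (simp add: new_cmp new_mult)
    qed
    fix l assume l: "l < k" and d: "composable A' m l a a'" "composable A' m l b b'"
    show "cmp A' m l (cmp A' m k a b) (cmp A' m k a' b') = cmp A' m k (cmp A' m l a a') (cmp A' m l b b')"
      using m
    proof
      assume "m \<le> n"
      then show ?thesis using c l d cmp_exchange[of m l k a b a' b'] by (simp add: old)
    next
      assume n: "m = Suc n"
      with new obtain f g f' g' where e: "ok f" "ok g" "ok f'" "ok g'" "a = cls f" "b = cls g"
          "a' = cls f'" "b' = cls g'" "ok (Cmp k f g)" "ok (Cmp k f' g')" by metis
      have h: "ok (Cmp l f f')" "ok (Cmp l g g')" using d n e by (simp_all add: composable_new)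
      note o = ok_Cmp_exchange[OF l e(9,10) h]
      show ?thesis using n e o h cls_eq[OF tm_eq.exchange[OF l o]] by (simp add: new_cmp)
    qed
  }
qed

lemma new_cell_nonempty: "a \<in> carrier B \<Longrightarrow> a \<noteq> {}"
  using in_cls by (auto elim!: new_cellE)

lemma new_cell_disjoint:
  "a \<in> carrier B \<Longrightarrow> b \<in> carrier B \<Longrightarrow> u \<in> a \<Longrightarrow> u \<in> b \<Longrightarrow> a = b"
  by (elim new_cellE) (metis cls_eq eqv_cls)

end

section \<open>The free algebra on a set\<close>

lemma poly_mapping_sum_single:
  "p = (\<Sum>u\<in>Poly_Mapping.keys p. Poly_Mapping.single u (Poly_Mapping.lookup p u))"
  by (rule poly_mapping_eqI)
    (auto simp: lookup_sum lookup_single when_def in_keys_iff sum.delta' if_distrib cong: if_cong)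

lemma single_zero_commute:
  fixes p :: "'a::monoid_add \<Rightarrow>\<^sub>0 'k::comm_semiring_1"
  shows "Poly_Mapping.single 0 c * p = p * Poly_Mapping.single 0 c"
proof -
  have "Poly_Mapping.single 0 c * (\<Sum>u\<in>K. Poly_Mapping.single u (a u)) =
      (\<Sum>u\<in>K. Poly_Mapping.single u (a u)) * Poly_Mapping.single 0 c" for K :: "'a set" and a
    by (simp add: sum_distrib_left sum_distrib_right mult_single mult.commute)
  from this[of "Poly_Mapping.lookup p" "Poly_Mapping.keys p"] show ?thesis
    unfolding poly_mapping_sum_single[symmetric] .
qed

lemma lin_bracket_add: "lin_bracket \<tau> (p + q) = lin_bracket \<tau> p + lin_bracket \<tau> q"
  unfolding lin_bracket_def
  by (rule setsum_keys_plus_distrib) (simp_all add: single_add)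

text \<open>Summation over a fixed finite set in place of the support, which may shrink under
  scaling.\<close>

lemma lin_bracket_superset:
  assumes "finite S" "Poly_Mapping.keys p \<subseteq> S"
  shows "lin_bracket \<tau> p = (\<Sum>u\<in>S. Poly_Mapping.single (bracket \<tau> u) (Poly_Mapping.lookup p u))"
  unfolding lin_bracket_def using assms
  by (intro sum.mono_neutral_left) (auto simp: in_keys_iff)

lemma lin_bracket_scale:
  fixes p :: "('z, 'o) omon \<Rightarrow>\<^sub>0 'k::comm_semiring_1"
  shows "lin_bracket \<tau> (Poly_Mapping.map ((*) c) p) = Poly_Mapping.map ((*) c) (lin_bracket \<tau> p)"
proof -
  have l: "Poly_Mapping.lookup (Poly_Mapping.map ((*) c) p) u = c * Poly_Mapping.lookup p u" for u
    by (simp add: map.rep_eq when_def)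
  have k: "Poly_Mapping.keys (Poly_Mapping.map ((*) c) p) \<subseteq> Poly_Mapping.keys p"
    by (auto simp: in_keys_iff l)
  have "lin_bracket \<tau> (Poly_Mapping.map ((*) c) p) =
      (\<Sum>u\<in>Poly_Mapping.keys p. Poly_Mapping.single (bracket \<tau> u) (c * Poly_Mapping.lookup p u))"
    by (simp add: lin_bracket_superset[OF _ k] l)
  also have "\<dots> = Poly_Mapping.single 0 c * lin_bracket \<tau> p"
    by (simp add: lin_bracket_def sum_distrib_left mult_single)
  finally show ?thesis by (simp add: mult_map_scale_conv_mult)
qed

lemma lin_bracket_single: "lin_bracket \<tau> (Poly_Mapping.single u c) = Poly_Mapping.single (bracket \<tau> u) c"
  by (cases "c = 0") (simp_all add: lin_bracket_def)

lemma Word_in_free_omon: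
  "Word w \<in> free_omon Z \<Omega> \<longleftrightarrow>
    (\<forall>x\<in>set w. x \<in> Var ` Z \<or> (\<exists>\<tau>\<in>\<Omega>. \<exists>u\<in>free_omon Z \<Omega>. x = Br \<tau> u))"
proof
  assume "Word w \<in> free_omon Z \<Omega>"
  then obtain n where "Word w \<in> omon_upto Z \<Omega> n" by (auto simp: free_omon_def)
  then show "\<forall>x\<in>set w. x \<in> Var ` Z \<or> (\<exists>\<tau>\<in>\<Omega>. \<exists>u\<in>free_omon Z \<Omega>. x = Br \<tau> u)"
    by (cases n) (auto simp: free_omon_def)
next
  define W where "W M = {Word w | w. set w \<subseteq> Var ` Z \<union> {Br \<tau> u | \<tau> u. \<tau> \<in> \<Omega> \<and> u \<in> M}}" for M
  have W: "W M \<subseteq> W M'" if "M \<subseteq> M'" for M M'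
  proof
    fix x assume "x \<in> W M"
    then obtain w where w: "x = Word w" "set w \<subseteq> Var ` Z \<union> {Br \<tau> u | \<tau> u. \<tau> \<in> \<Omega> \<and> u \<in> M}"
      unfolding W_def by auto
    have "{Br \<tau> u | \<tau> u. \<tau> \<in> \<Omega> \<and> u \<in> M} \<subseteq> {Br \<tau> u | \<tau> u. \<tau> \<in> \<Omega> \<and> u \<in> M'}"
      using that by auto
    with w(2) have "set w \<subseteq> Var ` Z \<union> {Br \<tau> u | \<tau> u. \<tau> \<in> \<Omega> \<and> u \<in> M'}"
      by (metis (no_types, lifting) Un_mono order_trans subset_refl)
    then show "x \<in> W M'" unfolding W_def using w(1) by auto
  qed
  have Suc_W: "omon_upto Z \<Omega> (Suc n) = W (omon_upto Z \<Omega> n)" for n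
    by (simp add: W_def)
  have step: "omon_upto Z \<Omega> n \<subseteq> omon_upto Z \<Omega> (Suc n)" for n
  proof (induction n)
    case (Suc n)
    then show ?case unfolding Suc_W by (rule W)
  qed auto
  have mono: "m \<le> n \<Longrightarrow> omon_upto Z \<Omega> m \<subseteq> omon_upto Z \<Omega> n" for m n
    by (rule lift_Suc_mono_le[of "omon_upto Z \<Omega>"]) (rule step)
  assume "\<forall>x\<in>set w. x \<in> Var ` Z \<or> (\<exists>\<tau>\<in>\<Omega>. \<exists>u\<in>free_omon Z \<Omega>. x = Br \<tau> u)"
  define B where "B n = {Br \<tau> u | \<tau> u. \<tau> \<in> \<Omega> \<and> u \<in> omon_upto Z \<Omega> n}" for n
  have B: "B k \<subseteq> B l" if "k \<le> l" for k l
    using mono[OF that] unfolding B_def by blast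
  have BE: "\<exists>n. x \<in> Var ` Z \<union> B n" if "x \<in> set w" for x
    using \<open>\<forall>x\<in>set w. _ x\<close> that unfolding B_def free_omon_def by fast
  have "\<exists>n. set w' \<subseteq> Var ` Z \<union> B n" if "set w' \<subseteq> set w" for w'
    using that
  proof (induction w')
    case (Cons x w')
    then obtain n where n: "set w' \<subseteq> Var ` Z \<union> B n" by auto
    obtain m where m: "x \<in> Var ` Z \<union> B m" using BE[of x] Cons.prems by auto
    have "set (x # w') \<subseteq> Var ` Z \<union> B (max n m)"
      using n m B[of n "max n m"] B[of m "max n m"] by auto
    then show ?case by blast
  qed simp
  then obtain n where "set w \<subseteq> Var ` Z \<union> B n" by blast
  then have "Word w \<in> omon_upto Z \<Omega> (Suc n)" by (simp add: B_def)
  then show "Word w \<in> free_omon Z \<Omega>" unfolding free_omon_def by blast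
qed

lemma free_omon_add: "u \<in> free_omon Z \<Omega> \<Longrightarrow> v \<in> free_omon Z \<Omega> \<Longrightarrow> u + v \<in> free_omon Z \<Omega>"
  by (cases u; cases v) (auto simp: plus_omon_def Word_in_free_omon)

lemma free_omon_zero: "0 \<in> free_omon Z \<Omega>"
  by (simp add: zero_omon_def Word_in_free_omon)

lemma free_omon_bracket: "\<tau> \<in> \<Omega> \<Longrightarrow> u \<in> free_omon Z \<Omega> \<Longrightarrow> bracket \<tau> u \<in> free_omon Z \<Omega>"
  by (simp add: bracket_def Word_in_free_omon)

lemma Pol_in_pol_cell: "Pol p \<in> pol_cell q \<longleftrightarrow> p = q"
  by (simp add: pol_cell_def)

lemma pol_cell_eq_iff: "pol_cell p = pol_cell q \<longleftrightarrow> p = q"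
  by (simp add: pol_cell_def)

context
  fixes Z :: "'z set" and \<Omega> :: "'o set"
begin

abbreviation A0 :: "('k::field_char_0, ('z, 'o, 'k, 'x) cell, 'o) omega_alg" where
  "A0 \<equiv> free_omega_alg Z \<Omega>"

lemma A0_ops:
  "pol_cell p \<oplus>\<^bsub>A0\<^esub> pol_cell q = pol_cell (p + q)"
  "pol_cell p \<otimes>\<^bsub>A0\<^esub> pol_cell q = pol_cell (p * q)"
  "c \<odot>\<^bsub>A0\<^esub> pol_cell p = pol_cell (Poly_Mapping.single 0 c * p)"
  "oper A0 \<tau> (pol_cell p) = pol_cell (lin_bracket \<tau> p)"
  "\<zero>\<^bsub>A0\<^esub> = pol_cell 0" "\<one>\<^bsub>A0\<^esub> = pol_cell 1"
  unfolding free_omega_alg_def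
  by (simp_all add: Pol_in_pol_cell pol_cell_def mon_cell_def mult_map_scale_conv_mult)

lemma A0_carrier: "carrier A0 = pol_cell ` {p. Poly_Mapping.keys p \<subseteq> free_omon Z \<Omega>}"
  unfolding free_omega_alg_def by auto

lemma A0_cellE:
  assumes "a \<in> carrier A0"
  obtains p where "a = pol_cell p" "Poly_Mapping.keys p \<subseteq> free_omon Z \<Omega>"
  using assms unfolding A0_carrier by auto

lemma keys_mult_free:
  assumes "Poly_Mapping.keys p \<subseteq> free_omon Z \<Omega>" "Poly_Mapping.keys q \<subseteq> free_omon Z \<Omega>"
  shows "Poly_Mapping.keys (p * q) \<subseteq> free_omon Z \<Omega>"
  using keys_mult[of p q] assms free_omon_add by blast

lemma keys_bracket_free:
  assumes "\<tau> \<in> \<Omega>" "Poly_Mapping.keys p \<subseteq> free_omon Z \<Omega>"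
  shows "Poly_Mapping.keys (lin_bracket \<tau> p) \<subseteq> free_omon Z \<Omega>"
proof -
  have "Poly_Mapping.keys (lin_bracket \<tau> p) \<subseteq>
      (\<Union>u\<in>Poly_Mapping.keys p. Poly_Mapping.keys (Poly_Mapping.single (bracket \<tau> u) (Poly_Mapping.lookup p u)))"
    unfolding lin_bracket_def by (rule keys_sum)
  also have "\<dots> \<subseteq> free_omon Z \<Omega>"
  proof (rule UN_least)
    fix u assume "u \<in> Poly_Mapping.keys p"
    then have "bracket \<tau> u \<in> free_omon Z \<Omega>" using assms by (intro free_omon_bracket) auto
    then show "Poly_Mapping.keys (Poly_Mapping.single (bracket \<tau> u) (Poly_Mapping.lookup p u))
      \<subseteq> free_omon Z \<Omega>" by simp
  qed
  finally show ?thesis .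
qed

lemma free_omega_alg: "omega_algebra (A0 :: ('k::field_char_0, ('z, 'o, 'k, 'x) cell, 'o) omega_alg) \<Omega>"
proof -
  define sc :: "'k \<Rightarrow> (('z, 'o) omon \<Rightarrow>\<^sub>0 'k) \<Rightarrow> (('z, 'o) omon \<Rightarrow>\<^sub>0 'k)"
    where "sc c p = Poly_Mapping.single 0 c * p" for c p
  have c: "pol_cell p \<in> carrier A0 \<longleftrightarrow> Poly_Mapping.keys p \<subseteq> free_omon Z \<Omega>" for p :: "('z, 'o) omon \<Rightarrow>\<^sub>0 'k"
    by (auto simp: A0_carrier pol_cell_eq_iff)
  have k: "Poly_Mapping.keys (sc c p) \<subseteq> free_omon Z \<Omega>"
    if "Poly_Mapping.keys p \<subseteq> free_omon Z \<Omega>" for c :: 'k and p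
    unfolding sc_def using that by (intro keys_mult_free) (simp_all add: free_omon_zero)
  have ka: "Poly_Mapping.keys (p + q) \<subseteq> free_omon Z \<Omega>"
    if "Poly_Mapping.keys p \<subseteq> free_omon Z \<Omega>" "Poly_Mapping.keys q \<subseteq> free_omon Z \<Omega>"
    for p q :: "('z, 'o) omon \<Rightarrow>\<^sub>0 'k"
    using keys_add[of p q] that by blast
  have b: "lin_bracket \<tau> (sc c p) = sc c (lin_bracket \<tau> p)" for \<tau> c p
    using lin_bracket_scale[of \<tau> c p] by (simp add: mult_map_scale_conv_mult sc_def)
  have s: "sc (- 1) p = - p" "sc 1 p = p" for p
    by (simp_all add: single_uminus sc_def)
  have mc: "p * sc c q = sc c (p * q)" "sc c p * q = sc c (p * q)" for p q c
    unfolding sc_def by (metis mult.assoc single_zero_commute)+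
  have m: "sc (c * d) p = sc c (sc d p)" for c d p
    by (simp add: sc_def mult_single flip: mult.assoc)
  have d: "sc (c + d) p = sc c p + sc d p" "sc c (p + q) = sc c p + sc c q" for c d p q
    by (simp_all add: sc_def single_add algebra_simps)
  have o: "c \<odot>\<^bsub>A0\<^esub> pol_cell p = pol_cell (sc c p)" for c p
    by (simp add: A0_ops sc_def)
  show ?thesis
    by (rule omega_algebraI; (elim A0_cellE)?)
      (simp_all add: A0_ops(1,2,4-6) o c pol_cell_eq_iff k b s ka m mc d keys_mult_free keys_bracket_free
        lin_bracket_add algebra_simps free_omon_zero)
qed

end

section \<open>The free higher algebra of a polygraph\<close>

text \<open>Every axiom concerns boundedly many dimensions, so it can be checked in a finite stage.\<close>

lemma higher_algebra_limit:
  assumes F: "\<And>n. higher_algebra \<Omega> (enat n) (F n)"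
    and lev: "\<And>m n. m \<le> n \<Longrightarrow> level A m = level (F n) m"
    and cmp: "\<And>m n. m \<le> n \<Longrightarrow> cmp A m = cmp (F n) m"
    and src: "\<And>m n. m < n \<Longrightarrow> src A m = src (F n) m"
    and tgt: "\<And>m n. m < n \<Longrightarrow> tgt A m = tgt (F n) m"
    and idt: "\<And>m n. m < n \<Longrightarrow> idt A m = idt (F n) m"
  shows "higher_algebra \<Omega> \<infinity> A"
proof -
  have ks: "m \<le> n \<Longrightarrow> ksrc A k m = ksrc (F n) k m" for k m n
    by (induction m) (simp_all add: src[of _ n] Suc_le_eq fun_eq_iff)
  have kt: "m \<le> n \<Longrightarrow> ktgt A k m = ktgt (F n) k m" for k m n
    by (induction m) (simp_all add: tgt[of _ n] Suc_le_eq fun_eq_iff)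
  have li: "m \<le> n \<Longrightarrow> lift A k m = lift (F n) k m" for k m n
    by (induction m) (simp_all add: idt[of _ n] Suc_le_eq fun_eq_iff)
  have co: "m \<le> n \<Longrightarrow> composable A m = composable (F n) m" for m n
    unfolding composable_def by (simp add: lev[of m n] ks kt fun_eq_iff)
  show ?thesis
  proof (rule higher_algebra.intro)
    fix m :: nat
    note agree = lev[of _ "Suc (Suc m)"] cmp[of _ "Suc (Suc m)"] src[of _ "Suc (Suc m)"]
      tgt[of _ "Suc (Suc m)"] idt[of _ "Suc (Suc m)"] ks[of _ "Suc (Suc m)"] kt[of _ "Suc (Suc m)"]
      li[of _ "Suc (Suc m)"] co[of _ "Suc (Suc m)"]
    note [simp del] = ksrc.simps ktgt.simps lift.simps
    interpret Fn: higher_algebra \<Omega> "enat (Suc (Suc m))" "F (Suc (Suc m))" by (rule F)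
    show "omega_algebra (level A m) \<Omega>" using Fn.level_alg[of m] by (simp add: agree)
    show "omega_hom \<Omega> (level A (Suc m)) (level A m) (src A m)" using Fn.src_hom[of m] by (simp add: agree)
    show "omega_hom \<Omega> (level A (Suc m)) (level A m) (tgt A m)" using Fn.tgt_hom[of m] by (simp add: agree)
    show "omega_hom \<Omega> (level A m) (level A (Suc m)) (idt A m)" using Fn.idt_hom[of m] by (simp add: agree)
    { fix a
      show "src A m (src A (Suc m) a) = src A m (tgt A (Suc m) a)"
        "tgt A m (src A (Suc m) a) = tgt A m (tgt A (Suc m) a)" if "a \<in> cells A (Suc (Suc m))"
        using that Fn.glob_src[of m a] Fn.glob_tgt[of m a] by (simp_all add: agree)
      show "src A m (idt A m a) = a" "tgt A m (idt A m a) = a" if "a \<in> cells A m"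
        using that Fn.src_idt[of m a] Fn.tgt_idt[of m a] by (simp_all add: agree)
      fix k
      show "cmp A m k (lift A k m (ksrc A k m a)) a = a" "cmp A m k a (lift A k m (ktgt A k m a)) = a"
        if "k < m" "a \<in> cells A m"
        using that Fn.unit_left[of m k a] Fn.unit_right[of m k a] by (simp_all add: agree)
    }
    { fix a b k
      show "src A m (cmp A (Suc m) m a b) = src A m a" "tgt A m (cmp A (Suc m) m a b) = tgt A m b"
        if "composable A (Suc m) m a b"
        using that Fn.src_cmp_top[of m a b] Fn.tgt_cmp_top[of m a b] by (simp_all add: agree)
      show "src A m (cmp A (Suc m) k a b) = cmp A m k (src A m a) (src A m b)"
        "tgt A m (cmp A (Suc m) k a b) = cmp A m k (tgt A m a) (tgt A m b)"
        if "composable A (Suc m) k a b" "k < m"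
        using that Fn.src_cmp[of m k a b] Fn.tgt_cmp[of m k a b] by (simp_all add: agree)
      assume ab: "composable A m k a b"
      then show "cmp A m k a b \<in> cells A m"
        "cmp A (Suc m) k (idt A m a) (idt A m b) = idt A m (cmp A m k a b)"
        "cmp A m k (c \<odot>\<^bsub>level A m\<^esub> a) (c \<odot>\<^bsub>level A m\<^esub> b) = c \<odot>\<^bsub>level A m\<^esub> cmp A m k a b" for c
        using Fn.cmp_closed[of m k a b] Fn.cmp_idt[of m k a b] Fn.cmp_smult[of m k a b c]
        by (simp_all add: agree)
      show "cmp A m k (oper (level A m) \<tau> a) (oper (level A m) \<tau> b) = oper (level A m) \<tau> (cmp A m k a b)"
        if "\<tau> \<in> \<Omega>" for \<tau>
        using that ab Fn.cmp_oper[of m k a b \<tau>] by (simp add: agree)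
      show "cmp A m k (cmp A m k a b) b' = cmp A m k a (cmp A m k b b')" if "composable A m k b b'" for b'
        using that ab Fn.cmp_assoc[of m k a b b'] by (simp add: agree)
      fix a' b' assume "composable A m k a' b'"
      with ab show "cmp A m k (a \<oplus>\<^bsub>level A m\<^esub> a') (b \<oplus>\<^bsub>level A m\<^esub> b') =
            cmp A m k a b \<oplus>\<^bsub>level A m\<^esub> cmp A m k a' b'"
        "cmp A m k (a \<otimes>\<^bsub>level A m\<^esub> a') (b \<otimes>\<^bsub>level A m\<^esub> b') =
            cmp A m k a b \<otimes>\<^bsub>level A m\<^esub> cmp A m k a' b'"
        using Fn.cmp_add[of m k a b a' b'] Fn.cmp_mult[of m k a b a' b'] by (simp_all add: agree)
      fix l assume "l < k" "composable A m l a a'" "composable A m l b b'"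
      with ab \<open>composable A m k a' b'\<close>
      show "cmp A m l (cmp A m k a b) (cmp A m k a' b') = cmp A m k (cmp A m l a a') (cmp A m l b b')"
        using Fn.cmp_exchange[of m l k a b a' b'] by (simp add: agree)
    }
  qed
qed

lemma discrete_higher_algebra:
  assumes "omega_algebra B \<Omega>"
  shows "higher_algebra \<Omega> 0 (discrete B)"
  using assms
  by (intro higher_algebra.intro)
    (simp_all add: discrete_def composable_def zero_enat_def omega_algebra_def)

lemma free_n_alg_stable:
  assumes "m \<le> n"
  shows "level (free_n_alg \<Omega> P n) m = level (free_n_alg \<Omega> P m) m"
    and "cmp (free_n_alg \<Omega> P n) m = cmp (free_n_alg \<Omega> P m) m"
  using assms by (induction n rule: dec_induct) (simp_all add: adjoin_def)

lemma free_n_alg_stable_maps: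
  assumes "m < n"
  shows "src (free_n_alg \<Omega> P n) m = src (free_n_alg \<Omega> P (Suc m)) m"
    and "tgt (free_n_alg \<Omega> P n) m = tgt (free_n_alg \<Omega> P (Suc m)) m"
    and "idt (free_n_alg \<Omega> P n) m = idt (free_n_alg \<Omega> P (Suc m)) m"
  using Suc_leI[OF assms] by (induction n rule: dec_induct) (simp_all add: adjoin_def)

locale polygraph =
  fixes \<Omega> :: "'o set" and X :: "('z, 'o, 'k::field_char_0, 'x) polygraph"
  assumes omega_polygraph: "omega_polygraph \<Omega> X"
begin

abbreviation F where "F \<equiv> free_n_alg \<Omega> X"
abbreviation A where "A \<equiv> free_\<omega>_alg \<Omega> X"
abbreviation L where "L \<equiv> level A"
abbreviation s0 where "s0 \<equiv> ksrc A 0"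
abbreviation t0 where "t0 \<equiv> ktgt A 0"
abbreviation up where "up \<equiv> lift A 0"
abbreviation M where "M \<equiv> free_omon (gens0 X) \<Omega>"

lemma cellular_F: "cellular_extension n (F n) (gens X (Suc n)) (gsrc X (Suc n)) (gtgt X (Suc n))"
  using omega_polygraph by (simp add: omega_polygraph_def)

lemma free_extension_F:
  "free_extension \<Omega> n (F n) (gens X (Suc n)) (gsrc X (Suc n)) (gtgt X (Suc n))"
proof (induction n)
  case 0
  show ?case
  proof (intro free_extension.intro free_extension_axioms.intro cellular_F)
    show "higher_algebra \<Omega> (enat 0) (F 0)"
      using discrete_higher_algebra[OF free_omega_alg] by (simp add: zero_enat_def)
  qed (auto simp: discrete_def A0_carrier pol_cell_def)
next
  case (Suc n)
  interpret free_extension \<Omega> n "F n" "gens X (Suc n)" "gsrc X (Suc n)" "gtgt X (Suc n)" by (rule Suc)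
  show ?case
  proof (intro free_extension.intro free_extension_axioms.intro cellular_F)
    show "higher_algebra \<Omega> (enat (Suc n)) (F (Suc n))"
      using adjoin_higher_algebra by simp
  qed (use new_cell_nonempty new_cell_disjoint in auto)
qed

lemma higher_algebra_F: "higher_algebra \<Omega> (enat n) (F n)"
  by (rule free_extension.axioms(1)[OF free_extension_F])

lemma level_F: "m \<le> n \<Longrightarrow> level A m = level (F n) m"
  and cmp_F: "m \<le> n \<Longrightarrow> cmp A m = cmp (F n) m"
  and src_F: "m < n \<Longrightarrow> src A m = src (F n) m"
  and tgt_F: "m < n \<Longrightarrow> tgt A m = tgt (F n) m"
  and idt_F: "m < n \<Longrightarrow> idt A m = idt (F n) m"
  using free_n_alg_stable[of m n \<Omega> X] free_n_alg_stable_maps[of m n \<Omega> X]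
  by (simp_all add: free_\<omega>_alg_def del: free_n_alg.simps)

text \<open>All dimensions are allowed here, and the rewriting removes the bounds from the inherited
  facts.\<close>

sublocale higher_algebra \<Omega> \<infinity> A
  rewrites "\<And>m. (m \<le> (\<infinity> :: enat)) \<equiv> True"
    and "\<And>P. (True \<Longrightarrow> P) \<equiv> Trueprop P"
    and "\<And>P Q. (True \<Longrightarrow> PROP P \<Longrightarrow> PROP Q) \<equiv> (PROP P \<Longrightarrow> True \<Longrightarrow> PROP Q)"
  by (rule higher_algebra_limit[of \<Omega> F])
    (simp_all add: higher_algebra_F level_F cmp_F src_F tgt_F idt_F)

lemma level_0: "level A 0 = free_omega_alg (gens0 X) \<Omega>"
  by (simp add: free_\<omega>_alg_def discrete_def)

end

subsection \<open>Zero-cells\<close>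

context
  fixes Z :: "'z set" and \<Omega> :: "'o set"
begin

lemma mon_cell_carrier: "(mon_cell u :: ('z, 'o, 'k::field_char_0, 'x) cell) \<in> carrier (A0 Z \<Omega>) \<longleftrightarrow> u \<in> free_omon Z \<Omega>"
  by (auto simp: mon_cell_def A0_carrier pol_cell_eq_iff)

lemma mon_cell_mult: "mon_cell u \<otimes>\<^bsub>A0 Z \<Omega>\<^esub> mon_cell v = (mon_cell (u + v) :: ('z, 'o, 'k::field_char_0, 'x) cell)"
  by (simp add: mon_cell_def A0_ops mult_single)

lemma mon_cell_oper: "oper (A0 Z \<Omega>) \<tau> (mon_cell u) = (mon_cell (bracket \<tau> u) :: ('z, 'o, 'k::field_char_0, 'x) cell)"
  by (simp add: mon_cell_def A0_ops lin_bracket_single)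

lemma mon_cell_zero: "(mon_cell 0 :: ('z, 'o, 'k::field_char_0, 'x) cell) = \<one>\<^bsub>A0 Z \<Omega>\<^esub>"
  by (simp add: mon_cell_def A0_ops)

lemma zero_cell_induct [consumes 1, case_names mon add smult]:
  fixes P :: "('z, 'o, 'k::field_char_0, 'x) cell \<Rightarrow> bool"
  assumes c: "c \<in> carrier (A0 Z \<Omega>)"
    and mon: "\<And>u. u \<in> free_omon Z \<Omega> \<Longrightarrow> P (mon_cell u)"
    and add: "\<And>a b. a \<in> carrier (A0 Z \<Omega>) \<Longrightarrow> b \<in> carrier (A0 Z \<Omega>) \<Longrightarrow> P a \<Longrightarrow> P b \<Longrightarrow> P (a \<oplus>\<^bsub>A0 Z \<Omega>\<^esub> b)"
    and smult: "\<And>r a. a \<in> carrier (A0 Z \<Omega>) \<Longrightarrow> P a \<Longrightarrow> P (r \<odot>\<^bsub>A0 Z \<Omega>\<^esub> a)"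
  shows "P c"
proof -
  interpret R: omega_algebra "A0 Z \<Omega> :: ('k, ('z, 'o, 'k, 'x) cell, 'o) omega_alg" \<Omega>
    by (rule free_omega_alg)
  define pc :: "(('z, 'o) omon \<Rightarrow>\<^sub>0 'k) \<Rightarrow> ('z, 'o, 'k, 'x) cell" where "pc = pol_cell"
  obtain p where p: "c = pc p" "Poly_Mapping.keys p \<subseteq> free_omon Z \<Omega>"
    using c unfolding pc_def by (rule A0_cellE)
  have sm: "P (pc (Poly_Mapping.single u r)) \<and> pc (Poly_Mapping.single u r) \<in> carrier (A0 Z \<Omega>)"
    if "u \<in> free_omon Z \<Omega>" for u r
  proof -
    have "(mon_cell u :: ('z, 'o, 'k, 'x) cell) \<in> carrier (A0 Z \<Omega>)"
      using that by (simp add: mon_cell_carrier)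
    from smult[OF this mon[OF that], of r] R.smult_closed[OF this, of r]
    show ?thesis by (simp add: mon_cell_def A0_ops mult_single pc_def)
  qed
  have "P (pc (\<Sum>u\<in>K. Poly_Mapping.single u (f u))) \<and>
      pc (\<Sum>u\<in>K. Poly_Mapping.single u (f u)) \<in> carrier (A0 Z \<Omega>)"
    if "finite K" "K \<subseteq> free_omon Z \<Omega>" for K f
    using that
  proof (induction K)
    case empty
    show ?case using sm[OF free_omon_zero, of 0] by simp
  next
    case (insert u K)
    have "pc (Poly_Mapping.single u (f u) + (\<Sum>u\<in>K. Poly_Mapping.single u (f u))) =
      pc (Poly_Mapping.single u (f u)) \<oplus>\<^bsub>A0 Z \<Omega>\<^esub> pc (\<Sum>u\<in>K. Poly_Mapping.single u (f u))"
      by (simp add: A0_ops pc_def)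
    then show ?case using insert sm[of u "f u"] add by simp
  qed
  from this[OF _ p(2), of "Poly_Mapping.lookup p"] show ?thesis
    using poly_mapping_sum_single[of p] p(1) by simp
qed

text \<open>The monomials form a basis of the algebra of \<open>0\<close>-cells.\<close>

lemma linear_extension:
  fixes B :: "('k::field_char_0, 'b, 'o) omega_alg"
  assumes B: "omega_algebra B \<Omega>" and e: "\<And>u. u \<in> free_omon Z \<Omega> \<Longrightarrow> e u \<in> carrier B"
  obtains f :: "('z, 'o, 'k, 'x) cell \<Rightarrow> 'b"
  where "linear_map (A0 Z \<Omega>) B f" "\<And>u. u \<in> free_omon Z \<Omega> \<Longrightarrow> f (mon_cell u) = e u"
proof -
  interpret B: omega_algebra B \<Omega> by (rule B)
  define g where "g S p = (\<Oplus>\<^bsub>B\<^esub>u\<in>S. Poly_Mapping.lookup p u \<odot>\<^bsub>B\<^esub> e u)" for S and p :: "('z, 'o) omon \<Rightarrow>\<^sub>0 'k"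
  have c: "(\<lambda>u. Poly_Mapping.lookup r u \<odot>\<^bsub>B\<^esub> e u) \<in> S \<rightarrow> carrier B" if "S \<subseteq> free_omon Z \<Omega>"
    for r :: "('z, 'o) omon \<Rightarrow>\<^sub>0 'k" and S
    by (auto intro!: B.smult_closed e dest: subsetD[OF that])
  have g: "g S p = g (Poly_Mapping.keys p) p"
    if "finite S" "Poly_Mapping.keys p \<subseteq> S" "S \<subseteq> free_omon Z \<Omega>" for S p
    unfolding g_def
  proof (rule B.add.finprod_mono_neutral_cong_right)
    fix u assume "u \<in> S - Poly_Mapping.keys p"
    then show "Poly_Mapping.lookup p u \<odot>\<^bsub>B\<^esub> e u = \<zero>\<^bsub>B\<^esub>"
      using e that by (auto simp: in_keys_iff B.smult_zero_left)
  qed (use that in \<open>auto intro!: B.smult_closed e dest: subsetD[OF that(3)]\<close>)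
  define pol :: "('z, 'o, 'k, 'x) cell \<Rightarrow> _" where "pol a = (THE p. a = pol_cell p)" for a
  have pol: "pol (pol_cell p) = p" for p by (simp add: pol_def pol_cell_eq_iff)
  define f :: "('z, 'o, 'k, 'x) cell \<Rightarrow> 'b" where "f a = g (Poly_Mapping.keys (pol a)) (pol a)" for a
  have "linear_map (A0 Z \<Omega>) B f"
    unfolding linear_map_def
  proof (intro conjI ballI allI; elim A0_cellE; hypsubst)
    fix p :: "('z, 'o) omon \<Rightarrow>\<^sub>0 'k" assume p: "Poly_Mapping.keys p \<subseteq> free_omon Z \<Omega>"
    show "f (pol_cell p) \<in> carrier B"
      unfolding f_def g_def pol using p e by (intro B.finsum_closed) (auto simp: B.smult_closed)
    fix r
    have k: "Poly_Mapping.keys (Poly_Mapping.single 0 r * p) \<subseteq> Poly_Mapping.keys p"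
      using keys_mult[of "Poly_Mapping.single 0 r" p] by (auto split: if_splits)
    have l: "Poly_Mapping.lookup (Poly_Mapping.single 0 r * p) u = r * Poly_Mapping.lookup p u" for u
      by (simp add: mult_map_scale_conv_mult[symmetric] map.rep_eq when_def)
    have "g S (Poly_Mapping.single 0 r * p) = r \<odot>\<^bsub>B\<^esub> g S p" if "finite S" "S \<subseteq> free_omon Z \<Omega>" for S
      using that
    proof (induction S)
      case empty
      show ?case by (simp add: g_def B.smult_zero_right)
    next
      case (insert u S)
      have "g (insert u S) p = Poly_Mapping.lookup p u \<odot>\<^bsub>B\<^esub> e u \<oplus>\<^bsub>B\<^esub> g S p" "g S p \<in> carrier B" for p
        unfolding g_def using insert c[of S p] by (simp_all add: B.finsum_insert B.smult_closed e B.finsum_closed)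
      then show ?case using insert e by (simp add: l B.smult_r_distr B.smult_closed B.smult_assoc)
    qed
    from this[OF _ p] show "f (r \<odot>\<^bsub>A0 Z \<Omega>\<^esub> pol_cell p) = r \<odot>\<^bsub>B\<^esub> f (pol_cell p)"
      using g[OF _ k p] by (simp add: f_def A0_ops pol)
  next
    fix p q :: "('z, 'o) omon \<Rightarrow>\<^sub>0 'k"
    assume p: "Poly_Mapping.keys p \<subseteq> free_omon Z \<Omega>" and q: "Poly_Mapping.keys q \<subseteq> free_omon Z \<Omega>"
    define S where "S = Poly_Mapping.keys p \<union> Poly_Mapping.keys q"
    have S: "finite S" "S \<subseteq> free_omon Z \<Omega>" using p q by (auto simp: S_def)
    have "g S (p + q) = (\<Oplus>\<^bsub>B\<^esub>u\<in>S. Poly_Mapping.lookup p u \<odot>\<^bsub>B\<^esub> e u \<oplus>\<^bsub>B\<^esub> Poly_Mapping.lookup q u \<odot>\<^bsub>B\<^esub> e u)"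
      unfolding g_def
      by (intro B.finsum_cong')
        (auto simp: lookup_add B.smult_l_distr e dest: subsetD[OF S(2)] intro!: B.smult_closed e B.a_closed)
    also have "\<dots> = g S p \<oplus>\<^bsub>B\<^esub> g S q"
      unfolding g_def by (rule B.finsum_addf[OF c[OF S(2)] c[OF S(2)]])
    finally have "g S (p + q) = g S p \<oplus>\<^bsub>B\<^esub> g S q" .
    moreover have "Poly_Mapping.keys (p + q) \<subseteq> S" unfolding S_def by (rule keys_add)
    ultimately show "f (pol_cell p \<oplus>\<^bsub>A0 Z \<Omega>\<^esub> pol_cell q) = f (pol_cell p) \<oplus>\<^bsub>B\<^esub> f (pol_cell q)"
      using g[OF S(1) _ S(2), of p] g[OF S(1) _ S(2), of q] g[OF S(1) _ S(2), of "p + q"]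
      by (simp add: f_def A0_ops pol S_def)
  qed
  moreover have "f (mon_cell u) = e u" if "u \<in> free_omon Z \<Omega>" for u
    using that e by (simp add: f_def mon_cell_def pol g_def B.smult_one)
  ultimately show thesis by (rule that)
qed

end

context polygraph
begin

abbreviation I where "I \<equiv> rel_ideal \<Omega> X"

sublocale L0: omega_algebra "L 0" \<Omega>
  by (rule level_alg)

lemma mon_cell_0: "mon_cell u \<in> cells A 0 \<longleftrightarrow> u \<in> M"
  by (simp add: level_0 mon_cell_carrier)

lemma gen_boundary: "y \<in> gens X (Suc n) \<Longrightarrow> gsrc X (Suc n) y \<in> cells A n"
  "y \<in> gens X (Suc n) \<Longrightarrow> gtgt X (Suc n) y \<in> cells A n"
  using cellular_F[of n] by (auto simp: cellular_extension_def level_F[of n n])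

definition gen_cell :: "nat \<Rightarrow> 'x \<Rightarrow> ('z, 'o, 'k, 'x) cell" where
  "gen_cell n y = tm_class \<Omega> n (F n) (gens X (Suc n)) (gsrc X (Suc n)) (gtgt X (Suc n)) (Gen y)"

lemma gen_cell:
  assumes "y \<in> gens X (Suc n)"
  shows "gen_cell n y \<in> cells A (Suc n)" "src A n (gen_cell n y) = gsrc X (Suc n) y"
    "tgt A n (gen_cell n y) = gtgt X (Suc n) y"
proof -
  interpret E: free_extension \<Omega> n "F n" "gens X (Suc n)" "gsrc X (Suc n)" "gtgt X (Suc n)"
    by (rule free_extension_F)
  have ok: "E.ok (Gen y)" using assms by simp
  show "gen_cell n y \<in> cells A (Suc n)"
    using E.cls_cell[OF ok] by (simp add: gen_cell_def level_F[of "Suc n" "Suc n"])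
  show "src A n (gen_cell n y) = gsrc X (Suc n) y" "tgt A n (gen_cell n y) = gtgt X (Suc n) y"
    using E.new_src[OF ok] E.new_tgt[OF ok]
    by (simp_all add: gen_cell_def src_F[of n "Suc n"] tgt_F[of n "Suc n"])
qed

text \<open>Induction on a term representing the cell.\<close>

lemma cell_induct [consumes 1, case_names idt gen add smult mult oper cmp]:
  assumes a: "a \<in> cells A (Suc n)"
    and idt: "\<And>c. c \<in> cells A n \<Longrightarrow> P (idt A n c)"
    and gen: "\<And>y. y \<in> gens X (Suc n) \<Longrightarrow> P (gen_cell n y)"
    and add: "\<And>f g. f \<in> cells A (Suc n) \<Longrightarrow> g \<in> cells A (Suc n) \<Longrightarrow> P f \<Longrightarrow> P g \<Longrightarrow>
      P (f \<oplus>\<^bsub>L (Suc n)\<^esub> g)"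
    and smult: "\<And>c f. f \<in> cells A (Suc n) \<Longrightarrow> P f \<Longrightarrow> P (c \<odot>\<^bsub>L (Suc n)\<^esub> f)"
    and mult: "\<And>f g. f \<in> cells A (Suc n) \<Longrightarrow> g \<in> cells A (Suc n) \<Longrightarrow> P f \<Longrightarrow> P g \<Longrightarrow>
      P (f \<otimes>\<^bsub>L (Suc n)\<^esub> g)"
    and oper: "\<And>\<tau> f. \<tau> \<in> \<Omega> \<Longrightarrow> f \<in> cells A (Suc n) \<Longrightarrow> P f \<Longrightarrow> P (oper (L (Suc n)) \<tau> f)"
    and cmp: "\<And>k f g. composable A (Suc n) k f g \<Longrightarrow> P f \<Longrightarrow> P g \<Longrightarrow> P (cmp A (Suc n) k f g)"
  shows "P a"
proof -
  interpret E: free_extension \<Omega> n "F n" "gens X (Suc n)" "gsrc X (Suc n)" "gtgt X (Suc n)"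
    by (rule free_extension_F)
  have [simp]: "L (Suc n) = level E.A' (Suc n)" "cmp A (Suc n) = cmp E.A' (Suc n)"
    using level_F[of "Suc n" "Suc n"] cmp_F[of "Suc n" "Suc n"] by simp_all
  have co: "composable A (Suc n) k f g \<longleftrightarrow> composable E.A' (Suc n) k f g" for k f g
  proof -
    have "ksrc A k (Suc n) = ksrc E.A' k (Suc n)" "ktgt A k (Suc n) = ktgt E.A' k (Suc n)"
    proof -
      have "m \<le> Suc n \<Longrightarrow> ksrc A k m = ksrc (F (Suc n)) k m" for m
        by (induction m) (simp_all add: src_F[of _ "Suc n"] Suc_le_eq fun_eq_iff del: free_n_alg.simps)
      moreover have "m \<le> Suc n \<Longrightarrow> ktgt A k m = ktgt (F (Suc n)) k m" for m
        by (induction m) (simp_all add: tgt_F[of _ "Suc n"] Suc_le_eq fun_eq_iff del: free_n_alg.simps)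
      ultimately show "ksrc A k (Suc n) = ksrc E.A' k (Suc n)" "ktgt A k (Suc n) = ktgt E.A' k (Suc n)"
        by (metis free_n_alg.simps(2) order_refl)+
    qed
    then show ?thesis unfolding composable_def by simp
  qed
  have "E.ok f \<Longrightarrow> P (E.cls f)" for f
  proof (induction f)
    case (Idt u)
    then obtain c where "c \<in> cells (F n) n" "u \<in> c" by auto
    then show ?case
      using idt[of c] E.new_idt[of c u] by (simp add: level_F[of n n] idt_F[of n "Suc n"])
  next
    case (Gen y)
    then show ?case using gen[of y] by (simp add: gen_cell_def)
  next
    case (Add f g)
    then show ?case using add[of "E.cls f" "E.cls g"] by (simp add: E.new_add E.cls_cell)
  next
    case (Scl c f)
    then show ?case using smult[of "E.cls f" c] by (simp add: E.new_smult E.cls_cell)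
  next
    case (Mul f g)
    then show ?case using mult[of "E.cls f" "E.cls g"] by (simp add: E.new_mult E.cls_cell)
  next
    case (Opr \<tau> f)
    then show ?case using oper[of \<tau> "E.cls f"] by (simp add: E.new_oper E.cls_cell)
  next
    case (Cmp k f g)
    then have fg: "E.ok f" "E.ok g" by auto
    from Cmp cmp[of k "E.cls f" "E.cls g"] show ?case
      unfolding co E.composable_new[OF fg] using E.new_cmp[OF Cmp.prems] fg by simp
  qed simp
  moreover obtain f where "E.ok f" "a = E.cls f" using a by (auto elim: E.new_cellE)
  ultimately show ?thesis by simp
qed

subsection \<open>The ideal of relations\<close>

lemma rel_ideal: "ideal I (L 0)"
  and smult_I: "i \<in> I \<Longrightarrow> c \<odot>\<^bsub>L 0\<^esub> i \<in> I"
  and oper_I: "i \<in> I \<Longrightarrow> \<tau> \<in> \<Omega> \<Longrightarrow> oper (L 0) \<tau> i \<in> I"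
  and gens_I: "y \<in> gens X 1 \<Longrightarrow> gsrc X 1 y \<ominus>\<^bsub>L 0\<^esub> gtgt X 1 y \<in> I"
  and rel_ideal_least: "omega_ideal \<Omega> (L 0) J \<Longrightarrow>
    (\<And>y. y \<in> gens X 1 \<Longrightarrow> gsrc X 1 y \<ominus>\<^bsub>L 0\<^esub> gtgt X 1 y \<in> J) \<Longrightarrow> I \<subseteq> J"
proof -
  let ?S = "{gsrc X 1 y \<ominus>\<^bsub>L 0\<^esub> gtgt X 1 y | y. y \<in> gens X 1}"
  let ?C = "{J. omega_ideal \<Omega> (L 0) J \<and> ?S \<subseteq> J}"
  have I: "I = \<Inter>?C"
    by (simp add: rel_ideal_def gen_omega_ideal_def level_0 Let_def)
  have S: "?S \<subseteq> cells A 0" using gen_boundary[of _ 0] by (auto simp: One_nat_def)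
  have C: "cells A 0 \<in> ?C"
    using S L0.oneideal by (auto simp: omega_ideal_def L0.smult_closed L0.oper_closed)
  show "ideal I (L 0)" unfolding I
    by (rule L0.i_Intersect) (use C in \<open>auto simp: omega_ideal_def\<close>)
  show "i \<in> I \<Longrightarrow> c \<odot>\<^bsub>L 0\<^esub> i \<in> I" "i \<in> I \<Longrightarrow> \<tau> \<in> \<Omega> \<Longrightarrow> oper (L 0) \<tau> i \<in> I"
    unfolding I by (auto simp: omega_ideal_def)
  show "y \<in> gens X 1 \<Longrightarrow> gsrc X 1 y \<ominus>\<^bsub>L 0\<^esub> gtgt X 1 y \<in> I" unfolding I by auto
  show "omega_ideal \<Omega> (L 0) J \<Longrightarrow>
    (\<And>y. y \<in> gens X 1 \<Longrightarrow> gsrc X 1 y \<ominus>\<^bsub>L 0\<^esub> gtgt X 1 y \<in> J) \<Longrightarrow> I \<subseteq> J"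
    unfolding I by blast
qed

sublocale I: ideal I "L 0"
  by (rule rel_ideal)

lemma diff_mult_I:
  assumes "a \<in> cells A 0" "b \<in> cells A 0" "a' \<in> cells A 0" "b' \<in> cells A 0"
    and i: "a \<ominus>\<^bsub>L 0\<^esub> a' \<in> I" and j: "b \<ominus>\<^bsub>L 0\<^esub> b' \<in> I"
  shows "a \<otimes>\<^bsub>L 0\<^esub> b \<ominus>\<^bsub>L 0\<^esub> a' \<otimes>\<^bsub>L 0\<^esub> b' \<in> I"
proof -
  have "a \<otimes>\<^bsub>L 0\<^esub> b \<ominus>\<^bsub>L 0\<^esub> a' \<otimes>\<^bsub>L 0\<^esub> b' =
      (a \<ominus>\<^bsub>L 0\<^esub> a') \<otimes>\<^bsub>L 0\<^esub> b \<oplus>\<^bsub>L 0\<^esub> a' \<otimes>\<^bsub>L 0\<^esub> (b \<ominus>\<^bsub>L 0\<^esub> b')"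
    using assms(1-4) by algebra
  then show ?thesis using assms by (simp add: I.a_closed I.I_l_closed I.I_r_closed)
qed

lemma diff_add_I:
  assumes "a \<in> cells A 0" "b \<in> cells A 0" "a' \<in> cells A 0" "b' \<in> cells A 0"
    and i: "a \<ominus>\<^bsub>L 0\<^esub> a' \<in> I" and j: "b \<ominus>\<^bsub>L 0\<^esub> b' \<in> I"
  shows "(a \<oplus>\<^bsub>L 0\<^esub> b) \<ominus>\<^bsub>L 0\<^esub> (a' \<oplus>\<^bsub>L 0\<^esub> b') \<in> I"
proof -
  have "(a \<oplus>\<^bsub>L 0\<^esub> b) \<ominus>\<^bsub>L 0\<^esub> (a' \<oplus>\<^bsub>L 0\<^esub> b') =
      (a \<ominus>\<^bsub>L 0\<^esub> a') \<oplus>\<^bsub>L 0\<^esub> (b \<ominus>\<^bsub>L 0\<^esub> b')"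
    using assms(1-4) by algebra
  then show ?thesis using assms by (simp add: I.a_closed)
qed

lemma diff_trans_I:
  assumes "a \<in> cells A 0" "b \<in> cells A 0" "c \<in> cells A 0"
    and i: "a \<ominus>\<^bsub>L 0\<^esub> b \<in> I" and j: "b \<ominus>\<^bsub>L 0\<^esub> c \<in> I"
  shows "a \<ominus>\<^bsub>L 0\<^esub> c \<in> I"
proof -
  have "a \<ominus>\<^bsub>L 0\<^esub> c = (a \<ominus>\<^bsub>L 0\<^esub> b) \<oplus>\<^bsub>L 0\<^esub> (b \<ominus>\<^bsub>L 0\<^esub> c)"
    using assms(1-3) by algebra
  then show ?thesis using assms by (simp add: I.a_closed)
qed

text \<open>The property holds for generating cells and identities, and is preserved by all operations,
  composition being transitivity of congruence modulo the ideal.\<close>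

lemma boundary_diff_I: "f \<in> cells A 1 \<Longrightarrow> src A 0 f \<ominus>\<^bsub>L 0\<^esub> tgt A 0 f \<in> I"
  unfolding One_nat_def
proof (induction rule: cell_induct)
  case (idt c)
  then show ?case by (simp add: src_idt tgt_idt a_minus_def L0.r_neg I.zero_closed)
next
  case (gen y)
  then show ?case using gens_I[of y] by (simp add: gen_cell)
next
  case (add f g)
  then show ?case
    using omega_homD(3,4)[OF src_hom[of 0]] omega_homD(3,4)[OF tgt_hom[of 0]] by (simp add: diff_add_I)
next
  case (smult c f)
  then show ?case
    using omega_homD(3,5)[OF src_hom[of 0]] omega_homD(3,5)[OF tgt_hom[of 0]]
      smult_I[of "src A 0 f \<ominus>\<^bsub>L 0\<^esub> tgt A 0 f" c]
    by (simp add: L0.smult_diff)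
next
  case (mult f g)
  then show ?case
    using omega_homD(3,6)[OF src_hom[of 0]] omega_homD(3,6)[OF tgt_hom[of 0]] by (simp add: diff_mult_I)
next
  case (oper \<tau> f)
  then show ?case
    using omega_homD(3,7)[OF src_hom[of 0]] omega_homD(3,7)[OF tgt_hom[of 0]]
      oper_I[of "src A 0 f \<ominus>\<^bsub>L 0\<^esub> tgt A 0 f" \<tau>]
    by (simp add: L0.oper_diff)
next
  case (cmp k f g)
  then have "k = 0" and fg: "f \<in> cells A (Suc 0)" "g \<in> cells A (Suc 0)" "tgt A 0 f = src A 0 g"
    by (auto simp: composable_def)
  with cmp show ?case
    using src_cmp_top[of 0 f g] tgt_cmp_top[of 0 f g]
      omega_homD(3)[OF src_hom[of 0]] omega_homD(3)[OF tgt_hom[of 0]]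
      diff_trans_I[of "src A 0 f" "tgt A 0 f" "tgt A 0 g"] by simp
qed

lemma kboundary_diff_I:
  assumes "f \<in> cells A m"
  shows "s0 m f \<ominus>\<^bsub>L 0\<^esub> t0 m f \<in> I"
proof (cases m)
  case 0
  then show ?thesis using assms by (simp add: a_minus_def L0.r_neg I.zero_closed)
next
  case (Suc m')
  have t: "t0 1 (ksrc A 1 m f) = t0 m f"
    using assms Suc by (intro ktgt_ksrc) auto
  have s: "s0 1 (ksrc A 1 m f) = s0 m f"
    using Suc by (intro ksrc_ksrc) auto
  have "ksrc A 1 m f \<in> cells A 1"
    using omega_homD(3)[OF ksrc_hom[of 1 m] assms] Suc by simp
  from boundary_diff_I[OF this] show ?thesis
    unfolding t[symmetric] s[symmetric] by simp
qed

lemma ksrc_lift_low: "j \<le> k \<Longrightarrow> k \<le> m \<Longrightarrow> a \<in> cells A k \<Longrightarrow> ksrc A j m (lift A k m a) = ksrc A j k a"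
  using ksrc_ksrc[of j k m "lift A k m a"] ksrc_lift[of k m a] by simp

lemma ktgt_lift_low: "j \<le> k \<Longrightarrow> k \<le> m \<Longrightarrow> a \<in> cells A k \<Longrightarrow> ktgt A j m (lift A k m a) = ktgt A j k a"
  using ktgt_ktgt[of j k m "lift A k m a"] ktgt_lift[of k m a] by simp

lemma lift_closed: "k \<le> m \<Longrightarrow> a \<in> cells A k \<Longrightarrow> lift A k m a \<in> cells A m"
  using omega_homD(3)[OF lift_hom] .

lemma ksrc_closed: "k \<le> m \<Longrightarrow> a \<in> cells A m \<Longrightarrow> ksrc A k m a \<in> cells A k"
  using omega_homD(3)[OF ksrc_hom] .

lemma ktgt_closed: "k \<le> m \<Longrightarrow> a \<in> cells A m \<Longrightarrow> ktgt A k m a \<in> cells A k"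
  using omega_homD(3)[OF ktgt_hom] .

lemma ktgt_lift_high: "k \<le> j \<Longrightarrow> j \<le> m \<Longrightarrow> a \<in> cells A k \<Longrightarrow> ktgt A j m (lift A k m a) = lift A k j a"
  using ktgt_lift[of j m "lift A k j a"] by (simp add: lift_lift lift_closed)

end

section \<open>Unital sections\<close>

locale polygraph_section = polygraph \<Omega> X
  for \<Omega> :: "'o set" and X :: "('z, 'o, 'k::field_char_0, 'x) polygraph" +
  fixes \<iota> :: "nat \<Rightarrow> ('z, 'o, 'k, 'x) cell set \<Rightarrow> ('z, 'o, 'k, 'x) cell"
  assumes unital_section: "unital_section \<Omega> X \<iota>"
begin

text \<open>On \<open>n\<close>-cells the map \<open>hat\<close> is determined by its values on
  \<open>0\<close>-cells (\<open>hat_eq\<close>). On these it is a linear idempotent whose kernel is the ideal of relations.\<close>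

abbreviation h where "h \<equiv> hat \<Omega> X \<iota> 0"

lemma proj_eq: "proj \<Omega> X n a = I +>\<^bsub>L 0\<^esub> s0 n a"
  by (simp add: proj_def level_0)

lemma presented_carrier:
  "x \<in> carrier (presented_alg \<Omega> X) \<longleftrightarrow> (\<exists>c\<in>cells A 0. x = I +>\<^bsub>L 0\<^esub> c)"
  by (auto simp: presented_alg_def omega_quot_def FactRing_def A_RCOSETS_def' level_0)

lemma iota_Suc: "x \<in> carrier (presented_alg \<Omega> X) \<Longrightarrow> \<iota> (Suc n) x = idt A n (\<iota> n x)"
  using unital_section by (simp add: unital_section_def globular_linear_map_def discrete_def)

lemma iota_lift: "x \<in> carrier (presented_alg \<Omega> X) \<Longrightarrow> \<iota> n x = up n (\<iota> 0 x)"
  by (induction n) (simp_all add: iota_Suc)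

lemma iota_linear: "linear_map (presented_alg \<Omega> X) (L 0) (\<iota> 0)"
  using unital_section by (simp add: unital_section_def globular_linear_map_def discrete_def)

lemma coset_presented: "c \<in> cells A 0 \<Longrightarrow> I +>\<^bsub>L 0\<^esub> c \<in> carrier (presented_alg \<Omega> X)"
  by (auto simp: presented_carrier)

lemma h_def: "h c = \<iota> 0 (I +>\<^bsub>L 0\<^esub> c)"
  by (simp add: hat_def proj_eq)

lemma coset_eq: "a \<in> cells A 0 \<Longrightarrow> b \<in> cells A 0 \<Longrightarrow>
    a \<ominus>\<^bsub>L 0\<^esub> b \<in> I \<longleftrightarrow> I +>\<^bsub>L 0\<^esub> a = I +>\<^bsub>L 0\<^esub> b"
  by (rule L0.quotient_eq_iff_same_a_r_cos[OF I.ideal_axioms])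

lemma coset_smult:
  assumes "a \<in> cells A 0"
  shows "c \<odot>\<^bsub>presented_alg \<Omega> X\<^esub> (I +>\<^bsub>L 0\<^esub> a) = I +>\<^bsub>L 0\<^esub> (c \<odot>\<^bsub>L 0\<^esub> a)"
proof -
  have "I +>\<^bsub>L 0\<^esub> (c \<odot>\<^bsub>L 0\<^esub> b) = I +>\<^bsub>L 0\<^esub> (c \<odot>\<^bsub>L 0\<^esub> a)"
    if b: "b \<in> I +>\<^bsub>L 0\<^esub> a" for b
  proof -
    obtain i where i: "i \<in> I" "b = i \<oplus>\<^bsub>L 0\<^esub> a" using b by (auto simp: a_r_coset_def')
    then have ic: "i \<in> cells A 0" "b \<in> cells A 0" using assms I.a_subset by auto
    have "b \<ominus>\<^bsub>L 0\<^esub> a = i" unfolding i(2) using ic(1) assms by algebra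
    then have "c \<odot>\<^bsub>L 0\<^esub> b \<ominus>\<^bsub>L 0\<^esub> c \<odot>\<^bsub>L 0\<^esub> a \<in> I"
      using L0.smult_diff[OF ic(2) assms, of c] smult_I[OF i(1), of c] by simp
    then show ?thesis using ic assms by (simp add: coset_eq L0.smult_closed)
  qed
  then have "(\<Union>b\<in>I +>\<^bsub>L 0\<^esub> a. I +>\<^bsub>L 0\<^esub> (c \<odot>\<^bsub>L 0\<^esub> b)) =
      (\<Union>b\<in>I +>\<^bsub>L 0\<^esub> a. I +>\<^bsub>L 0\<^esub> (c \<odot>\<^bsub>L 0\<^esub> a))"
    by (intro SUP_cong HOL.refl)
  also have "\<dots> = I +>\<^bsub>L 0\<^esub> (c \<odot>\<^bsub>L 0\<^esub> a)"
    using I.a_rcos_self[OF assms] by (intro UN_constant_eq HOL.refl) auto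
  finally show ?thesis
    by (simp add: presented_alg_def omega_quot_def level_0)
qed

lemma h_linear: "linear_map (L 0) (L 0) h"
  unfolding linear_map_def
proof (intro conjI ballI allI)
  note lin = linear_mapD[OF iota_linear]
  fix a assume a: "a \<in> cells A 0"
  show "h a \<in> cells A 0" unfolding h_def using lin(1) a by (simp add: coset_presented)
  show "h (c \<odot>\<^bsub>L 0\<^esub> a) = c \<odot>\<^bsub>L 0\<^esub> h a" for c
    unfolding h_def coset_smult[OF a, symmetric] using lin(3) a by (simp add: coset_presented)
  fix b assume b: "b \<in> cells A 0"
  have "(I +>\<^bsub>L 0\<^esub> a) \<oplus>\<^bsub>presented_alg \<Omega> X\<^esub> (I +>\<^bsub>L 0\<^esub> b) = I +>\<^bsub>L 0\<^esub> (a \<oplus>\<^bsub>L 0\<^esub> b)"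
    using I.a_rcos_sum[OF a b] by (simp add: presented_alg_def omega_quot_def FactRing_def level_0)
  then show "h (a \<oplus>\<^bsub>L 0\<^esub> b) = h a \<oplus>\<^bsub>L 0\<^esub> h b"
    using lin(2)[OF coset_presented[OF a] coset_presented[OF b]] by (simp add: h_def)
qed

lemma h_closed: "a \<in> cells A 0 \<Longrightarrow> h a \<in> cells A 0"
  by (rule linear_mapD(1)[OF h_linear])

lemma h_eq: "a \<in> cells A 0 \<Longrightarrow> b \<in> cells A 0 \<Longrightarrow> a \<ominus>\<^bsub>L 0\<^esub> b \<in> I \<Longrightarrow> h a = h b"
  by (simp add: h_def coset_eq)

lemma h_zero: "h \<zero>\<^bsub>L 0\<^esub> = \<zero>\<^bsub>L 0\<^esub>"
  using linear_map_minus(1)[OF h_linear L0.omega_algebra_axioms L0.omega_algebra_axioms] .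

lemma h_I: "i \<in> I \<Longrightarrow> h i = \<zero>\<^bsub>L 0\<^esub>"
proof -
  assume i: "i \<in> I"
  then have "i \<in> cells A 0" using I.a_subset by auto
  moreover from this have "i \<ominus>\<^bsub>L 0\<^esub> \<zero>\<^bsub>L 0\<^esub> \<in> I" using i by (simp add: a_minus_def)
  ultimately have "h i = h \<zero>\<^bsub>L 0\<^esub>" by (intro h_eq) auto
  then show ?thesis by (simp add: h_zero)
qed

lemma h_diff_I: "c \<in> cells A 0 \<Longrightarrow> h c \<ominus>\<^bsub>L 0\<^esub> c \<in> I"
proof -
  assume c: "c \<in> cells A 0"
  have "proj \<Omega> X 0 (\<iota> 0 (I +>\<^bsub>L 0\<^esub> c)) = I +>\<^bsub>L 0\<^esub> c"
    using unital_section coset_presented[OF c] by (simp add: unital_section_def)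
  then show ?thesis using coset_eq[OF h_closed[OF c] c] by (simp add: proj_eq h_def)
qed

lemma diff_h_I: "c \<in> cells A 0 \<Longrightarrow> c \<ominus>\<^bsub>L 0\<^esub> h c \<in> I"
proof -
  assume c: "c \<in> cells A 0"
  have "\<ominus>\<^bsub>L 0\<^esub> (h c \<ominus>\<^bsub>L 0\<^esub> c) \<in> I" using h_diff_I[OF c] by (rule I.a_inv_closed)
  moreover have "\<ominus>\<^bsub>L 0\<^esub> (h c \<ominus>\<^bsub>L 0\<^esub> c) = c \<ominus>\<^bsub>L 0\<^esub> h c"
    using c h_closed[OF c] by algebra
  ultimately show ?thesis by simp
qed

lemma h_idem: "c \<in> cells A 0 \<Longrightarrow> h (h c) = h c"
  by (rule h_eq) (simp_all add: h_closed h_diff_I)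

lemma h_one: "h \<one>\<^bsub>L 0\<^esub> = \<one>\<^bsub>L 0\<^esub>"
  using unital_section by (simp add: unital_section_def h_def presented_alg_def omega_quot_def FactRing_def level_0)

lemma hat_eq: "a \<in> cells A n \<Longrightarrow> hat \<Omega> X \<iota> n a = up n (h (s0 n a))"
  using iota_lift[OF coset_presented, of "s0 n a" n] omega_homD(3)[OF ksrc_hom[of 0 n], of a]
  by (simp add: hat_def proj_eq)

lemma h_ktgt: "f \<in> cells A n \<Longrightarrow> h (t0 n f) = h (s0 n f)"
  using h_eq[OF _ _ kboundary_diff_I[of f n]] omega_homD(3)[OF ksrc_hom[of 0 n]] omega_homD(3)[OF ktgt_hom[of 0 n]]
  by simp

lemma iota_hat: "x \<in> carrier (presented_alg \<Omega> X) \<Longrightarrow> \<exists>c\<in>cells A 0. \<iota> n x = up n (h c)"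
  unfolding presented_carrier using iota_lift[OF coset_presented, of _ n] by (auto simp: h_def)

end

section \<open>Contractible polygraphs are resolutions\<close>

lemma omega_isomorphic_refl: "omega_isomorphic \<Omega> B B"
proof -
  have "(\<lambda>x. x) \<in> ring_iso B B"
    by (auto simp: ring_iso_def ring_hom_def bij_betw_def)
  then show ?thesis
    unfolding omega_isomorphic_def linear_map_def by (intro bexI) auto
qed

context polygraph_section
begin

text \<open>The composites that make up the source of \<open>\<sigma>\<close> are defined because whiskering
  commutes with taking targets: the \<open>k\<close>-target of the \<open>k\<close>-th partial composite for
  \<open>a\<close> is the full composite for the \<open>k\<close>-target of \<open>a\<close>, which is the
  source of the next whisker.\<close>

lemma left_whisker_tgt:
  assumes \<sigma>: "contraction \<Omega> X \<iota> \<sigma>"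
  shows "k \<le> n \<Longrightarrow> a \<in> cells A n \<Longrightarrow> left_whisker A \<sigma> n a k \<in> cells A n \<and>
    (\<forall>j. k \<le> j \<longrightarrow> j \<le> n \<longrightarrow> ktgt A j n (left_whisker A \<sigma> n a k) = left_whisker A \<sigma> j (ktgt A j n a) k) \<and>
    (k < n \<longrightarrow> composable A n k (left_whisker A \<sigma> n a k) (lift A (Suc k) n (\<sigma> k (ktgt A k n a))))"
proof (induction k arbitrary: n a)
  note [simp del] = ksrc.simps ktgt.simps lift.simps
  have lin: "linear_map (L n) (L (Suc n)) (\<sigma> n)" for n
    using \<sigma> by (simp add: contraction_def Let_def)
  have src: "a \<in> cells A n \<Longrightarrow> src A n (\<sigma> n a) = left_whisker A \<sigma> n a n" for n a
    using \<sigma> by (simp add: contraction_def Let_def)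
  have comp: "composable A n k (left_whisker A \<sigma> n a k) (lift A (Suc k) n (\<sigma> k (ktgt A k n a)))"
    if "k < n" "a \<in> cells A n" "left_whisker A \<sigma> n a k \<in> cells A n"
      "ktgt A k n (left_whisker A \<sigma> n a k) = left_whisker A \<sigma> k (ktgt A k n a) k" for n a k
  proof -
    have t: "ktgt A k n a \<in> cells A k" using that ktgt_closed by simp
    have s: "\<sigma> k (ktgt A k n a) \<in> cells A (Suc k)" using linear_mapD(1)[OF lin t] .
    have "ksrc A k n (lift A (Suc k) n (\<sigma> k (ktgt A k n a))) = src A k (\<sigma> k (ktgt A k n a))"
      using that s by (simp add: ksrc_lift_low ksrc_Suc)
    then show ?thesis using that src[OF t] lift_closed[OF _ s, of n] by (simp add: composable_def)
  qed
  { case 0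
    then show ?case using comp[of 0 n a] by simp
  next
    case (Suc k)
    let ?x = "left_whisker A \<sigma> n a k" and ?y = "lift A (Suc k) n (\<sigma> k (ktgt A k n a))"
    have kn: "k < n" "k \<le> n" using Suc.prems by auto
    have c: "composable A n k ?x ?y" and xt: "\<And>j. k \<le> j \<Longrightarrow> j \<le> n \<Longrightarrow>
        ktgt A j n ?x = left_whisker A \<sigma> j (ktgt A j n a) k"
      using Suc.IH[OF kn(2) Suc.prems(2)] kn by auto
    have t: "ktgt A k n a \<in> cells A k" using Suc.prems ktgt_closed by simp
    have s: "\<sigma> k (ktgt A k n a) \<in> cells A (Suc k)" using linear_mapD(1)[OF lin t] .
    have cl: "left_whisker A \<sigma> n a (Suc k) \<in> cells A n" using cmp_closed[OF c] by simp
    have tg: "ktgt A j n (left_whisker A \<sigma> n a (Suc k)) = left_whisker A \<sigma> j (ktgt A j n a) (Suc k)"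
      if j: "Suc k \<le> j" "j \<le> n" for j
    proof -
      have "ktgt A j n ?y = lift A (Suc k) j (\<sigma> k (ktgt A k n a))"
        using j s by (simp add: ktgt_lift_high)
      then show ?thesis using ktgt_cmp_high[OF _ j(2) c] j xt[of j] by (simp add: ktgt_ktgt)
    qed
    show ?case using cl tg comp[of "Suc k" n a] Suc.prems by auto
  }
qed

text \<open>By \<open>cmp_formula\<close>, each whiskering step adds to the composite a term that depends
  only on the boundary of the cell. Hence it cancels in the difference for two parallel cells.\<close>

theorem contraction_imp_resolution:
  assumes \<sigma>: "contraction \<Omega> X \<iota> \<sigma>"
  shows "polygraphic_resolution \<Omega> X (presented_alg \<Omega> X)"
  unfolding polygraphic_resolution_def
proof (intro conjI omega_isomorphic_refl allI impI ballI)
  fix n f g assume n: "1 \<le> n" and f: "f \<in> cells (F n) n" and g: "g \<in> cells (F n) n" and p: "parallel (F n) n f g"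
  have lin: "linear_map (L n) (L (Suc n)) (\<sigma> n)"
    and src: "a \<in> cells A n \<Longrightarrow> src A n (\<sigma> n a) = left_whisker A \<sigma> n a n"
    and tgt: "a \<in> cells A n \<Longrightarrow> tgt A n (\<sigma> n a) = right_whisker A \<sigma> n a (hat \<Omega> X \<iota> n a) n" for a
    using \<sigma> by (simp_all add: contraction_def Let_def)
  have f: "f \<in> cells A n" and g: "g \<in> cells A n" using f g by (simp_all add: level_F[of n n])
  obtain m where m: "n = Suc m" using n by (cases n) auto
  have st: "src A m f = src A m g" "tgt A m f = tgt A m g"
    using p m by (simp_all add: parallel_def src_F[of m n] tgt_F[of m n] del: free_n_alg.simps)
  have ks: "ksrc A k n f = ksrc A k n g" and kt: "ktgt A k n f = ktgt A k n g" if "k < n" for k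
    using that st by (simp_all add: m)
  interpret L: omega_algebra "L n" \<Omega> by (rule level_alg)
  interpret L': omega_algebra "L (Suc n)" \<Omega> by (rule level_alg)
  have lw: "k \<le> n \<Longrightarrow> left_whisker A \<sigma> n f k \<ominus>\<^bsub>L n\<^esub> f = left_whisker A \<sigma> n g k \<ominus>\<^bsub>L n\<^esub> g" for k
  proof (induction k)
    case 0
    show ?case using f g by (simp add: a_minus_def L.r_neg)
  next
    case (Suc k)
    then have k: "k \<le> n" "k < n" by auto
    define e z where "e = lift A k n (left_whisker A \<sigma> k (ktgt A k n g) k)"
      and "z = lift A (Suc k) n (\<sigma> k (ktgt A k n g))"
    have step: "left_whisker A \<sigma> n a (Suc k) \<ominus>\<^bsub>L n\<^esub> a =
        (left_whisker A \<sigma> n a k \<ominus>\<^bsub>L n\<^esub> a) \<ominus>\<^bsub>L n\<^esub> e \<oplus>\<^bsub>L n\<^esub> z"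
      if a: "a \<in> cells A n" and t: "ktgt A k n a = ktgt A k n g" for a
    proof -
      note w = left_whisker_tgt[OF \<sigma> k(1) a]
      define x where "x = left_whisker A \<sigma> n a k"
      have x: "x \<in> cells A n" "ktgt A k n x = left_whisker A \<sigma> k (ktgt A k n g) k" "composable A n k x z"
        using w k t by (auto simp: x_def z_def)
      then have c: "e \<in> cells A n" "z \<in> cells A n"
        using lift_closed[OF k(1) ktgt_closed[OF k(1) x(1)]] by (auto simp: e_def composable_def)
      have "left_whisker A \<sigma> n a (Suc k) = x \<ominus>\<^bsub>L n\<^esub> e \<oplus>\<^bsub>L n\<^esub> z"
        using cmp_formula[OF x(3)] x(2) t by (simp add: x_def z_def e_def)
      then show ?thesis unfolding x_def[symmetric] using x(1) c a by (simp add: L.group_simps)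
    qed
    show ?case using step[OF f kt[OF k(2)]] step[OF g HOL.refl] Suc k by simp
  qed
  have rw: "right_whisker A \<sigma> n f b k = right_whisker A \<sigma> n g b k" if "k \<le> n" for b k
    using that by (induction k) (simp_all add: ks)
  have h: "hat \<Omega> X \<iota> n f = hat \<Omega> X \<iota> n g" using f g n by (simp add: hat_eq ks)
  \<comment> \<open>the filler: its source is \<open>f - g + g\<close>, and the two equal targets of \<open>\<sigma>\<close> cancel\<close>
  define w where "w = \<sigma> n f \<ominus>\<^bsub>L (Suc n)\<^esub> \<sigma> n g \<oplus>\<^bsub>L (Suc n)\<^esub> idt A n g"
  note sc = linear_mapD(1)[OF lin f] linear_mapD(1)[OF lin g] omega_homD(3)[OF idt_hom g]
  have wc: "w \<in> cells A (Suc n)" unfolding w_def using sc by simp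
  have c: "left_whisker A \<sigma> n f n \<in> cells A n" "left_whisker A \<sigma> n g n \<in> cells A n"
    using left_whisker_tgt[OF \<sigma> order_refl f] left_whisker_tgt[OF \<sigma> order_refl g] by auto
  have ws: "src A n w = f"
  proof -
    have "src A n w = left_whisker A \<sigma> n f n \<ominus>\<^bsub>L n\<^esub> left_whisker A \<sigma> n g n \<oplus>\<^bsub>L n\<^esub> g"
      unfolding w_def using sc f g omega_homD(4)[OF src_hom[of n]]
        linear_map_minus(3)[OF omega_homD(1)[OF src_hom[of n]] L'.omega_algebra_axioms L.omega_algebra_axioms]
      by (simp add: src src_idt)
    also have "\<dots> = (left_whisker A \<sigma> n f n \<ominus>\<^bsub>L n\<^esub> f) \<ominus>\<^bsub>L n\<^esub>
        (left_whisker A \<sigma> n g n \<ominus>\<^bsub>L n\<^esub> g) \<oplus>\<^bsub>L n\<^esub> f"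
      using c f g by (simp add: L.group_simps)
    also have "\<dots> = f" unfolding lw[OF order_refl] using c f g by (simp add: L.group_simps)
    finally show ?thesis .
  qed
  have wt: "tgt A n w = g"
  proof -
    define r where "r = tgt A n (\<sigma> n g)"
    have r: "r \<in> cells A n" "tgt A n (\<sigma> n f) = r"
      using omega_homD(3)[OF tgt_hom sc(2)] f g by (simp_all add: r_def tgt rw h)
    have "tgt A n w = r \<ominus>\<^bsub>L n\<^esub> r \<oplus>\<^bsub>L n\<^esub> g"
      unfolding w_def using sc f g r omega_homD(4)[OF tgt_hom[of n]]
        linear_map_minus(3)[OF omega_homD(1)[OF tgt_hom[of n]] L'.omega_algebra_axioms L.omega_algebra_axioms]
      by (simp add: tgt_idt r_def)
    also have "\<dots> = g" using r g by (simp add: L.group_simps)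
    finally show ?thesis .
  qed
  show "\<exists>w\<in>cells (F (Suc n)) (Suc n). src (F (Suc n)) n w = f \<and> tgt (F (Suc n)) n w = g"
    using wc ws wt by (metis level_F src_F tgt_F order_refl lessI)
qed

end

section \<open>Contractions in terms of homotopies\<close>

context polygraph
begin

lemma omega_hom_diff:
  assumes "omega_hom \<Omega> (L m) (L n) f"
  shows "a \<in> cells A m \<Longrightarrow> b \<in> cells A m \<Longrightarrow>
      f (a \<ominus>\<^bsub>L m\<^esub> b) = f a \<ominus>\<^bsub>L n\<^esub> f b"
    and "f \<zero>\<^bsub>L m\<^esub> = \<zero>\<^bsub>L n\<^esub>"
  using linear_map_minus[OF omega_homD(1)[OF assms] level_alg level_alg] by auto

lemmas src_simps = omega_homD(2-7)[OF src_hom] omega_hom_diff[OF src_hom] src_idt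
lemmas tgt_simps = omega_homD(2-7)[OF tgt_hom] omega_hom_diff[OF tgt_hom] tgt_idt
lemmas idt_simps = omega_homD(2-7)[OF idt_hom] omega_hom_diff[OF idt_hom]
lemmas lift_simps = omega_homD(2-7)[OF lift_hom] omega_hom_diff[OF lift_hom]
lemmas ksrc_simps = omega_homD(2-7)[OF ksrc_hom] omega_hom_diff[OF ksrc_hom]
lemmas ktgt_simps = omega_homD(2-7)[OF ktgt_hom] omega_hom_diff[OF ktgt_hom]

lemma level_closed [simp]:
  "a \<in> cells A m \<Longrightarrow> b \<in> cells A m \<Longrightarrow> a \<oplus>\<^bsub>L m\<^esub> b \<in> cells A m"
  "a \<in> cells A m \<Longrightarrow> b \<in> cells A m \<Longrightarrow> a \<ominus>\<^bsub>L m\<^esub> b \<in> cells A m"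
  "a \<in> cells A m \<Longrightarrow> b \<in> cells A m \<Longrightarrow> a \<otimes>\<^bsub>L m\<^esub> b \<in> cells A m"
  "a \<in> cells A m \<Longrightarrow> c \<odot>\<^bsub>L m\<^esub> a \<in> cells A m"
  "\<tau> \<in> \<Omega> \<Longrightarrow> a \<in> cells A m \<Longrightarrow> oper (L m) \<tau> a \<in> cells A m"
  "\<zero>\<^bsub>L m\<^esub> \<in> cells A m" "\<one>\<^bsub>L m\<^esub> \<in> cells A m"
proof -
  interpret L: omega_algebra "L m" \<Omega> by (rule level_alg)
  show "a \<in> cells A m \<Longrightarrow> b \<in> cells A m \<Longrightarrow> a \<oplus>\<^bsub>L m\<^esub> b \<in> cells A m"
    "a \<in> cells A m \<Longrightarrow> b \<in> cells A m \<Longrightarrow> a \<ominus>\<^bsub>L m\<^esub> b \<in> cells A m"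
    "a \<in> cells A m \<Longrightarrow> b \<in> cells A m \<Longrightarrow> a \<otimes>\<^bsub>L m\<^esub> b \<in> cells A m"
    "a \<in> cells A m \<Longrightarrow> c \<odot>\<^bsub>L m\<^esub> a \<in> cells A m"
    "\<tau> \<in> \<Omega> \<Longrightarrow> a \<in> cells A m \<Longrightarrow> oper (L m) \<tau> a \<in> cells A m"
    "\<zero>\<^bsub>L m\<^esub> \<in> cells A m" "\<one>\<^bsub>L m\<^esub> \<in> cells A m"
    by (simp_all add: L.smult_closed L.oper_closed)
qed

lemma map_closed [simp]:
  "a \<in> cells A (Suc m) \<Longrightarrow> src A m a \<in> cells A m"
  "a \<in> cells A (Suc m) \<Longrightarrow> tgt A m a \<in> cells A m"
  "a \<in> cells A m \<Longrightarrow> idt A m a \<in> cells A (Suc m)"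
  "k \<le> m \<Longrightarrow> a \<in> cells A k \<Longrightarrow> lift A k m a \<in> cells A m"
  "k \<le> m \<Longrightarrow> a \<in> cells A m \<Longrightarrow> ksrc A k m a \<in> cells A k"
  "k \<le> m \<Longrightarrow> a \<in> cells A m \<Longrightarrow> ktgt A k m a \<in> cells A k"
  using omega_homD(3)[OF src_hom] omega_homD(3)[OF tgt_hom] omega_homD(3)[OF idt_hom]
    lift_closed ksrc_closed ktgt_closed by auto

lemma peiffer_zero:
  assumes "x \<in> cells A (Suc m)" "y \<in> cells A (Suc m)"
    and "s0 (Suc m) x = \<zero>\<^bsub>L 0\<^esub>" "t0 (Suc m) y = \<zero>\<^bsub>L 0\<^esub>"
  shows "x \<otimes>\<^bsub>L (Suc m)\<^esub> y = \<zero>\<^bsub>L (Suc m)\<^esub>" "y \<otimes>\<^bsub>L (Suc m)\<^esub> x = \<zero>\<^bsub>L (Suc m)\<^esub>"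
  using peiffer[of "Suc m" x y] assms by simp_all

lemma level_diff_cancel [simp]:
  "a \<in> cells A m \<Longrightarrow> b \<in> cells A m \<Longrightarrow> a \<ominus>\<^bsub>L m\<^esub> b \<oplus>\<^bsub>L m\<^esub> b = a"
proof -
  interpret L: omega_algebra "L m" \<Omega> by (rule level_alg)
  show "a \<in> cells A m \<Longrightarrow> b \<in> cells A m \<Longrightarrow> a \<ominus>\<^bsub>L m\<^esub> b \<oplus>\<^bsub>L m\<^esub> b = a"
    by (simp add: L.group_simps)
qed

lemma level_diff_self [simp]:
  "a \<in> cells A m \<Longrightarrow> a \<ominus>\<^bsub>L m\<^esub> a = \<zero>\<^bsub>L m\<^esub>"
  "a \<in> cells A m \<Longrightarrow> a \<oplus>\<^bsub>L m\<^esub> \<zero>\<^bsub>L m\<^esub> = a"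
  "a \<in> cells A m \<Longrightarrow> \<zero>\<^bsub>L m\<^esub> \<oplus>\<^bsub>L m\<^esub> a = a"
  "a \<in> cells A m \<Longrightarrow> a \<ominus>\<^bsub>L m\<^esub> \<zero>\<^bsub>L m\<^esub> = a"
proof -
  interpret L: omega_algebra "L m" \<Omega> by (rule level_alg)
  show "a \<in> cells A m \<Longrightarrow> a \<ominus>\<^bsub>L m\<^esub> a = \<zero>\<^bsub>L m\<^esub>"
    "a \<in> cells A m \<Longrightarrow> a \<oplus>\<^bsub>L m\<^esub> \<zero>\<^bsub>L m\<^esub> = a"
    "a \<in> cells A m \<Longrightarrow> \<zero>\<^bsub>L m\<^esub> \<oplus>\<^bsub>L m\<^esub> a = a"
    "a \<in> cells A m \<Longrightarrow> a \<ominus>\<^bsub>L m\<^esub> \<zero>\<^bsub>L m\<^esub> = a"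
    by (simp_all add: a_minus_def L.r_neg)
qed

end

context polygraph_section
begin

lemma h_ksrc_tgt: "f \<in> cells A (Suc n) \<Longrightarrow> h (s0 n (tgt A n f)) = h (s0 (Suc n) f)"
proof -
  assume f: "f \<in> cells A (Suc n)"
  have "h (s0 n (tgt A n f)) = h (t0 n (tgt A n f))"
    using f h_ktgt[of "tgt A n f" n] by simp
  also have "\<dots> = h (s0 (Suc n) f)" using f h_ktgt[of f "Suc n"] by simp
  finally show ?thesis .
qed

end

text \<open>The part of a right and bracketed contraction that remains once identities are subtracted:
  \<open>\<delta> n a\<close> is \<open>\<sigma>\<^sub>a\<close> minus the identity of its source. By
  \<open>cmp_formula\<close> composition becomes addition, so the axioms of \<open>\<sigma>\<close> become
  linear in \<open>\<delta>\<close>. The formula for brackets is required for arbitrary \<open>v\<close>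
  rather than for monomials, which by linearity is the same.\<close>

locale reduced_contraction = polygraph_section \<Omega> X \<iota>
  for \<Omega> :: "'o set" and X :: "('z, 'o, 'k::field_char_0, 'x) polygraph"
    and \<iota> :: "nat \<Rightarrow> ('z, 'o, 'k, 'x) cell set \<Rightarrow> ('z, 'o, 'k, 'x) cell" +
  fixes \<delta> :: "nat \<Rightarrow> ('z, 'o, 'k, 'x) cell \<Rightarrow> ('z, 'o, 'k, 'x) cell"
  assumes \<delta>_linear: "linear_map (L n) (L (Suc n)) (\<delta> n)"
    and src_\<delta>: "a \<in> cells A n \<Longrightarrow> src A n (\<delta> n a) = \<zero>\<^bsub>L n\<^esub>"
    and tgt_\<delta>_0: "a \<in> cells A 0 \<Longrightarrow> tgt A 0 (\<delta> 0 a) = h a \<ominus>\<^bsub>L 0\<^esub> a"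
    and tgt_\<delta>_Suc: "a \<in> cells A (Suc n) \<Longrightarrow> tgt A (Suc n) (\<delta> (Suc n) a) =
      idt A n (src A n a) \<ominus>\<^bsub>L (Suc n)\<^esub> a \<oplus>\<^bsub>L (Suc n)\<^esub> \<delta> n (src A n a \<ominus>\<^bsub>L n\<^esub> tgt A n a)"
    and \<delta>_idt: "a \<in> cells A n \<Longrightarrow> \<delta> (Suc n) (idt A n a) = \<zero>\<^bsub>L (Suc (Suc n))\<^esub>"
    and \<delta>_h: "a \<in> cells A 0 \<Longrightarrow> \<delta> 0 (h a) = \<zero>\<^bsub>L (Suc 0)\<^esub>"
    and \<delta>_\<delta>: "a \<in> cells A n \<Longrightarrow> \<delta> (Suc n) (\<delta> n a) = \<zero>\<^bsub>L (Suc (Suc n))\<^esub>"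
    and \<delta>_mult: "f \<in> cells A n \<Longrightarrow> g \<in> cells A n \<Longrightarrow> \<delta> n (f \<otimes>\<^bsub>L n\<^esub> g) =
      up (Suc n) (s0 n f) \<otimes>\<^bsub>L (Suc n)\<^esub> \<delta> n g \<oplus>\<^bsub>L (Suc n)\<^esub>
      \<delta> n (f \<otimes>\<^bsub>L n\<^esub> up n (h (s0 n g)))"
    and \<delta>_oper: "f \<in> cells A n \<Longrightarrow> v \<in> cells A 0 \<Longrightarrow> \<tau> \<in> \<Omega> \<Longrightarrow>
      \<delta> n (oper (L n) \<tau> f \<otimes>\<^bsub>L n\<^esub> up n v) =
      oper (L (Suc n)) \<tau> (\<delta> n f) \<otimes>\<^bsub>L (Suc n)\<^esub> up (Suc n) v \<oplus>\<^bsub>L (Suc n)\<^esub>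
      \<delta> n (up n (oper (L 0) \<tau> (h (s0 n f)) \<otimes>\<^bsub>L 0\<^esub> v))"
begin

lemmas \<delta>_simps = linear_mapD[OF \<delta>_linear] linear_map_minus[OF \<delta>_linear level_alg level_alg]

text \<open>The source of \<open>\<sigma>\<^sub>a\<close> in closed form. In the expansion of the whiskered
  composite by \<open>cmp_formula\<close>, the corrections of all steps but the last cancel against their
  targets, which leaves \<open>a - 1\<^bsub>t(a)\<^esub> + \<sigma>\<^bsub>t(a)\<^esub>\<close>
  (\<open>S_Suc\<close>); here \<open>\<sigma>\<close> is written out because it is defined through
  \<open>S\<close>.\<close>

primrec S :: "nat \<Rightarrow> ('z, 'o, 'k, 'x) cell \<Rightarrow> ('z, 'o, 'k, 'x) cell" where
  "S 0 a = a"
| "S (Suc n) a = a \<ominus>\<^bsub>L (Suc n)\<^esub> idt A n (tgt A n a) \<oplus>\<^bsub>L (Suc n)\<^esub>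
    (idt A n (S n (tgt A n a)) \<oplus>\<^bsub>L (Suc n)\<^esub> \<delta> n (tgt A n a))"

definition \<sigma> :: "nat \<Rightarrow> ('z, 'o, 'k, 'x) cell \<Rightarrow> ('z, 'o, 'k, 'x) cell" where
  "\<sigma> n a = idt A n (S n a) \<oplus>\<^bsub>L (Suc n)\<^esub> \<delta> n a"

lemma S_Suc: "S (Suc n) a = a \<ominus>\<^bsub>L (Suc n)\<^esub> idt A n (tgt A n a) \<oplus>\<^bsub>L (Suc n)\<^esub> \<sigma> n (tgt A n a)"
  by (simp add: \<sigma>_def)

declare S.simps(2) [simp del]

lemma S_linear: "linear_map (L n) (L n) (S n)"
  and \<sigma>_linear: "linear_map (L n) (L (Suc n)) (\<sigma> n)"
proof -
  have *: "linear_map (L n) (L (Suc n)) (\<sigma> n)" if S: "linear_map (L n) (L n) (S n)" for n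
  proof -
    interpret L: omega_algebra "L (Suc n)" \<Omega> by (rule level_alg)
    show ?thesis unfolding linear_map_def \<sigma>_def
      by (auto simp: linear_mapD[OF S] idt_simps \<delta>_simps L.group_simps L.smult_r_distr)
  qed
  show S: "linear_map (L n) (L n) (S n)" for n
  proof (induction n)
    case 0
    show ?case by (simp add: linear_map_def)
  next
    case (Suc n)
    interpret L: omega_algebra "L (Suc n)" \<Omega> by (rule level_alg)
    show ?case unfolding linear_map_def S_Suc
      by (auto simp: linear_mapD[OF *[OF Suc]] idt_simps tgt_simps L.group_simps L.smult_r_distr L.smult_diff)
  qed
  show "linear_map (L n) (L (Suc n)) (\<sigma> n)" by (rule *[OF S])
qed

lemmas S_simps = linear_mapD[OF S_linear] linear_map_minus[OF S_linear level_alg level_alg]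
lemmas \<sigma>_simps = linear_mapD[OF \<sigma>_linear] linear_map_minus[OF \<sigma>_linear level_alg level_alg]

lemma src_\<sigma>: "a \<in> cells A n \<Longrightarrow> src A n (\<sigma> n a) = S n a"
  by (simp add: \<sigma>_def src_simps S_simps \<delta>_simps src_\<delta>)

text \<open>The whiskers in the source of \<open>\<sigma>\<close> are the same for the source and the target
  of a cell, so they cancel in the difference.\<close>

lemma S_boundary:
  assumes "a \<in> cells A (Suc n)"
  shows "S n (src A n a \<ominus>\<^bsub>L n\<^esub> tgt A n a) = src A n a \<ominus>\<^bsub>L n\<^esub> tgt A n a"
proof (cases n)
  case (Suc m)
  then show ?thesis using assms
    by (simp add: S_Suc tgt_simps glob_tgt idt_simps \<sigma>_simps)
qed simp

lemma tgt_\<sigma>_0: "a \<in> cells A 0 \<Longrightarrow> tgt A 0 (\<sigma> 0 a) = h a"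
  by (simp add: \<sigma>_def tgt_simps \<delta>_simps tgt_\<delta>_0 h_closed L0.group_simps)

text \<open>Applied to the boundary \<open>s(a) - t(a)\<close>, which \<open>S\<close> fixes, the definition
  of \<open>\<sigma>\<close> turns the condition on the target of \<open>\<delta>\<close> into this
  equation.\<close>

lemma tgt_\<sigma>_Suc:
  assumes a: "a \<in> cells A (Suc n)"
  shows "tgt A (Suc n) (\<sigma> (Suc n) a) = \<sigma> n (src A n a)"
proof -
  interpret L: omega_algebra "L (Suc n)" \<Omega> by (rule level_alg)
  let ?d = "src A n a \<ominus>\<^bsub>L n\<^esub> tgt A n a"
  have d: "\<sigma> n (src A n a) \<ominus>\<^bsub>L (Suc n)\<^esub> \<sigma> n (tgt A n a) =
      idt A n (src A n a) \<ominus>\<^bsub>L (Suc n)\<^esub> idt A n (tgt A n a) \<oplus>\<^bsub>L (Suc n)\<^esub> \<delta> n ?d"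
  proof -
    have "\<sigma> n (src A n a) \<ominus>\<^bsub>L (Suc n)\<^esub> \<sigma> n (tgt A n a) = \<sigma> n ?d" using a by (simp add: \<sigma>_simps)
    also have "\<dots> = idt A n ?d \<oplus>\<^bsub>L (Suc n)\<^esub> \<delta> n ?d" using a by (simp add: \<sigma>_def S_boundary)
    finally show ?thesis using a by (simp add: idt_simps)
  qed
  have cl: "\<sigma> n (src A n a) \<in> cells A (Suc n)" "\<sigma> n (tgt A n a) \<in> cells A (Suc n)" "\<delta> n ?d \<in> cells A (Suc n)"
    using a by (simp_all add: \<sigma>_simps \<delta>_simps(1))
  have "tgt A (Suc n) (\<sigma> (Suc n) a) = S (Suc n) a \<oplus>\<^bsub>L (Suc n)\<^esub>
      (idt A n (src A n a) \<ominus>\<^bsub>L (Suc n)\<^esub> a \<oplus>\<^bsub>L (Suc n)\<^esub> \<delta> n ?d)"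
    unfolding \<sigma>_def[of "Suc n"] using a tgt_\<delta>_Suc[OF a]
    by (simp add: tgt_simps S_simps(1) \<delta>_simps(1) tgt_idt)
  also have "\<dots> = \<sigma> n (tgt A n a) \<oplus>\<^bsub>L (Suc n)\<^esub>
    (\<sigma> n (src A n a) \<ominus>\<^bsub>L (Suc n)\<^esub> \<sigma> n (tgt A n a))"
    unfolding d S_Suc using a cl by (simp add: L.group_simps)
  also have "\<dots> = \<sigma> n (src A n a)" using cl by (simp add: L.group_simps)
  finally show ?thesis .
qed

lemma ktgt_\<sigma>: "a \<in> cells A n \<Longrightarrow> t0 (Suc n) (\<sigma> n a) = h (s0 n a)"
proof (induction n arbitrary: a)
  case (Suc n)
  then show ?case using tgt_\<sigma>_Suc[OF Suc.prems] Suc.IH[of "src A n a"] by simp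
qed (simp add: tgt_\<sigma>_0)

lemma ksrc_S: "a \<in> cells A n \<Longrightarrow> s0 n (S n a) = s0 n a"
proof (induction n arbitrary: a)
  case (Suc n)
  then have "s0 (Suc n) (S (Suc n) a) = s0 (Suc n) a \<ominus>\<^bsub>L 0\<^esub> s0 n (tgt A n a)
      \<oplus>\<^bsub>L 0\<^esub> s0 n (tgt A n a)"
    by (simp add: S_Suc src_simps ksrc_simps \<sigma>_simps(1) src_\<sigma> S_simps(1))
  also have "\<dots> = s0 (Suc n) a"
    using Suc.prems by (simp add: L0.group_simps)
  finally show ?case .
qed simp

lemma ksrc_\<sigma>: "a \<in> cells A n \<Longrightarrow> s0 (Suc n) (\<sigma> n a) = s0 n a"
  by (simp add: src_\<sigma> ksrc_S)

lemma \<sigma>_idt: "a \<in> cells A n \<Longrightarrow> \<sigma> (Suc n) (idt A n a) = idt A (Suc n) (\<sigma> n a)"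
  by (simp add: \<sigma>_def[of "Suc n"] S_Suc \<delta>_idt tgt_idt \<sigma>_simps(1))

lemma \<sigma>_lift: "a \<in> cells A 0 \<Longrightarrow> \<sigma> n (up n a) = lift A 1 (Suc n) (\<sigma> 0 a)"
  by (induction n) (simp_all add: \<sigma>_idt)

lemma \<sigma>_h: "a \<in> cells A 0 \<Longrightarrow> \<sigma> n (up n (h a)) = idt A n (up n (h a))"
proof (induction n)
  case 0
  then show ?case by (simp add: \<sigma>_def \<delta>_h h_closed)
qed (simp add: \<sigma>_idt h_closed)

text \<open>The target of \<open>\<sigma>\<^sub>a\<close> is again a value of \<open>\<sigma>\<close>, or in
  dimension \<open>0\<close> of \<open>h\<close>. By induction \<open>\<sigma>\<close> is an identity there,
  so \<open>S\<close> fixes \<open>\<sigma>\<^sub>a\<close>; and \<open>\<delta>\<close> vanishes on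
  \<open>\<sigma>\<^sub>a\<close>, which is an identity plus a value of \<open>\<delta>\<close>.\<close>

lemma \<sigma>_\<sigma>: "a \<in> cells A n \<Longrightarrow> \<sigma> (Suc n) (\<sigma> n a) = idt A (Suc n) (\<sigma> n a)"
proof (induction n arbitrary: a)
  case 0
  then have "S 1 (\<sigma> 0 a) = \<sigma> 0 a"
    using \<sigma>_h[of a 0] by (simp add: S_Suc tgt_\<sigma>_0 \<sigma>_simps(1) h_closed)
  moreover have "\<delta> 1 (\<sigma> 0 a) = \<zero>\<^bsub>L (Suc (Suc 0))\<^esub>"
    using 0 by (simp add: \<sigma>_def \<delta>_simps(1,2) \<delta>_idt \<delta>_\<delta>)
  ultimately show ?case using 0 by (simp add: \<sigma>_def[of "Suc 0"] \<sigma>_simps(1))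
next
  case (Suc n)
  then have "S (Suc (Suc n)) (\<sigma> (Suc n) a) = \<sigma> (Suc n) a"
    using Suc.IH[of "src A n a"] by (simp add: S_Suc[of "Suc n"] tgt_\<sigma>_Suc \<sigma>_simps(1))
  moreover have "\<delta> (Suc (Suc n)) (\<sigma> (Suc n) a) = \<zero>\<^bsub>L (Suc (Suc (Suc n)))\<^esub>"
    using Suc.prems by (simp add: \<sigma>_def[of "Suc n"] \<delta>_simps(1,2) \<delta>_idt \<delta>_\<delta> S_simps(1))
  ultimately show ?case using Suc by (simp add: \<sigma>_def[of "Suc (Suc n)"] \<sigma>_simps(1))
qed

lemma left_whisker_\<sigma>:
  assumes a: "a \<in> cells A n"
  shows "k \<le> n \<Longrightarrow> left_whisker A \<sigma> n a k =
    a \<ominus>\<^bsub>L n\<^esub> lift A k n (ktgt A k n a) \<oplus>\<^bsub>L n\<^esub> lift A k n (S k (ktgt A k n a))"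
proof (induction k)
  interpret L: omega_algebra "L n" \<Omega> by (rule level_alg)
  { case 0
    show ?case using a by (simp add: L.group_simps)
  next
    note [simp del] = ksrc.simps ktgt.simps lift.simps
    case (Suc k)
    then have k: "k \<le> n" "k < n" "Suc k \<le> n" by auto
    define t where "t = ktgt A k n a"
    define x where "x = a \<ominus>\<^bsub>L n\<^esub> lift A k n t \<oplus>\<^bsub>L n\<^esub> lift A k n (S k t)"
    define y where "y = lift A (Suc k) n (\<sigma> k t)"
    define z where "z = ktgt A (Suc k) n a"
    have t: "t \<in> cells A k" and z: "z \<in> cells A (Suc k)" using a k by (simp_all add: t_def z_def)
    have tz: "tgt A k z = t" using ktgt_ktgt[of k "Suc k" n a] k by (simp add: t_def z_def ktgt_Suc)
    have cl: "S k t \<in> cells A k" "\<sigma> k t \<in> cells A (Suc k)" using t by (simp_all add: S_simps(1) \<sigma>_simps(1))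
    have x: "x \<in> cells A n" and y: "y \<in> cells A n" using a t cl k by (simp_all add: x_def y_def)
    have tx: "ktgt A k n x = S k t"
      using a t cl k by (simp add: x_def ktgt_simps t_def[symmetric] ktgt_lift)
    have "ksrc A k n y = S k t" using t cl k by (simp add: y_def ksrc_lift_low ksrc_Suc src_\<sigma>)
    then have "composable A n k x y" using x y tx k by (simp add: composable_def)
    then have c: "cmp A n k x y = x \<ominus>\<^bsub>L n\<^esub> lift A k n (S k t) \<oplus>\<^bsub>L n\<^esub> y"
      using cmp_formula tx by simp
    have li: "lift A (Suc k) n (idt A k t) = lift A k n t"
      using lift_lift[of k "Suc k" n t] k by (simp add: lift_Suc)
    have "lift A (Suc k) n (S (Suc k) z) = lift A (Suc k) n z \<ominus>\<^bsub>L n\<^esub> lift A k n t \<oplus>\<^bsub>L n\<^esub> y"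
      using z t cl k by (simp add: S_Suc tz lift_simps li y_def)
    then show ?case
      using Suc.IH[OF k(1)] c a t z cl y k unfolding left_whisker.simps t_def[symmetric] z_def[symmetric]
        x_def[symmetric] y_def[symmetric]
      by (simp add: x_def L.group_simps)
  }
qed

text \<open>The composite telescopes: in each step the cell composed so far is the target of the new factor,
  so the composition is with an identity.\<close>

lemma right_whisker_\<sigma>:
  assumes a: "a \<in> cells A n"
  shows "Suc k \<le> n \<Longrightarrow> right_whisker A \<sigma> n a (hat \<Omega> X \<iota> n a) (Suc k) = lift A (Suc k) n (\<sigma> k (ksrc A k n a))"
proof (induction k)
  note [simp del] = ksrc.simps ktgt.simps lift.simps
  case 0
  have s: "s0 n a \<in> cells A 0" using a by simp
  have "t0 n (lift A (Suc 0) n (\<sigma> 0 (s0 n a))) = h (s0 n a)"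
    using s 0 by (simp add: ktgt_lift_low ktgt_Suc \<sigma>_simps(1) tgt_\<sigma>_0)
  then show ?case using unit_right[of 0 n "lift A (Suc 0) n (\<sigma> 0 (s0 n a))"] 0 a s
    by (simp add: hat_eq[OF a] \<sigma>_simps(1))
next
  note [simp del] = ksrc.simps ktgt.simps lift.simps
  case (Suc k)
  let ?s = "ksrc A (Suc k) n a"
  have s: "?s \<in> cells A (Suc k)" using a Suc by simp
  have "src A k ?s = ksrc A k n a" using ksrc_ksrc[of k "Suc k" n a] Suc by (simp add: ksrc_Suc)
  then have "ktgt A (Suc k) n (lift A (Suc (Suc k)) n (\<sigma> (Suc k) ?s)) = \<sigma> k (ksrc A k n a)"
    using s Suc.prems by (simp add: ktgt_lift_low ktgt_Suc \<sigma>_simps(1) tgt_\<sigma>_Suc)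
  then show ?case using unit_right[of "Suc k" n "lift A (Suc (Suc k)) n (\<sigma> (Suc k) ?s)"] Suc s
    by (simp add: \<sigma>_simps(1) del: right_whisker.simps add: right_whisker.simps(2)[of A \<sigma> n a _ "Suc k"])
qed

lemma contraction_\<sigma>: "contraction \<Omega> X \<iota> \<sigma>"
  unfolding contraction_def Let_def
proof (intro conjI allI ballI)
  fix n
  show "linear_map (L n) (L (Suc n)) (\<sigma> n)" by (rule \<sigma>_linear)
  show "\<sigma> n (\<iota> n x) = idt A n (\<iota> n x)" if "x \<in> carrier (presented_alg \<Omega> X)" for x
    using iota_hat[OF that, of n] \<sigma>_h by auto
  fix a assume a: "a \<in> cells A n"
  show "src A n (\<sigma> n a) = left_whisker A \<sigma> n a n"
    using a left_whisker_\<sigma>[OF a order_refl] by (simp add: src_\<sigma> S_simps(1))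
  show "tgt A n (\<sigma> n a) = right_whisker A \<sigma> n a (hat \<Omega> X \<iota> n a) n"
  proof (cases n)
    case 0
    then show ?thesis using a tgt_\<sigma>_0 by simp
  next
    case (Suc m)
    then show ?thesis using a right_whisker_\<sigma>[OF a, of m] tgt_\<sigma>_Suc[of a m]
      by (simp add: ksrc_Suc del: right_whisker.simps)
  qed
  show "\<sigma> (Suc n) (idt A n a) = idt A (Suc n) (\<sigma> n a)" using a by (rule \<sigma>_idt)
  show "\<sigma> (Suc n) (\<sigma> n a) = idt A (Suc n) (\<sigma> n a)" using a by (rule \<sigma>_\<sigma>)
qed

text \<open>By \<open>cmp_formula\<close>, the right-hand side is the \<open>0\<close>-composite in the
  definition of a right contraction. It splits into the same identity for \<open>S\<close> and the product
  formula for \<open>\<delta>\<close>.\<close>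

lemma \<sigma>_mult_step:
  assumes f: "f \<in> cells A n" and g: "g \<in> cells A n"
    and S: "S n (f \<otimes>\<^bsub>L n\<^esub> g) =
      up n (s0 n f) \<otimes>\<^bsub>L n\<^esub> S n g \<ominus>\<^bsub>L n\<^esub>
      up n (s0 n f) \<otimes>\<^bsub>L n\<^esub> up n (h (s0 n g)) \<oplus>\<^bsub>L n\<^esub>
      S n (f \<otimes>\<^bsub>L n\<^esub> up n (h (s0 n g)))"
  shows "\<sigma> n (f \<otimes>\<^bsub>L n\<^esub> g) =
      up (Suc n) (s0 n f) \<otimes>\<^bsub>L (Suc n)\<^esub> \<sigma> n g \<ominus>\<^bsub>L (Suc n)\<^esub>
      up (Suc n) (s0 n f) \<otimes>\<^bsub>L (Suc n)\<^esub> up (Suc n) (h (s0 n g))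
      \<oplus>\<^bsub>L (Suc n)\<^esub> \<sigma> n (f \<otimes>\<^bsub>L n\<^esub> up n (h (s0 n g)))"
proof -
  interpret L: omega_algebra "L (Suc n)" \<Omega> by (rule level_alg)
  have cl: "s0 n f \<in> cells A 0" "h (s0 n g) \<in> cells A 0"
    using f g by (simp_all add: h_closed)
  then show ?thesis
    unfolding \<sigma>_def S \<delta>_mult[OF f g]
    using f g by (simp add: idt_simps S_simps(1) \<delta>_simps(1) L.group_simps)
qed

text \<open>Inserting the formula for \<open>\<sigma>\<close> at the targets into the recursion of
  \<open>S\<close>, the two sides differ by three products, each of which vanishes by
  \<open>peiffer\<close>.\<close>

lemma S_mult:
  "f \<in> cells A n \<Longrightarrow> g \<in> cells A n \<Longrightarrow> S n (f \<otimes>\<^bsub>L n\<^esub> g) =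
      up n (s0 n f) \<otimes>\<^bsub>L n\<^esub> S n g \<ominus>\<^bsub>L n\<^esub>
      up n (s0 n f) \<otimes>\<^bsub>L n\<^esub> up n (h (s0 n g)) \<oplus>\<^bsub>L n\<^esub>
      S n (f \<otimes>\<^bsub>L n\<^esub> up n (h (s0 n g)))"
proof (induction n arbitrary: f g)
  case 0
  then show ?case by (simp add: h_closed)
next
  case (Suc n)
  interpret L: omega_algebra "L (Suc n)" \<Omega> by (rule level_alg)
  note f = Suc.prems(1) and g = Suc.prems(2)
  define a where "a = up (Suc n) (s0 (Suc n) f)"
  define a' where "a' = up (Suc n) (s0 n (tgt A n f))"
  define b where "b = h (s0 (Suc n) g)"
  define B where "B = up (Suc n) b"
  define tf where "tf = idt A n (tgt A n f)"
  define t where "t = idt A n (tgt A n g)"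
  define s where "s = \<sigma> n (tgt A n g)"
  define r where "r = \<sigma> n (tgt A n f \<otimes>\<^bsub>L n\<^esub> up n b)"
  have b: "b \<in> cells A 0" using g by (simp add: b_def h_closed)
  have cl: "a \<in> cells A (Suc n)" "a' \<in> cells A (Suc n)" "B \<in> cells A (Suc n)" "tf \<in> cells A (Suc n)"
      "t \<in> cells A (Suc n)" "s \<in> cells A (Suc n)" "r \<in> cells A (Suc n)"
    using f g b by (simp_all add: a_def a'_def B_def tf_def t_def s_def r_def \<sigma>_simps(1))
  have b': "h (s0 n (tgt A n g)) = b" using h_ksrc_tgt[OF g] by (simp add: b_def)
  have r: "\<sigma> n (tgt A n f \<otimes>\<^bsub>L n\<^esub> tgt A n g) =
      a' \<otimes>\<^bsub>L (Suc n)\<^esub> s \<ominus>\<^bsub>L (Suc n)\<^esub> a' \<otimes>\<^bsub>L (Suc n)\<^esub> B \<oplus>\<^bsub>L (Suc n)\<^esub> r"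
    using \<sigma>_mult_step[OF _ _ Suc.IH[of "tgt A n f" "tgt A n g"]] f g
    unfolding b' a'_def s_def B_def r_def by simp
  \<comment> \<open>in each of the three products below, one factor has zero 0-source and the other zero 0-target\<close>
  have k: "s0 (Suc n) a = s0 (Suc n) f" "s0 (Suc n) a' = s0 n (tgt A n f)"
    "t0 (Suc n) B = b" "s0 (Suc n) tf = s0 n (tgt A n f)"
    "t0 (Suc n) tf = t0 (Suc n) f" "s0 (Suc n) t = s0 n (tgt A n g)"
    "s0 (Suc n) s = s0 n (tgt A n g)" "t0 (Suc n) s = b"
    "t0 (Suc n) t = t0 (Suc n) g"
    using f g b ksrc_\<sigma>[of "tgt A n g" n] ktgt_\<sigma>[of "tgt A n g" n]
    unfolding a_def a'_def B_def tf_def t_def s_def b'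
    by (simp_all add: ksrc_lift ktgt_lift src_idt tgt_idt)
  have ks: "s0 (Suc n) (f \<ominus>\<^bsub>L (Suc n)\<^esub> a) = \<zero>\<^bsub>L 0\<^esub>"
    "s0 (Suc n) (t \<ominus>\<^bsub>L (Suc n)\<^esub> s) = \<zero>\<^bsub>L 0\<^esub>"
    "s0 (Suc n) (a' \<ominus>\<^bsub>L (Suc n)\<^esub> tf) = \<zero>\<^bsub>L 0\<^esub>"
    "t0 (Suc n) (f \<ominus>\<^bsub>L (Suc n)\<^esub> tf) = \<zero>\<^bsub>L 0\<^esub>"
    "t0 (Suc n) (s \<ominus>\<^bsub>L (Suc n)\<^esub> B) = \<zero>\<^bsub>L 0\<^esub>"
    using f g b cl k by (simp_all add: ksrc_simps ktgt_simps del: ksrc.simps ktgt.simps)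
  have kt: "t0 (Suc n) (g \<ominus>\<^bsub>L (Suc n)\<^esub> t \<oplus>\<^bsub>L (Suc n)\<^esub> (s \<ominus>\<^bsub>L (Suc n)\<^esub> B)) = \<zero>\<^bsub>L 0\<^esub>"
    using f g b cl k ks(5) by (simp add: ktgt_simps del: ksrc.simps ktgt.simps)
  have p: "(f \<ominus>\<^bsub>L (Suc n)\<^esub> a) \<otimes>\<^bsub>L (Suc n)\<^esub>
      (g \<ominus>\<^bsub>L (Suc n)\<^esub> t \<oplus>\<^bsub>L (Suc n)\<^esub> (s \<ominus>\<^bsub>L (Suc n)\<^esub> B)) = \<zero>\<^bsub>L (Suc n)\<^esub>"
    "(f \<ominus>\<^bsub>L (Suc n)\<^esub> tf) \<otimes>\<^bsub>L (Suc n)\<^esub> (t \<ominus>\<^bsub>L (Suc n)\<^esub> s) = \<zero>\<^bsub>L (Suc n)\<^esub>"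
    "(a' \<ominus>\<^bsub>L (Suc n)\<^esub> tf) \<otimes>\<^bsub>L (Suc n)\<^esub> (s \<ominus>\<^bsub>L (Suc n)\<^esub> B) = \<zero>\<^bsub>L (Suc n)\<^esub>"
    using peiffer_zero(1)[OF _ _ ks(1) kt] peiffer_zero(2)[OF _ _ ks(2,4)] peiffer_zero(1)[OF _ _ ks(3,5)]
      f g cl by simp_all
  let ?L = "f \<otimes>\<^bsub>L (Suc n)\<^esub> g \<ominus>\<^bsub>L (Suc n)\<^esub> tf \<otimes>\<^bsub>L (Suc n)\<^esub> t \<oplus>\<^bsub>L (Suc n)\<^esub>
    (a' \<otimes>\<^bsub>L (Suc n)\<^esub> s \<ominus>\<^bsub>L (Suc n)\<^esub> a' \<otimes>\<^bsub>L (Suc n)\<^esub> B \<oplus>\<^bsub>L (Suc n)\<^esub> r)"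
  let ?R = "a \<otimes>\<^bsub>L (Suc n)\<^esub> (g \<ominus>\<^bsub>L (Suc n)\<^esub> t \<oplus>\<^bsub>L (Suc n)\<^esub> s) \<ominus>\<^bsub>L (Suc n)\<^esub>
    a \<otimes>\<^bsub>L (Suc n)\<^esub> B \<oplus>\<^bsub>L (Suc n)\<^esub>
    (f \<otimes>\<^bsub>L (Suc n)\<^esub> B \<ominus>\<^bsub>L (Suc n)\<^esub> tf \<otimes>\<^bsub>L (Suc n)\<^esub> B \<oplus>\<^bsub>L (Suc n)\<^esub> r)"
  have "?L = ?R \<oplus>\<^bsub>L (Suc n)\<^esub> ((f \<ominus>\<^bsub>L (Suc n)\<^esub> a) \<otimes>\<^bsub>L (Suc n)\<^esub>
      (g \<ominus>\<^bsub>L (Suc n)\<^esub> t \<oplus>\<^bsub>L (Suc n)\<^esub> (s \<ominus>\<^bsub>L (Suc n)\<^esub> B)) \<oplus>\<^bsub>L (Suc n)\<^esub>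
      (f \<ominus>\<^bsub>L (Suc n)\<^esub> tf) \<otimes>\<^bsub>L (Suc n)\<^esub> (t \<ominus>\<^bsub>L (Suc n)\<^esub> s) \<oplus>\<^bsub>L (Suc n)\<^esub>
      (a' \<ominus>\<^bsub>L (Suc n)\<^esub> tf) \<otimes>\<^bsub>L (Suc n)\<^esub> (s \<ominus>\<^bsub>L (Suc n)\<^esub> B))"
    using f g cl by (simp add: L.group_simps)
  then have LR: "?L = ?R" unfolding p using f g cl by simp
  have "S (Suc n) (f \<otimes>\<^bsub>L (Suc n)\<^esub> g) = ?L"
    using f g by (simp add: S_Suc tgt_simps idt_simps r tf_def t_def)
  moreover have "S (Suc n) (f \<otimes>\<^bsub>L (Suc n)\<^esub> B) =
      f \<otimes>\<^bsub>L (Suc n)\<^esub> B \<ominus>\<^bsub>L (Suc n)\<^esub> tf \<otimes>\<^bsub>L (Suc n)\<^esub> B \<oplus>\<^bsub>L (Suc n)\<^esub> r"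
    using f g b by (simp add: S_Suc tgt_simps idt_simps r_def tf_def B_def)
  moreover have "S (Suc n) g = g \<ominus>\<^bsub>L (Suc n)\<^esub> t \<oplus>\<^bsub>L (Suc n)\<^esub> s"
    by (simp add: S_Suc t_def s_def)
  ultimately show ?case
    using LR unfolding a_def[symmetric] b_def[symmetric] B_def[symmetric] by simp
qed

lemma right_contraction_\<sigma>: "right_contraction \<Omega> X \<iota> \<sigma>"
  unfolding right_contraction_def Let_def
proof (intro allI ballI)
  fix n f g assume f: "f \<in> cells A n" and g: "g \<in> cells A n"
  let ?x = "up (Suc n) (s0 n f) \<otimes>\<^bsub>L (Suc n)\<^esub> \<sigma> n g"
  let ?y = "\<sigma> n (f \<otimes>\<^bsub>L n\<^esub> up n (h (s0 n g)))"
  have b: "h (s0 n g) \<in> cells A 0" and a: "s0 n f \<in> cells A 0" using f g by (simp_all add: h_closed)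
  have x: "t0 (Suc n) ?x = s0 n f \<otimes>\<^bsub>L 0\<^esub> h (s0 n g)"
    using f g a by (simp add: ktgt_simps(5)[of 0 "Suc n"] \<sigma>_simps(1) ktgt_\<sigma> ktgt_lift del: ktgt.simps lift.simps)
  have y: "s0 (Suc n) ?y = s0 n f \<otimes>\<^bsub>L 0\<^esub> h (s0 n g)"
    using f g b by (simp add: ksrc_\<sigma> ksrc_simps(5) ksrc_lift del: ksrc.simps)
  have c: "composable A (Suc n) 0 ?x ?y"
    using f g a b x y by (simp add: composable_def \<sigma>_simps(1) del: ksrc.simps ktgt.simps lift.simps)
  show "\<sigma> n (f \<otimes>\<^bsub>L n\<^esub> g) = cmp A (Suc n) 0 ?x ?y"
    unfolding cmp_formula[OF c] x \<sigma>_mult_step[OF f g S_mult[OF f g]]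
    using a b by (simp add: lift_simps(5)[of 0 "Suc n"] del: lift.simps)
qed

lemma \<sigma>_oper_step:
  assumes f: "f \<in> cells A n" and v: "v \<in> cells A 0" and \<tau>: "\<tau> \<in> \<Omega>"
    and c: "c = oper (L 0) \<tau> (h (s0 n f)) \<otimes>\<^bsub>L 0\<^esub> v"
    and S: "S n (oper (L n) \<tau> f \<otimes>\<^bsub>L n\<^esub> up n v) =
      oper (L n) \<tau> (S n f) \<otimes>\<^bsub>L n\<^esub> up n v \<ominus>\<^bsub>L n\<^esub>
      up n c \<oplus>\<^bsub>L n\<^esub> S n (up n c)"
  shows "\<sigma> n (oper (L n) \<tau> f \<otimes>\<^bsub>L n\<^esub> up n v) =
      oper (L (Suc n)) \<tau> (\<sigma> n f) \<otimes>\<^bsub>L (Suc n)\<^esub> up (Suc n) v \<ominus>\<^bsub>L (Suc n)\<^esub>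
      up (Suc n) c \<oplus>\<^bsub>L (Suc n)\<^esub> \<sigma> n (up n c)"
proof -
  interpret L: omega_algebra "L (Suc n)" \<Omega> by (rule level_alg)
  have cl: "c \<in> cells A 0" unfolding c using f v \<tau> by (simp add: h_closed)
  show ?thesis
    unfolding \<sigma>_def S \<delta>_oper[OF f v \<tau>, folded c]
    using f v cl \<tau> by (simp add: idt_simps S_simps(1) \<delta>_simps(1) L.group_simps L.oper_add)
qed

lemma S_oper:
  "f \<in> cells A n \<Longrightarrow> v \<in> cells A 0 \<Longrightarrow> \<tau> \<in> \<Omega> \<Longrightarrow>
    c = oper (L 0) \<tau> (h (s0 n f)) \<otimes>\<^bsub>L 0\<^esub> v \<Longrightarrow>
    S n (oper (L n) \<tau> f \<otimes>\<^bsub>L n\<^esub> up n v) =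
      oper (L n) \<tau> (S n f) \<otimes>\<^bsub>L n\<^esub> up n v \<ominus>\<^bsub>L n\<^esub>
      up n c \<oplus>\<^bsub>L n\<^esub> S n (up n c)"
proof (induction n arbitrary: f)
  case 0
  then show ?case by (simp add: h_closed)
next
  case (Suc n)
  interpret L: omega_algebra "L (Suc n)" \<Omega> by (rule level_alg)
  note f = Suc.prems(1) and v = Suc.prems(2) and \<tau> = Suc.prems(3)
  have cl: "c \<in> cells A 0" unfolding Suc.prems(4) using f v \<tau> by (simp add: h_closed)
  have c: "c = oper (L 0) \<tau> (h (s0 n (tgt A n f))) \<otimes>\<^bsub>L 0\<^esub> v"
    using Suc.prems h_ksrc_tgt[OF f] by simp
  have tf: "tgt A n f \<in> cells A n" using f by simp
  have e: "S (Suc n) (up (Suc n) c) = \<sigma> n (up n c)"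
    using cl by (simp add: S_Suc tgt_idt \<sigma>_simps(1))
  have "S (Suc n) (oper (L (Suc n)) \<tau> f \<otimes>\<^bsub>L (Suc n)\<^esub> up (Suc n) v) =
      oper (L (Suc n)) \<tau> f \<otimes>\<^bsub>L (Suc n)\<^esub> up (Suc n) v \<ominus>\<^bsub>L (Suc n)\<^esub>
      oper (L (Suc n)) \<tau> (idt A n (tgt A n f)) \<otimes>\<^bsub>L (Suc n)\<^esub> up (Suc n) v \<oplus>\<^bsub>L (Suc n)\<^esub>
      \<sigma> n (oper (L n) \<tau> (tgt A n f) \<otimes>\<^bsub>L n\<^esub> up n v)"
    using f v \<tau> by (simp add: S_Suc tgt_simps idt_simps)
  then show ?case
    unfolding e \<sigma>_oper_step[OF tf v \<tau> c Suc.IH[OF tf v \<tau> c]]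
    using f v cl \<tau> by (simp add: S_Suc \<sigma>_simps(1) L.group_simps L.oper_add L.oper_diff)
qed

lemma bracketed_contraction_\<sigma>: "bracketed_contraction \<Omega> X \<iota> \<sigma>"
  unfolding bracketed_contraction_def Let_def
proof (intro allI ballI)
  fix n f u \<tau> assume f: "f \<in> cells A n" and u: "u \<in> M" and \<tau>: "\<tau> \<in> \<Omega>"
  define v where "v = (mon_cell u :: ('z, 'o, 'k, 'x) cell)"
  define c where "c = oper (L 0) \<tau> (h (s0 n f)) \<otimes>\<^bsub>L 0\<^esub> v"
  have v: "v \<in> cells A 0" using u by (simp add: v_def mon_cell_0)
  have cl: "c \<in> cells A 0" unfolding c_def using f v \<tau> by (simp add: h_closed)
  let ?x = "oper (L (Suc n)) \<tau> (\<sigma> n f) \<otimes>\<^bsub>L (Suc n)\<^esub> up (Suc n) v"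
  let ?y = "lift A 1 (Suc n) (\<sigma> 0 c)"
  have x: "t0 (Suc n) ?x = c"
    using f v \<tau> by (simp add: ktgt_simps(5,6)[of 0 "Suc n"] \<sigma>_simps(1) ktgt_\<sigma> ktgt_lift c_def del: ktgt.simps lift.simps)
  have y: "s0 (Suc n) ?y = c"
    using cl ksrc_lift_low[of 0 1 "Suc n" "\<sigma> 0 c"] by (simp add: \<sigma>_simps(1) src_\<sigma> del: lift.simps)
  have co: "composable A (Suc n) 0 ?x ?y"
    using f v cl \<tau> x y by (simp add: composable_def \<sigma>_simps(1) del: ksrc.simps ktgt.simps lift.simps)
  show "\<sigma> n (oper (L n) \<tau> f \<otimes>\<^bsub>L n\<^esub> up n (mon_cell u)) =
    cmp A (Suc n) 0 (oper (L (Suc n)) \<tau> (\<sigma> n f) \<otimes>\<^bsub>L (Suc n)\<^esub> up (Suc n) (mon_cell u))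
      (lift A 1 (Suc n) (\<sigma> 0 (oper (L 0) \<tau> (h (s0 n f)) \<otimes>\<^bsub>L 0\<^esub> mon_cell u)))"
    unfolding v_def[symmetric] c_def[symmetric] cmp_formula[OF co] x
      \<sigma>_oper_step[OF f v \<tau> c_def S_oper[OF f v \<tau> c_def]] \<sigma>_lift[OF cl] ..
qed

end

section \<open>The homotopy on zero-cells\<close>

text \<open>The recursor for words, peeling off one letter at a time. For a letter that is a bracket it
  recurses both into the bracketed word and into the rest.\<close>

fun word_rec :: "'b \<Rightarrow> ('z \<Rightarrow> ('z, 'o) omon \<Rightarrow> 'b \<Rightarrow> 'b) \<Rightarrow>
    ('o \<Rightarrow> ('z, 'o) omon \<Rightarrow> ('z, 'o) omon \<Rightarrow> 'b \<Rightarrow> 'b \<Rightarrow> 'b) \<Rightarrow> ('z, 'o) omon \<Rightarrow> 'b" where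
  "word_rec e f g (Word []) = e"
| "word_rec e f g (Word (Var z # w)) = f z (Word w) (word_rec e f g (Word w))"
| "word_rec e f g (Word (Br \<tau> u # w)) = g \<tau> u (Word w) (word_rec e f g u) (word_rec e f g (Word w))"

lemma word_rec_plus:
  "word_rec e f g 0 = e"
  "word_rec e f g (Word [Var z] + w) = f z w (word_rec e f g w)"
  "word_rec e f g (bracket \<tau> u + w) = g \<tau> u w (word_rec e f g u) (word_rec e f g w)"
  by (cases w; simp add: zero_omon_def plus_omon_def bracket_def)+

lemma free_omon_induct [consumes 1, case_names one var bracket]:
  assumes u: "u \<in> free_omon Z \<Omega>" and one: "P 0"
    and var: "\<And>z w. z \<in> Z \<Longrightarrow> w \<in> free_omon Z \<Omega> \<Longrightarrow> P w \<Longrightarrow> P (Word [Var z] + w)"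
    and br: "\<And>\<tau> u w. \<tau> \<in> \<Omega> \<Longrightarrow> u \<in> free_omon Z \<Omega> \<Longrightarrow> w \<in> free_omon Z \<Omega> \<Longrightarrow> P u \<Longrightarrow> P w \<Longrightarrow>
      P (bracket \<tau> u + w)"
  shows "P u"
  using u
proof (induction "()" "\<lambda>(_::'a) (_::('a, 'b) omon) (_::unit). ()"
    "\<lambda>(_::'b) (_::('a, 'b) omon) (_::('a, 'b) omon) (_::unit) (_::unit). ()" u rule: word_rec.induct)
  case 1
  then show ?case using one by (simp add: zero_omon_def)
next
  case (2 z w)
  then have "z \<in> Z" "Word w \<in> free_omon Z \<Omega>" by (auto simp: Word_in_free_omon)
  with 2 var[of z "Word w"] show ?case by (simp add: plus_omon_def)
next
  case (3 \<tau> u w)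
  then have "\<tau> \<in> \<Omega>" "u \<in> free_omon Z \<Omega>" "Word w \<in> free_omon Z \<Omega>" by (auto simp: Word_in_free_omon)
  with 3 br[of \<tau> u "Word w"] show ?case by (simp add: plus_omon_def bracket_def)
qed

context polygraph
begin

lemma cell_0_induct [consumes 1, case_names mon add smult]:
  assumes "c \<in> cells A 0"
    and "\<And>u. u \<in> M \<Longrightarrow> P (mon_cell u)"
    and "\<And>a b. a \<in> cells A 0 \<Longrightarrow> b \<in> cells A 0 \<Longrightarrow> P a \<Longrightarrow> P b \<Longrightarrow> P (a \<oplus>\<^bsub>L 0\<^esub> b)"
    and "\<And>r a. a \<in> cells A 0 \<Longrightarrow> P a \<Longrightarrow> P (r \<odot>\<^bsub>L 0\<^esub> a)"
  shows "P c"
  using assms unfolding level_0 by (rule zero_cell_induct)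

lemma mon_cell_ops:
  "mon_cell (u + v) = mon_cell u \<otimes>\<^bsub>L 0\<^esub> mon_cell v"
  "mon_cell (bracket \<tau> u) = oper (L 0) \<tau> (mon_cell u)"
  "mon_cell 0 = \<one>\<^bsub>L 0\<^esub>"
  unfolding level_0 by (simp_all add: mon_cell_mult mon_cell_oper mon_cell_zero)

text \<open>The targets of the \<open>1\<close>-cells with source \<open>0\<close> form an ideal closed
  under the operators, and it contains \<open>s(y) - t(y)\<close> as the target of
  \<open>1\<^bsub>s(y)\<^esub> - y\<close> for each generating \<open>1\<close>-cell
  \<open>y\<close>.\<close>

lemma I_boundary:
  assumes "i \<in> I"
  obtains y where "y \<in> cells A (Suc 0)" "src A 0 y = \<zero>\<^bsub>L 0\<^esub>" "tgt A 0 y = i"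
proof -
  interpret L1: omega_algebra "L (Suc 0)" \<Omega> by (rule level_alg)
  define J where "J = {tgt A 0 y | y. y \<in> cells A (Suc 0) \<and> src A 0 y = \<zero>\<^bsub>L 0\<^esub>}"
  have JI: "tgt A 0 y \<in> J" if "y \<in> cells A (Suc 0)" "src A 0 y = \<zero>\<^bsub>L 0\<^esub>" for y
    using that by (auto simp: J_def)
  have "omega_ideal \<Omega> (L 0) J"
    unfolding omega_ideal_def
  proof (intro conjI allI ballI)
    show "ideal J (L 0)"
    proof (rule idealI)
      show "ring (L 0)" by (rule L0.ring_axioms)
      show "subgroup J (add_monoid (L 0))"
      proof (rule subgroup.intro; simp?)
        show "J \<subseteq> cells A 0" by (auto simp: J_def)
        show "\<zero>\<^bsub>L 0\<^esub> \<in> J" using JI[of "\<zero>\<^bsub>L (Suc 0)\<^esub>"] by (simp add: src_simps tgt_simps)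
        fix a b assume "a \<in> J" "b \<in> J"
        then obtain x y where xy: "x \<in> cells A (Suc 0)" "y \<in> cells A (Suc 0)" "a = tgt A 0 x" "b = tgt A 0 y"
          "src A 0 x = \<zero>\<^bsub>L 0\<^esub>" "src A 0 y = \<zero>\<^bsub>L 0\<^esub>" by (auto simp: J_def)
        then show "a \<oplus>\<^bsub>L 0\<^esub> b \<in> J"
          using JI[of "x \<oplus>\<^bsub>L (Suc 0)\<^esub> y"] by (simp add: src_simps tgt_simps)
      next
        fix a assume "a \<in> J"
        then obtain x where x: "x \<in> cells A (Suc 0)" "a = tgt A 0 x" "src A 0 x = \<zero>\<^bsub>L 0\<^esub>"
          by (auto simp: J_def)
        then show "inv\<^bsub>add_monoid (L 0)\<^esub> a \<in> J"
          using JI[of "(- 1) \<odot>\<^bsub>L (Suc 0)\<^esub> x"]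
          by (simp add: src_simps tgt_simps L0.smult_zero_right L0.a_inv_eq_smult a_inv_def[symmetric])
      qed
      fix a c assume "a \<in> J" and c: "c \<in> cells A 0"
      then obtain x where x: "x \<in> cells A (Suc 0)" "a = tgt A 0 x" "src A 0 x = \<zero>\<^bsub>L 0\<^esub>"
        by (auto simp: J_def)
      show "c \<otimes>\<^bsub>L 0\<^esub> a \<in> J"
        using JI[of "idt A 0 c \<otimes>\<^bsub>L (Suc 0)\<^esub> x"] x c by (simp add: src_simps tgt_simps)
      show "a \<otimes>\<^bsub>L 0\<^esub> c \<in> J"
        using JI[of "x \<otimes>\<^bsub>L (Suc 0)\<^esub> idt A 0 c"] x c by (simp add: src_simps tgt_simps)
    qed
    fix a assume "a \<in> J"
    then obtain x where x: "x \<in> cells A (Suc 0)" "a = tgt A 0 x" "src A 0 x = \<zero>\<^bsub>L 0\<^esub>"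
      by (auto simp: J_def)
    show "c \<odot>\<^bsub>L 0\<^esub> a \<in> J" for c
      using JI[of "c \<odot>\<^bsub>L (Suc 0)\<^esub> x"] x by (simp add: src_simps tgt_simps L0.smult_zero_right)
    show "oper (L 0) \<tau> a \<in> J" if "\<tau> \<in> \<Omega>" for \<tau>
      using JI[of "oper (L (Suc 0)) \<tau> x"] x that by (simp add: src_simps tgt_simps L0.oper_zero)
  qed
  moreover have "gsrc X 1 y \<ominus>\<^bsub>L 0\<^esub> gtgt X 1 y \<in> J" if "y \<in> gens X 1" for y
  proof -
    have y: "y \<in> gens X (Suc 0)" using that by simp
    show ?thesis
      using JI[of "idt A 0 (gsrc X 1 y) \<ominus>\<^bsub>L (Suc 0)\<^esub> gen_cell 0 y"] gen_cell[OF y] gen_boundary[OF y]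
      by (simp add: src_simps tgt_simps)
  qed
  ultimately have "I \<subseteq> J" by (rule rel_ideal_least)
  with assms have "i \<in> J" by blast
  then show thesis using that by (auto simp: J_def)
qed

end

context polygraph_section
begin

lemma h_mult_right: "a \<in> cells A 0 \<Longrightarrow> b \<in> cells A 0 \<Longrightarrow> h (a \<otimes>\<^bsub>L 0\<^esub> h b) = h (a \<otimes>\<^bsub>L 0\<^esub> b)"
  by (rule h_eq) (auto intro!: diff_mult_I h_diff_I simp: h_closed I.zero_closed)

lemma h_oper_mult:
  assumes "a \<in> cells A 0" "b \<in> cells A 0" "\<tau> \<in> \<Omega>"
  shows "h (oper (L 0) \<tau> (h a) \<otimes>\<^bsub>L 0\<^esub> b) = h (oper (L 0) \<tau> a \<otimes>\<^bsub>L 0\<^esub> b)"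
proof -
  have "oper (L 0) \<tau> (h a) \<ominus>\<^bsub>L 0\<^esub> oper (L 0) \<tau> a \<in> I"
    using oper_I[OF h_diff_I[OF assms(1)] assms(3)] assms by (simp add: L0.oper_diff h_closed)
  then show ?thesis using assms
    by (intro h_eq diff_mult_I) (auto simp: h_closed I.zero_closed)
qed

lemmas h_simps = linear_mapD(2,3)[OF h_linear] linear_map_minus(2,3)[OF h_linear L0.omega_algebra_axioms L0.omega_algebra_axioms]

text \<open>What the extension to dimension \<open>n + 1\<close> needs to know about \<open>\<delta>\<close>
  in dimension \<open>n\<close>, uniformly in \<open>n\<close>. The third condition makes the prescribed
  boundary of the next homotopy a cycle. The fifth makes that boundary vanish on the values of
  \<open>d\<close>, whence \<open>\<delta> \<delta> = 0\<close>.\<close>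

definition good :: "nat \<Rightarrow> (('z, 'o, 'k, 'x) cell \<Rightarrow> ('z, 'o, 'k, 'x) cell) \<Rightarrow> bool" where
  "good n d \<longleftrightarrow> linear_map (L n) (L (Suc n)) d \<and>
    (\<forall>a\<in>cells A n. src A n (d a) = \<zero>\<^bsub>L n\<^esub>) \<and>
    (\<forall>a\<in>cells A (Suc n). tgt A n (d (src A n a \<ominus>\<^bsub>L n\<^esub> tgt A n a)) = tgt A n a \<ominus>\<^bsub>L n\<^esub> src A n a) \<and>
    (n = 0 \<longrightarrow> (\<forall>a\<in>cells A 0. tgt A 0 (d a) = h a \<ominus>\<^bsub>L 0\<^esub> a)) \<and>
    (\<forall>a\<in>cells A n. d (tgt A n (d a)) \<oplus>\<^bsub>L (Suc n)\<^esub> d a = \<zero>\<^bsub>L (Suc n)\<^esub>) \<and>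
    (\<forall>f\<in>cells A n. \<forall>g\<in>cells A n. d (f \<otimes>\<^bsub>L n\<^esub> g) =
      up (Suc n) (s0 n f) \<otimes>\<^bsub>L (Suc n)\<^esub> d g \<oplus>\<^bsub>L (Suc n)\<^esub>
      d (f \<otimes>\<^bsub>L n\<^esub> up n (h (s0 n g)))) \<and>
    (\<forall>f\<in>cells A n. \<forall>v\<in>cells A 0. \<forall>\<tau>\<in>\<Omega>. d (oper (L n) \<tau> f \<otimes>\<^bsub>L n\<^esub> up n v) =
      oper (L (Suc n)) \<tau> (d f) \<otimes>\<^bsub>L (Suc n)\<^esub> up (Suc n) v \<oplus>\<^bsub>L (Suc n)\<^esub>
      d (up n (oper (L 0) \<tau> (h (s0 n f)) \<otimes>\<^bsub>L 0\<^esub> v)))"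

text \<open>Choose \<open>1\<close>-cells \<open>\<kappa> u : 0 \<rightarrow> hat u - u\<close> for
  monomials and extend linearly. The map \<open>d\<close> rewrites a word from the right: \<open>d(z c) = z
  d(c) + \<kappa>(z hat c)\<close> for a variable \<open>z\<close>, and for a bracket \<open>d([b] c) = [d
  b] c + [hat b] d(c) + \<kappa>([hat b] hat c)\<close>. On the ideal of relations \<open>hat\<close> is
  \<open>0\<close>, so the terms with \<open>\<kappa>\<close> disappear and \<open>d\<close> is linear over
  left multiplication and brackets there.\<close>

lemma zero_homotopy_unnormalised:
  obtains d where "linear_map (L 0) (L (Suc 0)) d"
    and "\<And>c. c \<in> cells A 0 \<Longrightarrow> src A 0 (d c) = \<zero>\<^bsub>L 0\<^esub>"
    and "\<And>c. c \<in> cells A 0 \<Longrightarrow> tgt A 0 (d c) = h c \<ominus>\<^bsub>L 0\<^esub> c"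
    and "\<And>c i. c \<in> cells A 0 \<Longrightarrow> i \<in> I \<Longrightarrow>
      d (c \<otimes>\<^bsub>L 0\<^esub> i) = idt A 0 c \<otimes>\<^bsub>L (Suc 0)\<^esub> d i"
    and "\<And>\<tau> i v. \<tau> \<in> \<Omega> \<Longrightarrow> i \<in> I \<Longrightarrow> v \<in> cells A 0 \<Longrightarrow>
      d (oper (L 0) \<tau> i \<otimes>\<^bsub>L 0\<^esub> v) = oper (L (Suc 0)) \<tau> (d i) \<otimes>\<^bsub>L (Suc 0)\<^esub> idt A 0 v"
proof -
  interpret L1: omega_algebra "L (Suc 0)" \<Omega> by (rule level_alg)
  let ?m = "mon_cell :: ('z, 'o) omon \<Rightarrow> ('z, 'o, 'k, 'x) cell"
  note mon_simps = mon_cell_ops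
  have ext: "\<exists>f. linear_map (L 0) (L (Suc 0)) f \<and> (\<forall>u\<in>M. f (?m u) = e u)"
    if e: "\<And>u. u \<in> M \<Longrightarrow> e u \<in> cells A (Suc 0)" for e
  proof -
    obtain f where "linear_map (L 0) (L (Suc 0)) f" "\<And>u. u \<in> M \<Longrightarrow> f (?m u) = e u"
      unfolding level_0 using linear_extension[where Z = "gens0 X" and e = e, OF L1.omega_algebra_axioms e] by auto
    then show ?thesis by blast
  qed
  have "\<exists>y\<in>cells A (Suc 0). src A 0 y = \<zero>\<^bsub>L 0\<^esub> \<and> tgt A 0 y = h (?m u) \<ominus>\<^bsub>L 0\<^esub> ?m u"
    if "u \<in> M" for u
    using I_boundary[OF h_diff_I[of "?m u"]] that by (metis mon_cell_0)
  then obtain k where k: "\<And>u. u \<in> M \<Longrightarrow> k u \<in> cells A (Suc 0)"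
    "\<And>u. u \<in> M \<Longrightarrow> src A 0 (k u) = \<zero>\<^bsub>L 0\<^esub>" "\<And>u. u \<in> M \<Longrightarrow> tgt A 0 (k u) = h (?m u) \<ominus>\<^bsub>L 0\<^esub> ?m u"
    by metis
  obtain \<kappa> where \<kappa>: "linear_map (L 0) (L (Suc 0)) \<kappa>" and \<kappa>k: "\<And>u. u \<in> M \<Longrightarrow> \<kappa> (?m u) = k u"
    using ext[of k] k(1) by blast
  note \<kappa>_simps = linear_mapD[OF \<kappa>] linear_map_minus[OF \<kappa> L0.omega_algebra_axioms L1.omega_algebra_axioms]
  have \<kappa>_src: "src A 0 (\<kappa> c) = \<zero>\<^bsub>L 0\<^esub>" if "c \<in> cells A 0" for c
    using that by (induction rule: cell_0_induct) (simp_all add: \<kappa>k k \<kappa>_simps src_simps L0.smult_zero_right)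
  have \<kappa>_tgt: "tgt A 0 (\<kappa> c) = h c \<ominus>\<^bsub>L 0\<^esub> c" if "c \<in> cells A 0" for c
    using that by (induction rule: cell_0_induct)
      (simp_all add: \<kappa>k k \<kappa>_simps tgt_simps h_simps L0.smult_diff h_closed L0.add_diff_diff)
  define dm where "dm = word_rec \<zero>\<^bsub>L (Suc 0)\<^esub>
    (\<lambda>z w r. idt A 0 (?m (Word [Var z])) \<otimes>\<^bsub>L (Suc 0)\<^esub> r \<oplus>\<^bsub>L (Suc 0)\<^esub>
       \<kappa> (?m (Word [Var z]) \<otimes>\<^bsub>L 0\<^esub> h (?m w)))
    (\<lambda>\<tau> u w p q. oper (L (Suc 0)) \<tau> p \<otimes>\<^bsub>L (Suc 0)\<^esub> idt A 0 (?m w) \<oplus>\<^bsub>L (Suc 0)\<^esub>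
       idt A 0 (oper (L 0) \<tau> (h (?m u))) \<otimes>\<^bsub>L (Suc 0)\<^esub> q \<oplus>\<^bsub>L (Suc 0)\<^esub>
       \<kappa> (oper (L 0) \<tau> (h (?m u)) \<otimes>\<^bsub>L 0\<^esub> h (?m w)))"
  have var: "Word [Var z] \<in> M" if "z \<in> gens0 X" for z using that by (simp add: Word_in_free_omon)
  have dm_closed: "dm u \<in> cells A (Suc 0)" if "u \<in> M" for u
    using that unfolding dm_def
    by (induction rule: free_omon_induct) (simp_all add: word_rec_plus mon_cell_0 var h_closed \<kappa>_simps(1))
  obtain d where d: "linear_map (L 0) (L (Suc 0)) d" and dm: "\<And>u. u \<in> M \<Longrightarrow> d (?m u) = dm u"
    using ext[of dm] dm_closed by blast
  note d_simps = linear_mapD[OF d] linear_map_minus[OF d L0.omega_algebra_axioms L1.omega_algebra_axioms]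
  have d_one: "d \<one>\<^bsub>L 0\<^esub> = \<zero>\<^bsub>L (Suc 0)\<^esub>"
    using dm[OF free_omon_zero] by (simp add: mon_simps dm_def word_rec_plus)
  have d_var: "d (?m (Word [Var z]) \<otimes>\<^bsub>L 0\<^esub> c) = idt A 0 (?m (Word [Var z])) \<otimes>\<^bsub>L (Suc 0)\<^esub> d c
      \<oplus>\<^bsub>L (Suc 0)\<^esub> \<kappa> (?m (Word [Var z]) \<otimes>\<^bsub>L 0\<^esub> h c)"
    if z: "z \<in> gens0 X" and c: "c \<in> cells A 0" for z c
    using c
  proof (induction rule: cell_0_induct)
    case (mon w)
    then have "Word [Var z] + w \<in> M" using var[OF z] by (rule free_omon_add[rotated])
    from dm[OF this] dm[OF mon] show ?case by (simp add: mon_simps dm_def word_rec_plus)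
  qed (use var[OF z] in \<open>simp_all add: mon_cell_0 d_simps \<kappa>_simps h_simps h_closed L0.smult_mult_r
    L1.smult_mult_r L1.smult_r_distr L0.r_distr L1.r_distr L1.a_ac\<close>)
  have d_br: "d (oper (L 0) \<tau> b \<otimes>\<^bsub>L 0\<^esub> c) =
      oper (L (Suc 0)) \<tau> (d b) \<otimes>\<^bsub>L (Suc 0)\<^esub> idt A 0 c \<oplus>\<^bsub>L (Suc 0)\<^esub>
      idt A 0 (oper (L 0) \<tau> (h b)) \<otimes>\<^bsub>L (Suc 0)\<^esub> d c \<oplus>\<^bsub>L (Suc 0)\<^esub>
      \<kappa> (oper (L 0) \<tau> (h b) \<otimes>\<^bsub>L 0\<^esub> h c)"
    if \<tau>: "\<tau> \<in> \<Omega>" and b: "b \<in> cells A 0" and c: "c \<in> cells A 0" for \<tau> b c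
    using b
  proof (induction rule: cell_0_induct)
    case (mon u)
    show ?case using c
    proof (induction rule: cell_0_induct)
      case (mon w)
      have "bracket \<tau> u + w \<in> M"
        using \<open>u \<in> M\<close> mon \<tau> by (intro free_omon_add free_omon_bracket)
      from dm[OF this] dm[OF mon] dm[OF \<open>u \<in> M\<close>] show ?case by (simp add: mon_simps dm_def word_rec_plus)
    qed (use \<open>u \<in> M\<close> \<tau> in \<open>simp_all add: mon_cell_0 d_simps \<kappa>_simps h_simps h_closed idt_simps L0.smult_mult_r
      L1.smult_mult_r L1.smult_r_distr L0.r_distr L1.r_distr L1.a_ac\<close>)
  qed (use c \<tau> in \<open>simp_all add: d_simps \<kappa>_simps h_simps h_closed idt_simps L0.smult_mult_l L0.oper_add L1.oper_add
    L0.oper_smult L1.oper_smult L1.smult_mult_l L1.smult_r_distr L0.l_distr L1.l_distr L1.a_ac\<close>)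
  have d_src: "src A 0 (d c) = \<zero>\<^bsub>L 0\<^esub>" if "c \<in> cells A 0" for c
    using that
  proof (induction rule: cell_0_induct)
    case (mon u)
    then show ?case
    proof (induction rule: free_omon_induct)
      case one
      then show ?case by (simp add: mon_simps d_one src_simps)
    next
      case (var z w)
      then show ?case
        by (simp add: mon_simps d_var d_simps(1) src_simps \<kappa>_src \<kappa>_simps(1) mon_cell_0 h_closed \<open>z \<in> gens0 X \<Longrightarrow> Word [Var z] \<in> M\<close>)
    next
      case (bracket \<tau> u w)
      then show ?case
        by (simp add: mon_simps d_br d_simps(1) src_simps \<kappa>_src \<kappa>_simps(1) mon_cell_0 h_closed L0.oper_zero)
    qed
  qed (simp_all add: d_simps src_simps L0.smult_zero_right)
  have d_tgt: "tgt A 0 (d c) = h c \<ominus>\<^bsub>L 0\<^esub> c" if "c \<in> cells A 0" for c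
    using that
  proof (induction rule: cell_0_induct)
    case (mon u)
    then show ?case
    proof (induction rule: free_omon_induct)
      case one
      then show ?case by (simp add: mon_simps d_one tgt_simps h_one)
    next
      case (var z w)
      have zw: "?m (Word [Var z]) \<in> cells A 0" "?m w \<in> cells A 0"
        using var.hyps by (simp_all add: mon_cell_0 Word_in_free_omon)
      then have "tgt A 0 (d (?m (Word [Var z] + w))) = ?m (Word [Var z]) \<otimes>\<^bsub>L 0\<^esub> tgt A 0 (d (?m w)) \<oplus>\<^bsub>L 0\<^esub>
          (h (?m (Word [Var z]) \<otimes>\<^bsub>L 0\<^esub> ?m w) \<ominus>\<^bsub>L 0\<^esub> ?m (Word [Var z]) \<otimes>\<^bsub>L 0\<^esub> h (?m w))"
        using var.hyps by (simp add: mon_simps d_var d_simps(1) tgt_simps \<kappa>_tgt \<kappa>_simps(1) h_closed h_mult_right)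
      then show ?case unfolding var.IH using zw by (simp add: mon_simps h_closed L0.group_simps)
    next
      case (bracket \<tau> u w)
      have uw: "?m u \<in> cells A 0" "?m w \<in> cells A 0" using bracket.hyps by (simp_all add: mon_cell_0)
      then have "h (oper (L 0) \<tau> (h (?m u)) \<otimes>\<^bsub>L 0\<^esub> h (?m w)) = h (oper (L 0) \<tau> (?m u) \<otimes>\<^bsub>L 0\<^esub> ?m w)"
        using bracket.hyps by (simp add: h_mult_right h_oper_mult h_closed)
      then have "tgt A 0 (d (?m (bracket \<tau> u + w))) = oper (L 0) \<tau> (tgt A 0 (d (?m u))) \<otimes>\<^bsub>L 0\<^esub> ?m w \<oplus>\<^bsub>L 0\<^esub>
          oper (L 0) \<tau> (h (?m u)) \<otimes>\<^bsub>L 0\<^esub> tgt A 0 (d (?m w)) \<oplus>\<^bsub>L 0\<^esub>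
          (h (oper (L 0) \<tau> (?m u) \<otimes>\<^bsub>L 0\<^esub> ?m w) \<ominus>\<^bsub>L 0\<^esub> oper (L 0) \<tau> (h (?m u)) \<otimes>\<^bsub>L 0\<^esub> h (?m w))"
        using bracket.hyps uw by (simp add: mon_simps d_br d_simps(1) tgt_simps \<kappa>_tgt \<kappa>_simps(1) h_closed)
      then show ?case unfolding bracket.IH using bracket.hyps uw
        by (simp add: mon_simps h_closed L0.oper_diff L0.group_simps)
    qed
  qed (simp_all add: d_simps tgt_simps h_simps L0.smult_diff h_closed L0.add_diff_diff)
  have d_left: "d (c \<otimes>\<^bsub>L 0\<^esub> i) = idt A 0 c \<otimes>\<^bsub>L (Suc 0)\<^esub> d i" if c: "c \<in> cells A 0" and i: "i \<in> I" for c i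
  proof -
    have ic: "i \<in> cells A 0" using i by (rule I.Icarr)
    show ?thesis using c
    proof (induction rule: cell_0_induct)
      case (mon u)
      then show ?case
      proof (induction rule: free_omon_induct)
        case one
        then show ?case using ic by (simp add: mon_simps idt_simps d_simps(1))
      next
        case (var z w)
        have "h (?m w \<otimes>\<^bsub>L 0\<^esub> i) = \<zero>\<^bsub>L 0\<^esub>" using var i by (intro h_I I.I_l_closed) (simp_all add: mon_cell_0)
        then show ?case using var ic
          by (simp add: mon_simps d_var d_simps(1) \<kappa>_simps(4) mon_cell_0 idt_simps L0.m_assoc L1.m_assoc
             \<open>z \<in> gens0 X \<Longrightarrow> Word [Var z] \<in> M\<close>)
      next
        case (bracket \<tau> u w)
        define j where "j = ?m w \<otimes>\<^bsub>L 0\<^esub> i"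
        define y where "y = d j"
        define p where "p = oper (L (Suc 0)) \<tau> (d (?m u))"
        define a b where "a = idt A 0 (oper (L 0) \<tau> (?m u))" and "b = idt A 0 (oper (L 0) \<tau> (h (?m u)))"
        have j: "j \<in> I" "j \<in> cells A 0" using bracket i ic I.I_l_closed by (simp_all add: j_def mon_cell_0)
        have cl: "y \<in> cells A (Suc 0)" "p \<in> cells A (Suc 0)" "a \<in> cells A (Suc 0)" "b \<in> cells A (Suc 0)"
          using bracket j by (simp_all add: y_def p_def a_def b_def d_simps(1) mon_cell_0 h_closed)
        \<comment> \<open>as \<open>d j\<close> is a cell \<open>0 \<rightarrow> - j\<close> for \<open>j\<close> in the ideal, its sum with the identity of \<open>j\<close> has target 0\<close>
        have p1: "p \<otimes>\<^bsub>L (Suc 0)\<^esub> (y \<oplus>\<^bsub>L (Suc 0)\<^esub> idt A 0 j) = \<zero>\<^bsub>L (Suc 0)\<^esub>"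
          using bracket j cl
          by (intro peiffer_zero)
            (simp_all add: y_def p_def src_simps tgt_simps d_simps(1) d_src d_tgt mon_cell_0 L0.oper_zero h_I L0.group_simps)
        have p2: "(p \<ominus>\<^bsub>L (Suc 0)\<^esub> (b \<ominus>\<^bsub>L (Suc 0)\<^esub> a)) \<otimes>\<^bsub>L (Suc 0)\<^esub> y = \<zero>\<^bsub>L (Suc 0)\<^esub>"
          using bracket j cl
          by (intro peiffer_zero(2))
            (simp_all add: y_def p_def a_def b_def src_simps tgt_simps d_simps(1) d_src d_tgt mon_cell_0 h_closed L0.oper_diff)
        have "p \<otimes>\<^bsub>L (Suc 0)\<^esub> idt A 0 j \<oplus>\<^bsub>L (Suc 0)\<^esub> b \<otimes>\<^bsub>L (Suc 0)\<^esub> y =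
            p \<otimes>\<^bsub>L (Suc 0)\<^esub> (y \<oplus>\<^bsub>L (Suc 0)\<^esub> idt A 0 j) \<ominus>\<^bsub>L (Suc 0)\<^esub>
            (p \<ominus>\<^bsub>L (Suc 0)\<^esub> (b \<ominus>\<^bsub>L (Suc 0)\<^esub> a)) \<otimes>\<^bsub>L (Suc 0)\<^esub> y
            \<oplus>\<^bsub>L (Suc 0)\<^esub> a \<otimes>\<^bsub>L (Suc 0)\<^esub> y"
          using cl j(2) by (simp add: L1.group_simps)
        also have "\<dots> = a \<otimes>\<^bsub>L (Suc 0)\<^esub> y" unfolding p1 p2 using cl by simp
        finally have e: "p \<otimes>\<^bsub>L (Suc 0)\<^esub> idt A 0 j \<oplus>\<^bsub>L (Suc 0)\<^esub> b \<otimes>\<^bsub>L (Suc 0)\<^esub> y =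
          a \<otimes>\<^bsub>L (Suc 0)\<^esub> y" .
        have "d (?m (bracket \<tau> u + w) \<otimes>\<^bsub>L 0\<^esub> i) = d (oper (L 0) \<tau> (?m u) \<otimes>\<^bsub>L 0\<^esub> j)"
          using bracket ic by (simp add: mon_simps j_def mon_cell_0 L0.m_assoc)
        also have "\<dots> = p \<otimes>\<^bsub>L (Suc 0)\<^esub> idt A 0 j \<oplus>\<^bsub>L (Suc 0)\<^esub> b \<otimes>\<^bsub>L (Suc 0)\<^esub> y"
          using bracket j h_I[OF j(1)] cl d_br[of \<tau> "?m u" j]
          by (simp add: p_def b_def y_def mon_cell_0 h_closed \<kappa>_simps(4))
        also have "\<dots> = a \<otimes>\<^bsub>L (Suc 0)\<^esub> y" using e by simp
        also have "y = idt A 0 (?m w) \<otimes>\<^bsub>L (Suc 0)\<^esub> d i" unfolding y_def j_def by (rule bracket)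
        finally show ?case using bracket ic
          by (simp add: a_def mon_simps idt_simps mon_cell_0 L1.m_assoc d_simps(1))
      qed
    qed (use ic in \<open>simp_all add: d_simps idt_simps L0.l_distr L1.l_distr L0.smult_mult_l L1.smult_mult_l\<close>)
  qed
  have d_oper: "d (oper (L 0) \<tau> i \<otimes>\<^bsub>L 0\<^esub> v) = oper (L (Suc 0)) \<tau> (d i) \<otimes>\<^bsub>L (Suc 0)\<^esub> idt A 0 v"
    if "\<tau> \<in> \<Omega>" "i \<in> I" "v \<in> cells A 0" for \<tau> i v
    using that d_br[of \<tau> i v] h_I[of i]
    by (simp add: I.Icarr L0.oper_zero idt_simps \<kappa>_simps(4) d_simps(1) h_closed)
  show thesis by (rule that[OF d d_src d_tgt d_left d_oper])
qed

text \<open>The cell \<open>c - hat c\<close> lies in the ideal of relations, where the map above is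
  multiplicative. Precomposing with this projection makes the map vanish on the image of \<open>h\<close>
  and yields the product and bracket formulas for all \<open>0\<close>-cells.\<close>

lemma zero_homotopy:
  obtains d where "good 0 d" "\<And>a. a \<in> cells A 0 \<Longrightarrow> d (h a) = \<zero>\<^bsub>L (Suc 0)\<^esub>"
proof -
  obtain d where d: "linear_map (L 0) (L (Suc 0)) d"
    and src: "\<And>c. c \<in> cells A 0 \<Longrightarrow> src A 0 (d c) = \<zero>\<^bsub>L 0\<^esub>"
    and tgt: "\<And>c. c \<in> cells A 0 \<Longrightarrow> tgt A 0 (d c) = h c \<ominus>\<^bsub>L 0\<^esub> c"
    and left: "\<And>c i. c \<in> cells A 0 \<Longrightarrow> i \<in> I \<Longrightarrow>
      d (c \<otimes>\<^bsub>L 0\<^esub> i) = idt A 0 c \<otimes>\<^bsub>L (Suc 0)\<^esub> d i"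
    and opr: "\<And>\<tau> i v. \<tau> \<in> \<Omega> \<Longrightarrow> i \<in> I \<Longrightarrow> v \<in> cells A 0 \<Longrightarrow>
      d (oper (L 0) \<tau> i \<otimes>\<^bsub>L 0\<^esub> v) = oper (L (Suc 0)) \<tau> (d i) \<otimes>\<^bsub>L (Suc 0)\<^esub> idt A 0 v"
    using zero_homotopy_unnormalised by blast
  interpret L1: omega_algebra "L (Suc 0)" \<Omega> by (rule level_alg)
  note d_simps = linear_mapD[OF d] linear_map_minus[OF d L0.omega_algebra_axioms L1.omega_algebra_axioms]
  define e where "e c = d (c \<ominus>\<^bsub>L 0\<^esub> h c)" for c
  have e: "e c = d c \<ominus>\<^bsub>L (Suc 0)\<^esub> d (h c)" if "c \<in> cells A 0" for c
    using that by (simp add: e_def d_simps h_closed)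
  have eI: "e i = d i" if "i \<in> I" for i
    using that by (simp add: e_def h_I I.Icarr)
  have lin: "linear_map (L 0) (L (Suc 0)) e"
    unfolding linear_map_def
    by (auto simp: e h_simps d_simps h_closed L1.add_diff_diff L1.smult_diff)
  have e_tgt: "tgt A 0 (e a) = h a \<ominus>\<^bsub>L 0\<^esub> a" if "a \<in> cells A 0" for a
    using that h_I[OF diff_h_I[OF that]] by (simp add: e_def tgt h_closed L0.group_simps)
  have e_h: "e (h a) = \<zero>\<^bsub>L (Suc 0)\<^esub>" if "a \<in> cells A 0" for a
    using that by (simp add: e h_idem d_simps(1) h_closed)
  have "good 0 e"
    unfolding good_def
  proof (intro conjI ballI impI)
    show "linear_map (L 0) (L (Suc 0)) e" by (rule lin)
    fix a assume a: "a \<in> cells A 0"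
    show "src A 0 (e a) = \<zero>\<^bsub>L 0\<^esub>" using a by (simp add: e_def src h_closed)
    show "tgt A 0 (e a) = h a \<ominus>\<^bsub>L 0\<^esub> a" using a by (rule e_tgt)
    show "e (tgt A 0 (e a)) \<oplus>\<^bsub>L (Suc 0)\<^esub> e a = \<zero>\<^bsub>L (Suc 0)\<^esub>"
      using a by (simp add: e_tgt linear_map_minus(3)[OF lin L0.omega_algebra_axioms L1.omega_algebra_axioms]
        linear_mapD(1)[OF lin] h_closed e_h)
    { fix b assume b: "b \<in> cells A 0"
      have "e (a \<otimes>\<^bsub>L 0\<^esub> b) \<ominus>\<^bsub>L (Suc 0)\<^esub> e (a \<otimes>\<^bsub>L 0\<^esub> h b) = d (a \<otimes>\<^bsub>L 0\<^esub> b) \<ominus>\<^bsub>L (Suc 0)\<^esub> d (a \<otimes>\<^bsub>L 0\<^esub> h b)"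
        using a b by (simp add: e h_mult_right h_closed d_simps(1) L1.group_simps)
      also have "\<dots> = idt A 0 a \<otimes>\<^bsub>L (Suc 0)\<^esub> e b"
        using a b left[OF a diff_h_I[OF b]] by (simp add: e_def d_simps h_closed L0.diff_simps)
      finally show "e (a \<otimes>\<^bsub>L 0\<^esub> b) =
        up (Suc 0) (s0 0 a) \<otimes>\<^bsub>L (Suc 0)\<^esub> e b \<oplus>\<^bsub>L (Suc 0)\<^esub> e (a \<otimes>\<^bsub>L 0\<^esub> up 0 (h (s0 0 b)))"
        using a b linear_mapD(1)[OF lin] by (simp add: h_closed L1.diff_eq_iff)
    }
    fix v \<tau> assume v: "v \<in> cells A 0" and \<tau>: "\<tau> \<in> \<Omega>"
    have "e (oper (L 0) \<tau> a \<otimes>\<^bsub>L 0\<^esub> v) \<ominus>\<^bsub>L (Suc 0)\<^esub> e (oper (L 0) \<tau> (h a) \<otimes>\<^bsub>L 0\<^esub> v) =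
        d (oper (L 0) \<tau> a \<otimes>\<^bsub>L 0\<^esub> v) \<ominus>\<^bsub>L (Suc 0)\<^esub> d (oper (L 0) \<tau> (h a) \<otimes>\<^bsub>L 0\<^esub> v)"
      using a v \<tau> by (simp add: e h_oper_mult h_closed d_simps(1) L1.group_simps)
    also have "\<dots> = oper (L (Suc 0)) \<tau> (e a) \<otimes>\<^bsub>L (Suc 0)\<^esub> idt A 0 v"
      using a v \<tau> opr[OF \<tau> diff_h_I[OF a] v] by (simp add: e_def d_simps h_closed L0.diff_simps L0.oper_diff)
    finally show "e (oper (L 0) \<tau> a \<otimes>\<^bsub>L 0\<^esub> up 0 v) =
      oper (L (Suc 0)) \<tau> (e a) \<otimes>\<^bsub>L (Suc 0)\<^esub> up (Suc 0) v \<oplus>\<^bsub>L (Suc 0)\<^esub>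
      e (up 0 (oper (L 0) \<tau> (h (s0 0 a)) \<otimes>\<^bsub>L 0\<^esub> v))"
      using a v \<tau> linear_mapD(1)[OF lin] by (simp add: h_closed L1.diff_eq_iff)
  next
    fix a assume a: "a \<in> cells A (Suc 0)"
    then have i: "src A 0 a \<ominus>\<^bsub>L 0\<^esub> tgt A 0 a \<in> I" using boundary_diff_I[of a] by simp
    show "tgt A 0 (e (src A 0 a \<ominus>\<^bsub>L 0\<^esub> tgt A 0 a)) = tgt A 0 a \<ominus>\<^bsub>L 0\<^esub> src A 0 a"
      using a h_I[OF i] by (simp add: e_tgt L0.group_simps)
  qed
  then show thesis using e_h by (rule that)
qed

text \<open>A relation \<open>i\<close> is the target of some \<open>x\<close> with source \<open>0\<close>.
  Then \<open>y x\<close> vanishes by \<open>peiffer\<close>, since \<open>x\<close> has zero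
  \<open>0\<close>-source, and so does \<open>y (1\<^sub>i - x)\<close>, since \<open>1\<^sub>i - x\<close>
  has zero \<open>0\<close>-target. Cells with zero \<open>0\<close>-source and \<open>0\<close>-target thus
  form a bimodule over the presented algebra.\<close>

lemma I_kills:
  assumes y: "y \<in> cells A (Suc n)" and s: "s0 (Suc n) y = \<zero>\<^bsub>L 0\<^esub>"
    and t: "t0 (Suc n) y = \<zero>\<^bsub>L 0\<^esub>" and i: "i \<in> I"
  shows "y \<otimes>\<^bsub>L (Suc n)\<^esub> up (Suc n) i = \<zero>\<^bsub>L (Suc n)\<^esub>"
    "up (Suc n) i \<otimes>\<^bsub>L (Suc n)\<^esub> y = \<zero>\<^bsub>L (Suc n)\<^esub>"
proof -
  interpret L: omega_algebra "L (Suc n)" \<Omega> by (rule level_alg)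
  obtain x where x: "x \<in> cells A (Suc 0)" "src A 0 x = \<zero>\<^bsub>L 0\<^esub>" "tgt A 0 x = i"
    using I_boundary[OF i] .
  define z where "z = lift A (Suc 0) (Suc n) x"
  have ic: "i \<in> cells A 0" using i by (rule I.Icarr)
  have z: "z \<in> cells A (Suc n)" "s0 (Suc n) z = \<zero>\<^bsub>L 0\<^esub>" "t0 (Suc n) z = i"
    using x ksrc_lift_low[of 0 "Suc 0" "Suc n" x] ktgt_lift_low[of 0 "Suc 0" "Suc n" x] lift_closed[of "Suc 0" "Suc n" x]
    by (simp_all add: z_def del: lift.simps ksrc.simps ktgt.simps add: ksrc_Suc ktgt_Suc)
  have u: "up (Suc n) i \<in> cells A (Suc n)" using ic by (intro lift_closed) simp_all
  have t': "t0 (Suc n) (up (Suc n) i \<ominus>\<^bsub>L (Suc n)\<^esub> z) = \<zero>\<^bsub>L 0\<^esub>"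
    using u z ic by (simp add: ktgt_simps ktgt_lift del: lift.simps ktgt.simps)
  have 1: "z \<otimes>\<^bsub>L (Suc n)\<^esub> y = \<zero>\<^bsub>L (Suc n)\<^esub>" "y \<otimes>\<^bsub>L (Suc n)\<^esub> z = \<zero>\<^bsub>L (Suc n)\<^esub>"
    by (rule peiffer_zero[OF z(1) y z(2) t])+
  have 2: "y \<otimes>\<^bsub>L (Suc n)\<^esub> (up (Suc n) i \<ominus>\<^bsub>L (Suc n)\<^esub> z) = \<zero>\<^bsub>L (Suc n)\<^esub>"
    "(up (Suc n) i \<ominus>\<^bsub>L (Suc n)\<^esub> z) \<otimes>\<^bsub>L (Suc n)\<^esub> y = \<zero>\<^bsub>L (Suc n)\<^esub>"
    by (rule peiffer_zero[OF y _ s t']; use u z in simp)+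
  show "y \<otimes>\<^bsub>L (Suc n)\<^esub> up (Suc n) i = \<zero>\<^bsub>L (Suc n)\<^esub>"
    using 1(2) 2(1) y u z(1) by (simp add: L.diff_simps del: lift.simps)
  show "up (Suc n) i \<otimes>\<^bsub>L (Suc n)\<^esub> y = \<zero>\<^bsub>L (Suc n)\<^esub>"
    using 1(1) 2(2) y u z(1) by (simp add: L.diff_simps del: lift.simps)
qed

end

section \<open>The homotopy on higher cells\<close>

locale homotopy = polygraph_section \<Omega> X \<iota>
  for \<Omega> :: "'o set" and X :: "('z, 'o, 'k::field_char_0, 'x) polygraph"
    and \<iota> :: "nat \<Rightarrow> ('z, 'o, 'k, 'x) cell set \<Rightarrow> ('z, 'o, 'k, 'x) cell" +
  fixes n :: nat and e :: "('z, 'o, 'k, 'x) cell \<Rightarrow> ('z, 'o, 'k, 'x) cell"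
  assumes good: "good n e"
begin

abbreviation K where "K \<equiv> L (Suc n)"
abbreviation K2 where "K2 \<equiv> L (Suc (Suc n))"

text \<open>With \<open>e\<close> as \<open>\<delta>\<close> in dimension \<open>n\<close>, this is the
  target prescribed for \<open>\<delta> a\<close> in dimension \<open>n + 1\<close>.\<close>

definition D :: "('z, 'o, 'k, 'x) cell \<Rightarrow> ('z, 'o, 'k, 'x) cell" where
  "D a = idt A n (src A n a) \<ominus>\<^bsub>K\<^esub> a \<oplus>\<^bsub>K\<^esub> e (src A n a \<ominus>\<^bsub>L n\<^esub> tgt A n a)"

sublocale K: omega_algebra "K" \<Omega>
  by (rule level_alg)

lemma e_linear: "linear_map (L n) K e"
  and e_src: "a \<in> cells A n \<Longrightarrow> src A n (e a) = \<zero>\<^bsub>L n\<^esub>"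
  and e_tgt: "a \<in> cells A (Suc n) \<Longrightarrow>
    tgt A n (e (src A n a \<ominus>\<^bsub>L n\<^esub> tgt A n a)) = tgt A n a \<ominus>\<^bsub>L n\<^esub> src A n a"
  and e_tgt_0: "n = 0 \<Longrightarrow> a \<in> cells A 0 \<Longrightarrow> tgt A 0 (e a) = h a \<ominus>\<^bsub>L 0\<^esub> a"
  and e_tgt_e: "a \<in> cells A n \<Longrightarrow> e (tgt A n (e a)) \<oplus>\<^bsub>K\<^esub> e a = \<zero>\<^bsub>K\<^esub>"
  and e_mult: "f \<in> cells A n \<Longrightarrow> g \<in> cells A n \<Longrightarrow> e (f \<otimes>\<^bsub>L n\<^esub> g) =
      up (Suc n) (s0 n f) \<otimes>\<^bsub>K\<^esub> e g \<oplus>\<^bsub>K\<^esub>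
      e (f \<otimes>\<^bsub>L n\<^esub> up n (h (s0 n g)))"
  and e_oper: "f \<in> cells A n \<Longrightarrow> v \<in> cells A 0 \<Longrightarrow> \<tau> \<in> \<Omega> \<Longrightarrow>
      e (oper (L n) \<tau> f \<otimes>\<^bsub>L n\<^esub> up n v) =
      oper K \<tau> (e f) \<otimes>\<^bsub>K\<^esub> up (Suc n) v \<oplus>\<^bsub>K\<^esub>
      e (up n (oper (L 0) \<tau> (h (s0 n f)) \<otimes>\<^bsub>L 0\<^esub> v))"
  using good unfolding good_def by blast+

lemmas e_simps = linear_mapD[OF e_linear] linear_map_minus[OF e_linear level_alg level_alg]

lemma D_closed: "a \<in> cells A (Suc n) \<Longrightarrow> D a \<in> cells A (Suc n)"
  by (simp add: D_def e_simps(1))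

lemma D_linear: "linear_map K K D"
  unfolding linear_map_def
  by (auto simp: D_closed) (simp_all add: D_def src_simps tgt_simps idt_simps e_simps K.smult_diff
      K.smult_r_distr K.group_simps)

lemmas D_simps = linear_mapD[OF D_linear] linear_map_minus[OF D_linear level_alg level_alg]

lemma D_src: "a \<in> cells A (Suc n) \<Longrightarrow> src A n (D a) = \<zero>\<^bsub>L n\<^esub>"
  by (simp add: D_def src_simps e_simps(1) e_src)

lemma D_tgt: "a \<in> cells A (Suc n) \<Longrightarrow> tgt A n (D a) = \<zero>\<^bsub>L n\<^esub>"
proof -
  interpret L: omega_algebra "L n" \<Omega> by (rule level_alg)
  assume "a \<in> cells A (Suc n)"
  then show ?thesis by (simp add: D_def tgt_simps e_simps(1) e_tgt L.group_simps)
qed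

lemma D_idt: "a \<in> cells A n \<Longrightarrow> D (idt A n a) = \<zero>\<^bsub>K\<^esub>"
  by (simp add: D_def src_idt tgt_idt e_simps)

lemma D_e: "a \<in> cells A n \<Longrightarrow> D (e a) = \<zero>\<^bsub>K\<^esub>"
proof -
  assume a: "a \<in> cells A n"
  then have "D (e a) = \<zero>\<^bsub>K\<^esub> \<ominus>\<^bsub>K\<^esub> (e (tgt A n (e a)) \<oplus>\<^bsub>K\<^esub> e a)"
    by (simp add: D_def e_simps e_src idt_simps K.group_simps)
  then show ?thesis unfolding e_tgt_e[OF a] by simp
qed

lemma D_cycle: "src A n z = \<zero>\<^bsub>L n\<^esub> \<Longrightarrow> tgt A n z = \<zero>\<^bsub>L n\<^esub> \<Longrightarrow> z \<in> cells A (Suc n) \<Longrightarrow>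
    D z = \<ominus>\<^bsub>K\<^esub> z"
  by (simp add: D_def idt_simps e_simps K.minus_as_diff)

text \<open>Expanding both sides leaves products that vanish by \<open>peiffer\<close> or
  \<open>I_kills\<close>. For \<open>n > 0\<close> the source and the target of \<open>f\<close> have the
  same \<open>0\<close>-source, so the values of \<open>e\<close> match. For \<open>n = 0\<close> they need
  not, and the discrepancy is balanced by the target \<open>hat t(g) - t(g)\<close> of \<open>e\<close> at
  the target of \<open>g\<close>.\<close>

lemma D_mult:
  assumes f: "f \<in> cells A (Suc n)" and g: "g \<in> cells A (Suc n)"
  shows "D (f \<otimes>\<^bsub>K\<^esub> g) = up (Suc n) (s0 (Suc n) f) \<otimes>\<^bsub>K\<^esub> D g \<oplus>\<^bsub>K\<^esub>
    D (f \<otimes>\<^bsub>K\<^esub> up (Suc n) (h (s0 (Suc n) g)))"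
proof -
  define a a' where "a = up (Suc n) (s0 (Suc n) f)" and "a' = up (Suc n) (s0 n (tgt A n f))"
  define b where "b = h (s0 (Suc n) g)"
  define B where "B = up (Suc n) b"
  define sf where "sf = idt A n (src A n f)"
  define sg where "sg = idt A n (src A n g)"
  define u where "u = e (src A n f \<otimes>\<^bsub>L n\<^esub> up n b)"
  define v where "v = e (tgt A n f \<otimes>\<^bsub>L n\<^esub> up n b)"
  define p where "p = e (src A n g)"
  define q where "q = e (tgt A n g)"
  have b: "b \<in> cells A 0" using g by (simp add: b_def h_closed)
  have cl: "a \<in> cells A (Suc n)" "a' \<in> cells A (Suc n)" "B \<in> cells A (Suc n)" "sf \<in> cells A (Suc n)"
    "sg \<in> cells A (Suc n)" "u \<in> cells A (Suc n)" "v \<in> cells A (Suc n)" "p \<in> cells A (Suc n)" "q \<in> cells A (Suc n)"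
    using f g b by (simp_all add: a_def a'_def B_def sf_def sg_def u_def v_def p_def q_def e_simps(1))
  have b': "h (s0 n (tgt A n g)) = b" "h (s0 n (src A n g)) = b"
    using h_ksrc_tgt[OF g] by (simp_all add: b_def)
  have es: "e (src A n f \<otimes>\<^bsub>L n\<^esub> src A n g) = a \<otimes>\<^bsub>K\<^esub> p \<oplus>\<^bsub>K\<^esub> u"
    using e_mult[of "src A n f" "src A n g"] f g b' by (simp add: a_def p_def u_def)
  have et: "e (tgt A n f \<otimes>\<^bsub>L n\<^esub> tgt A n g) = a' \<otimes>\<^bsub>K\<^esub> q \<oplus>\<^bsub>K\<^esub> v"
    using e_mult[of "tgt A n f" "tgt A n g"] f g b' by (simp add: a'_def q_def v_def)
  have Dfg: "D (f \<otimes>\<^bsub>K\<^esub> g) = sf \<otimes>\<^bsub>K\<^esub> sg \<ominus>\<^bsub>K\<^esub> f \<otimes>\<^bsub>K\<^esub> g \<oplus>\<^bsub>K\<^esub>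
     ((a \<otimes>\<^bsub>K\<^esub> p \<oplus>\<^bsub>K\<^esub> u) \<ominus>\<^bsub>K\<^esub> (a' \<otimes>\<^bsub>K\<^esub> q \<oplus>\<^bsub>K\<^esub> v))"
    using f g by (simp add: D_def src_simps tgt_simps idt_simps e_simps(6) es et sf_def sg_def)
  have Dg: "D g = sg \<ominus>\<^bsub>K\<^esub> g \<oplus>\<^bsub>K\<^esub> (p \<ominus>\<^bsub>K\<^esub> q)"
    using g by (simp add: D_def e_simps(6) sg_def p_def q_def)
  have DfB: "D (f \<otimes>\<^bsub>K\<^esub> B) = sf \<otimes>\<^bsub>K\<^esub> B \<ominus>\<^bsub>K\<^esub> f \<otimes>\<^bsub>K\<^esub> B \<oplus>\<^bsub>K\<^esub>
      (u \<ominus>\<^bsub>K\<^esub> v)"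
    using f b by (simp add: D_def src_simps tgt_simps idt_simps e_simps(6) sf_def B_def u_def v_def)
  have "D (f \<otimes>\<^bsub>K\<^esub> g) = a \<otimes>\<^bsub>K\<^esub> D g \<oplus>\<^bsub>K\<^esub> D (f \<otimes>\<^bsub>K\<^esub> B)"
  proof (cases n)
    case 0
    define tf where "tf = idt A n (tgt A n f)"
    have tf: "tf \<in> cells A (Suc n)" using f by (simp add: tf_def)
    have eq: "sf = a" "a' = tf" using 0 by (simp_all add: sf_def a_def a'_def tf_def)
    have z1: "(f \<ominus>\<^bsub>K\<^esub> a) \<otimes>\<^bsub>K\<^esub> (g \<ominus>\<^bsub>K\<^esub> B \<oplus>\<^bsub>K\<^esub> q) = \<zero>\<^bsub>K\<^esub>"
    proof (rule peiffer_zero)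
      show "s0 (Suc n) (f \<ominus>\<^bsub>K\<^esub> a) = \<zero>\<^bsub>L 0\<^esub>"
        using f cl 0 by (simp add: a_def src_simps src_idt)
      have "tgt A 0 q = b \<ominus>\<^bsub>L 0\<^esub> tgt A 0 g" using e_tgt_0[OF 0, of "tgt A 0 g"] g b'(1) 0 by (simp add: q_def)
      then show "t0 (Suc n) (g \<ominus>\<^bsub>K\<^esub> B \<oplus>\<^bsub>K\<^esub> q) = \<zero>\<^bsub>L 0\<^esub>"
        using g cl b 0 by (simp add: B_def tgt_simps tgt_idt L0.group_simps)
    qed (use f g cl in simp_all)
    have z2: "(tf \<ominus>\<^bsub>K\<^esub> f) \<otimes>\<^bsub>K\<^esub> q = \<zero>\<^bsub>K\<^esub>"
    proof (rule peiffer_zero(2))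
      show "t0 (Suc n) (tf \<ominus>\<^bsub>K\<^esub> f) = \<zero>\<^bsub>L 0\<^esub>"
        using f tf 0 by (simp add: tf_def tgt_simps tgt_idt)
      show "s0 (Suc n) q = \<zero>\<^bsub>L 0\<^esub>" using g 0 e_src[of "tgt A n g"] by (simp add: q_def)
    qed (use f g cl tf in simp_all)
    have "D (f \<otimes>\<^bsub>K\<^esub> g) \<oplus>\<^bsub>K\<^esub>
        ((f \<ominus>\<^bsub>K\<^esub> a) \<otimes>\<^bsub>K\<^esub> (g \<ominus>\<^bsub>K\<^esub> B \<oplus>\<^bsub>K\<^esub> q) \<oplus>\<^bsub>K\<^esub>
        (tf \<ominus>\<^bsub>K\<^esub> f) \<otimes>\<^bsub>K\<^esub> q) =
      a \<otimes>\<^bsub>K\<^esub> D g \<oplus>\<^bsub>K\<^esub> D (f \<otimes>\<^bsub>K\<^esub> B)"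
      unfolding Dfg Dg DfB eq using f g cl tf by (simp add: K.group_simps)
    then show ?thesis unfolding z1 z2 using f g by (simp add: D_closed)
  next
    case (Suc m)
    have eq: "a' = a" using f Suc by (simp add: a_def a'_def glob_src)
    have z1: "(sf \<ominus>\<^bsub>K\<^esub> a) \<otimes>\<^bsub>K\<^esub> (sg \<ominus>\<^bsub>K\<^esub> g) = \<zero>\<^bsub>K\<^esub>"
    proof (rule peiffer_zero)
      show "s0 (Suc n) (sf \<ominus>\<^bsub>K\<^esub> a) = \<zero>\<^bsub>L 0\<^esub>"
        using f cl ksrc_lift[of 0 n "s0 n (src A n f)"] by (simp add: a_def sf_def src_simps src_idt ksrc_simps)
      show "t0 (Suc n) (sg \<ominus>\<^bsub>K\<^esub> g) = \<zero>\<^bsub>L 0\<^esub>"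
        using g cl Suc by (simp add: sg_def tgt_simps tgt_idt ktgt_simps glob_tgt)
    qed (use f g cl in simp_all)
    have s0: "s0 (Suc n) (sf \<ominus>\<^bsub>K\<^esub> f) = \<zero>\<^bsub>L 0\<^esub>"
      "t0 (Suc n) (sf \<ominus>\<^bsub>K\<^esub> f) = \<zero>\<^bsub>L 0\<^esub>"
      using f cl Suc by (simp_all add: sf_def src_simps tgt_simps src_idt tgt_idt ksrc_simps ktgt_simps glob_tgt)
    define g0 where "g0 = up (Suc n) (s0 (Suc n) g)"
    have g0: "g0 \<in> cells A (Suc n)" using g by (simp add: g0_def)
    have z2: "(sf \<ominus>\<^bsub>K\<^esub> f) \<otimes>\<^bsub>K\<^esub> (g \<ominus>\<^bsub>K\<^esub> g0) = \<zero>\<^bsub>K\<^esub>"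
    proof (rule peiffer_zero(2)[OF _ _ _ s0(2)])
      show "s0 (Suc n) (g \<ominus>\<^bsub>K\<^esub> g0) = \<zero>\<^bsub>L 0\<^esub>"
        using g g0 ksrc_lift[of 0 n "s0 n (src A n g)"] by (simp add: g0_def src_simps src_idt ksrc_simps)
    qed (use f g g0 cl in simp_all)
    have "s0 (Suc n) g \<in> cells A 0" using g by (intro ksrc_closed) simp_all
    then have z3: "(sf \<ominus>\<^bsub>K\<^esub> f) \<otimes>\<^bsub>K\<^esub> (g0 \<ominus>\<^bsub>K\<^esub> B) = \<zero>\<^bsub>K\<^esub>"
      using I_kills(1)[OF _ s0 diff_h_I[of "s0 (Suc n) g"]] f cl b
      by (simp add: g0_def B_def b_def lift_simps h_closed del: lift.simps ksrc.simps)
    have "D (f \<otimes>\<^bsub>K\<^esub> g) =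
      a \<otimes>\<^bsub>K\<^esub> D g \<oplus>\<^bsub>K\<^esub> D (f \<otimes>\<^bsub>K\<^esub> B) \<oplus>\<^bsub>K\<^esub>
      ((sf \<ominus>\<^bsub>K\<^esub> a) \<otimes>\<^bsub>K\<^esub> (sg \<ominus>\<^bsub>K\<^esub> g) \<oplus>\<^bsub>K\<^esub>
      ((sf \<ominus>\<^bsub>K\<^esub> f) \<otimes>\<^bsub>K\<^esub> (g \<ominus>\<^bsub>K\<^esub> g0) \<oplus>\<^bsub>K\<^esub>
      (sf \<ominus>\<^bsub>K\<^esub> f) \<otimes>\<^bsub>K\<^esub> (g0 \<ominus>\<^bsub>K\<^esub> B)))"
      unfolding Dfg Dg DfB eq using f g cl g0 by (simp add: K.group_simps)
    then show ?thesis unfolding z1 z2 z3 using f g cl by (simp add: D_closed)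
  qed
  then show ?thesis by (simp only: a_def b_def B_def)
qed

text \<open>\<open>D_mult\<close> with an identity of a relation on the right: \<open>D\<close> vanishes on
  identities and \<open>h\<close> on relations. Hence \<open>D\<close> cannot distinguish right
  multiplication by \<open>c\<close> and by \<open>h c\<close>.\<close>

lemma D_right_I:
  assumes "f \<in> cells A (Suc n)" "i \<in> I"
  shows "D (f \<otimes>\<^bsub>K\<^esub> up (Suc n) i) = \<zero>\<^bsub>K\<^esub>"
proof -
  have i: "i \<in> cells A 0" using assms(2) by (rule I.Icarr)
  have "s0 (Suc n) (up (Suc n) i) = i" using i by (intro ksrc_lift) simp_all
  then show ?thesis
    using D_mult[OF assms(1), of "up (Suc n) i"] assms i
    by (simp add: D_idt h_I lift_simps idt_simps D_simps)
qed

lemma D_right_h: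
  assumes "f \<in> cells A (Suc n)" "c \<in> cells A 0"
  shows "D (f \<otimes>\<^bsub>K\<^esub> up (Suc n) (h c)) = D (f \<otimes>\<^bsub>K\<^esub> up (Suc n) c)"
proof -
  have "D (f \<otimes>\<^bsub>K\<^esub> up (Suc n) (h c \<ominus>\<^bsub>L 0\<^esub> c)) = \<zero>\<^bsub>K\<^esub>"
    using assms by (intro D_right_I h_diff_I)
  then have "D (f \<otimes>\<^bsub>K\<^esub> up (Suc n) (h c)) \<ominus>\<^bsub>K\<^esub>
      D (f \<otimes>\<^bsub>K\<^esub> up (Suc n) c) = \<zero>\<^bsub>K\<^esub>"
    using assms by (simp add: lift_simps idt_simps h_closed K.diff_simps(6) D_simps)
  then show ?thesis using assms by (simp add: K.diff_eq_iff D_closed h_closed)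
qed

lemma D_oper:
  assumes f: "f \<in> cells A (Suc n)" and v: "v \<in> cells A 0" and \<tau>: "\<tau> \<in> \<Omega>"
  shows "D (oper K \<tau> f \<otimes>\<^bsub>K\<^esub> up (Suc n) v) =
    oper K \<tau> (D f) \<otimes>\<^bsub>K\<^esub> up (Suc n) v"
proof -
  define c where "c = e (up n (oper (L 0) \<tau> (h (s0 (Suc n) f)) \<otimes>\<^bsub>L 0\<^esub> v))"
  have c: "c \<in> cells A (Suc n)" using f v \<tau> by (simp add: c_def e_simps(1) h_closed)
  have es: "e (oper (L n) \<tau> (src A n f) \<otimes>\<^bsub>L n\<^esub> up n v) =
      oper K \<tau> (e (src A n f)) \<otimes>\<^bsub>K\<^esub> up (Suc n) v \<oplus>\<^bsub>K\<^esub> c"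
    using e_oper[of "src A n f" v \<tau>] f v \<tau> by (simp add: c_def)
  have et: "e (oper (L n) \<tau> (tgt A n f) \<otimes>\<^bsub>L n\<^esub> up n v) =
      oper K \<tau> (e (tgt A n f)) \<otimes>\<^bsub>K\<^esub> up (Suc n) v \<oplus>\<^bsub>K\<^esub> c"
    using e_oper[of "tgt A n f" v \<tau>] f v \<tau> h_ksrc_tgt[OF f] by (simp add: c_def)
  have "D (oper K \<tau> f \<otimes>\<^bsub>K\<^esub> up (Suc n) v) =
    oper K \<tau> (idt A n (src A n f)) \<otimes>\<^bsub>K\<^esub> up (Suc n) v \<ominus>\<^bsub>K\<^esub>
    oper K \<tau> f \<otimes>\<^bsub>K\<^esub> up (Suc n) v \<oplus>\<^bsub>K\<^esub>
    ((oper K \<tau> (e (src A n f)) \<otimes>\<^bsub>K\<^esub> up (Suc n) v \<oplus>\<^bsub>K\<^esub> c) \<ominus>\<^bsub>K\<^esub>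
    (oper K \<tau> (e (tgt A n f)) \<otimes>\<^bsub>K\<^esub> up (Suc n) v \<oplus>\<^bsub>K\<^esub> c))"
    using f v \<tau> by (simp add: D_def src_simps tgt_simps idt_simps e_simps(6) es et)
  also have "\<dots> = oper K \<tau> (D f) \<otimes>\<^bsub>K\<^esub> up (Suc n) v"
    using f v \<tau> c by (simp add: D_def e_simps K.oper_add K.oper_diff K.group_simps)
  finally show ?thesis .
qed

end

context polygraph
begin

lemma ksrc_F: "m \<le> n \<Longrightarrow> ksrc (F n) k m = ksrc A k m"
  by (induction m) (simp_all add: src_F[of _ n] Suc_le_eq fun_eq_iff)

lemma ktgt_F: "m \<le> n \<Longrightarrow> ktgt (F n) k m = ktgt A k m"
  by (induction m) (simp_all add: tgt_F[of _ n] Suc_le_eq fun_eq_iff)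

lemma lift_F: "m \<le> n \<Longrightarrow> lift (F n) k m = lift A k m"
  by (induction m) (simp_all add: idt_F[of _ n] Suc_le_eq fun_eq_iff)

lemma boundary_zero:
  assumes y: "y \<in> cells A (Suc (Suc m))" and s: "src A (Suc m) y = \<zero>\<^bsub>L (Suc m)\<^esub>"
  shows "s0 (Suc (Suc m)) y = \<zero>\<^bsub>L 0\<^esub>" "t0 (Suc (Suc m)) y = \<zero>\<^bsub>L 0\<^esub>"
  using y glob_tgt[OF y] by (simp_all add: s src_simps tgt_simps ksrc_simps ktgt_simps flip: glob_tgt)

end

text \<open>The map \<open>G y\<close> sends \<open>c\<close> to a filler of \<open>D(y c)\<close>. It
  depends on \<open>c\<close> only modulo relations.\<close>

locale homotopy_step = homotopy \<Omega> X \<iota> n e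
  for \<Omega> :: "'o set" and X :: "('z, 'o, 'k::field_char_0, 'x) polygraph"
    and \<iota> :: "nat \<Rightarrow> ('z, 'o, 'k, 'x) cell set \<Rightarrow> ('z, 'o, 'k, 'x) cell"
    and n :: nat and e :: "('z, 'o, 'k, 'x) cell \<Rightarrow> ('z, 'o, 'k, 'x) cell" +
  fixes G :: "'x \<Rightarrow> ('z, 'o, 'k, 'x) cell \<Rightarrow> ('z, 'o, 'k, 'x) cell"
  assumes G_linear: "y \<in> gens X (Suc n) \<Longrightarrow> linear_map (L 0) (L (Suc (Suc n))) (G y)"
    and G_src: "y \<in> gens X (Suc n) \<Longrightarrow> c \<in> cells A 0 \<Longrightarrow> src A (Suc n) (G y c) = \<zero>\<^bsub>L (Suc n)\<^esub>"
    and G_tgt: "y \<in> gens X (Suc n) \<Longrightarrow> c \<in> cells A 0 \<Longrightarrow>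
      tgt A (Suc n) (G y c) = D (gen_cell n y \<otimes>\<^bsub>L (Suc n)\<^esub> up (Suc n) c)"
    and G_I: "y \<in> gens X (Suc n) \<Longrightarrow> i \<in> I \<Longrightarrow> G y i = \<zero>\<^bsub>L (Suc (Suc n))\<^esub>"
begin

sublocale E: free_extension \<Omega> n "F n" "gens X (Suc n)" "gsrc X (Suc n)" "gtgt X (Suc n)"
  by (rule free_extension_F)

sublocale K2: omega_algebra "K2" \<Omega>
  by (rule level_alg)

text \<open>\<open>\<Delta> f c\<close> is the value of the homotopy at the cell \<open>f c\<close>. The
  extra argument is needed because the product formula expresses the value at \<open>f g\<close> through the
  one at \<open>f\<close> multiplied on the right by a \<open>0\<close>-cell. In the case of a composite,
  the identity in \<open>cmp_formula\<close> contributes nothing.\<close>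

primrec \<Delta> :: "('z, 'o, 'k, 'x) tm \<Rightarrow> ('z, 'o, 'k, 'x) cell \<Rightarrow> ('z, 'o, 'k, 'x) cell" where
  "\<Delta> (Pol p) = (\<lambda>c. \<zero>\<^bsub>K2\<^esub>)"
| "\<Delta> (Idt u) = (\<lambda>c. \<zero>\<^bsub>K2\<^esub>)"
| "\<Delta> (Gen y) = G y"
| "\<Delta> (Add f g) = (\<lambda>c. \<Delta> f c \<oplus>\<^bsub>K2\<^esub> \<Delta> g c)"
| "\<Delta> (Scl r f) = (\<lambda>c. r \<odot>\<^bsub>K2\<^esub> \<Delta> f c)"
| "\<Delta> (Mul f g) = (\<lambda>c. up (Suc (Suc n)) (s0 n (E.sc f)) \<otimes>\<^bsub>K2\<^esub> \<Delta> g c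
    \<oplus>\<^bsub>K2\<^esub> \<Delta> f (s0 n (E.sc g) \<otimes>\<^bsub>L 0\<^esub> c))"
| "\<Delta> (Opr \<tau> f) = (\<lambda>c. oper K2 \<tau> (\<Delta> f \<one>\<^bsub>L 0\<^esub>)
    \<otimes>\<^bsub>K2\<^esub> up (Suc (Suc n)) c)"
| "\<Delta> (Cmp k f g) = (\<lambda>c. \<Delta> f c \<oplus>\<^bsub>K2\<^esub> \<Delta> g c)"

lemma F_A: "level (F n) n = L n" "level (F (Suc n)) (Suc n) = K"
  "cmp (F n) n = cmp A n" "cmp (F (Suc n)) (Suc n) = cmp A (Suc n)"
  "src (F (Suc n)) n = src A n" "tgt (F (Suc n)) n = tgt A n" "idt (F (Suc n)) n = idt A n"
  "ksrc (F n) k n = ksrc A k n" "ktgt (F n) k n = ktgt A k n" "lift (F n) k n = lift A k n"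
  using level_F[of n n] level_F[of "Suc n" "Suc n"] cmp_F[of n n] cmp_F[of "Suc n" "Suc n"]
    src_F[of n "Suc n"] tgt_F[of n "Suc n"] idt_F[of n "Suc n"] ksrc_F[of n n k] ktgt_F[of n n k] lift_F[of n n k]
  by simp_all

lemma A'_F: "E.A' = F (Suc n)"
  by simp

lemma cls_ops:
  "E.ok f \<Longrightarrow> E.ok g \<Longrightarrow> E.cls (Add f g) = E.cls f \<oplus>\<^bsub>K\<^esub> E.cls g"
  "E.ok f \<Longrightarrow> E.ok g \<Longrightarrow> E.cls (Mul f g) = E.cls f \<otimes>\<^bsub>K\<^esub> E.cls g"
  "E.ok f \<Longrightarrow> E.cls (Scl c f) = c \<odot>\<^bsub>K\<^esub> E.cls f"
  "\<tau> \<in> \<Omega> \<Longrightarrow> E.ok f \<Longrightarrow> E.cls (Opr \<tau> f) = oper K \<tau> (E.cls f)"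
  "E.ok (Cmp k f g) \<Longrightarrow> E.cls (Cmp k f g) = cmp A (Suc n) k (E.cls f) (E.cls g)"
  "a \<in> cells A n \<Longrightarrow> u \<in> a \<Longrightarrow> E.cls (Idt u) = idt A n a"
  "E.ok f \<Longrightarrow> E.cls f \<in> cells A (Suc n)"
  "E.ok f \<Longrightarrow> src A n (E.cls f) = E.sc f" "E.ok f \<Longrightarrow> tgt A n (E.cls f) = E.tg f"
  using E.new_add[of f g] E.new_mult[of f g] E.new_smult[of f c] E.new_oper[of \<tau> f] E.new_cmp[of k f g]
    E.new_idt[of a u] E.cls_cell[of f] E.new_src[of f] E.new_tgt[of f]
  unfolding A'_F F_A by simp_all

lemma sc_closed: "E.ok f \<Longrightarrow> E.sc f \<in> cells A n" "E.ok f \<Longrightarrow> s0 n (E.sc f) \<in> cells A 0"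
  using E.sc_closed[of f] unfolding F_A by simp_all

lemma ok_Cmp_A: "E.ok (Cmp k f g) \<Longrightarrow> composable A (Suc n) k (E.cls f) (E.cls g)"
  unfolding composable_def using ktgt_F[of n n] ksrc_F[of n n] by (auto simp: cls_ops fun_eq_iff)

lemma kill:
  assumes "y \<in> cells A (Suc (Suc n))" "src A (Suc n) y = \<zero>\<^bsub>K\<^esub>" "i \<in> I"
  shows "y \<otimes>\<^bsub>K2\<^esub> up (Suc (Suc n)) i = \<zero>\<^bsub>K2\<^esub>"
    "up (Suc (Suc n)) i \<otimes>\<^bsub>K2\<^esub> y = \<zero>\<^bsub>K2\<^esub>"
  using I_kills[OF assms(1) boundary_zero[OF assms(1,2)] assms(3)] by blast+

lemma \<Delta>_linear: "E.ok f \<Longrightarrow> linear_map (L 0) K2 (\<Delta> f)"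
proof (induction f)
  case (Idt u)
  then show ?case by (simp add: linear_map_def K2.smult_zero_right)
next
  case (Gen y)
  then show ?case by (simp add: G_linear)
next
  case (Add f g)
  then have l: "linear_map (L 0) K2 (\<Delta> f)" "linear_map (L 0) K2 (\<Delta> g)"
    by simp_all
  show ?case unfolding linear_map_def
    by (auto simp: linear_mapD[OF l(1)] linear_mapD[OF l(2)] K2.smult_r_distr K2.a_ac)
next
  case (Scl r f)
  then have l: "linear_map (L 0) K2 (\<Delta> f)" by simp
  show ?case unfolding linear_map_def
    by (auto simp: linear_mapD[OF l(1)] K2.smult_r_distr K2.smult_assoc[symmetric] mult.commute)
next
  case (Mul f g)
  then have l: "linear_map (L 0) K2 (\<Delta> f)" "linear_map (L 0) K2 (\<Delta> g)"
    and ok: "E.ok f" "E.ok g"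
    by simp_all
  show ?case unfolding linear_map_def using sc_closed(2)[OF ok(1)] sc_closed(2)[OF ok(2)]
    by (auto simp: linear_mapD[OF l(1)] linear_mapD[OF l(2)] K2.smult_r_distr K2.a_ac K2.r_distr L0.r_distr
      K2.smult_mult_r L0.smult_mult_r)
next
  case (Opr \<tau> f)
  then have l: "linear_map (L 0) K2 (\<Delta> f)" and \<tau>: "\<tau> \<in> \<Omega>" by simp_all
  show ?case unfolding linear_map_def using \<tau>
    by (auto simp: linear_mapD[OF l(1)] K2.r_distr lift_simps idt_simps K2.smult_mult_r)
next
  case (Cmp k f g)
  then have l: "linear_map (L 0) K2 (\<Delta> f)" "linear_map (L 0) K2 (\<Delta> g)"
    by simp_all
  show ?case unfolding linear_map_def
    by (auto simp: linear_mapD[OF l(1)] linear_mapD[OF l(2)] K2.smult_r_distr K2.a_ac)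
qed simp

lemmas \<Delta>_simps = linear_mapD[OF \<Delta>_linear] linear_map_minus[OF \<Delta>_linear level_alg level_alg]

lemma \<Delta>_src: "E.ok f \<Longrightarrow> c \<in> cells A 0 \<Longrightarrow> src A (Suc n) (\<Delta> f c) = \<zero>\<^bsub>K\<^esub>"
proof (induction f arbitrary: c)
  case (Mul f g)
  then show ?case by (simp add: src_simps \<Delta>_simps(1) sc_closed)
next
  case (Opr \<tau> f)
  then show ?case by (simp add: src_simps \<Delta>_simps(1) K.oper_zero)
qed (simp_all add: G_src src_simps \<Delta>_simps(1) K.smult_zero_right)

lemma \<Delta>_I: "E.ok f \<Longrightarrow> i \<in> I \<Longrightarrow> \<Delta> f i = \<zero>\<^bsub>K2\<^esub>"
proof (induction f arbitrary: i)
  case (Mul f g)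
  then show ?case by (simp add: I.I_l_closed sc_closed)
next
  case (Opr \<tau> f)
  then have "src A (Suc n) (oper K2 \<tau> (\<Delta> f \<one>\<^bsub>L 0\<^esub>)) = \<zero>\<^bsub>K\<^esub>"
    by (simp add: src_simps \<Delta>_simps(1) K.oper_zero \<Delta>_src)
  with Opr show ?case using kill(1)[of "oper K2 \<tau> (\<Delta> f \<one>\<^bsub>L 0\<^esub>)" i]
    by (simp add: \<Delta>_simps(1))
qed (simp_all add: G_I K2.smult_zero_right)

lemma \<Delta>_tgt: "E.ok f \<Longrightarrow> c \<in> cells A 0 \<Longrightarrow>
  tgt A (Suc n) (\<Delta> f c) = D (E.cls f \<otimes>\<^bsub>K\<^esub> up (Suc n) c)"
proof (induction f arbitrary: c)
  case (Idt u)
  then obtain a where a: "a \<in> cells A n" "u \<in> a" by (auto simp: F_A)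
  have "idt A n a \<otimes>\<^bsub>K\<^esub> up (Suc n) c = idt A n (a \<otimes>\<^bsub>L n\<^esub> up n c)"
    using a Idt by (simp add: idt_simps)
  then show ?case using a Idt by (simp add: cls_ops(6)[OF a] D_idt tgt_simps del: lift.simps)
next
  case (Gen y)
  then show ?case by (simp add: G_tgt gen_cell_def)
next
  case (Add f g)
  then show ?case by (simp add: tgt_simps \<Delta>_simps(1) cls_ops K.l_distr D_simps(2))
next
  case (Scl r f)
  then show ?case by (simp add: tgt_simps \<Delta>_simps(1) cls_ops K.smult_mult_l D_simps(3))
next
  case (Mul f g)
  then have ok: "E.ok f" "E.ok g" and c: "c \<in> cells A 0" by simp_all
  have s: "s0 (Suc n) (E.cls f) = s0 n (E.sc f)" "s0 (Suc n) (E.cls g) = s0 n (E.sc g)"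
    using ok by (simp_all add: cls_ops)
  have sg: "s0 (Suc n) (E.cls g \<otimes>\<^bsub>K\<^esub> up (Suc n) c) = s0 n (E.sc g) \<otimes>\<^bsub>L 0\<^esub> c"
    using ok c s ksrc_simps(5)[of 0 "Suc n" "E.cls g" "up (Suc n) c"]
    by (simp add: cls_ops ksrc_lift src_idt)
  have "D (E.cls (Mul f g) \<otimes>\<^bsub>K\<^esub> up (Suc n) c) =
      D (E.cls f \<otimes>\<^bsub>K\<^esub> (E.cls g \<otimes>\<^bsub>K\<^esub> up (Suc n) c))"
    using ok c by (simp add: cls_ops K.m_assoc)
  also have "\<dots> = up (Suc n) (s0 n (E.sc f)) \<otimes>\<^bsub>K\<^esub> D (E.cls g \<otimes>\<^bsub>K\<^esub> up (Suc n) c)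
    \<oplus>\<^bsub>K\<^esub> D (E.cls f \<otimes>\<^bsub>K\<^esub> up (Suc n) (s0 n (E.sc g) \<otimes>\<^bsub>L 0\<^esub> c))"
    using ok c D_mult[of "E.cls f" "E.cls g \<otimes>\<^bsub>K\<^esub> up (Suc n) c"]
      D_right_h[of "E.cls f" "s0 n (E.sc g) \<otimes>\<^bsub>L 0\<^esub> c"]
    unfolding sg s by (simp add: cls_ops sc_closed)
  finally show ?case using ok c Mul.IH by (simp add: tgt_simps tgt_idt \<Delta>_simps(1) sc_closed)
next
  case (Opr \<tau> f)
  then have ok: "E.ok f" and c: "c \<in> cells A 0" and \<tau>: "\<tau> \<in> \<Omega>" by simp_all
  have "tgt A (Suc n) (\<Delta> f \<one>\<^bsub>L 0\<^esub>) = D (E.cls f)"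
    using Opr.IH[OF ok, of "\<one>\<^bsub>L 0\<^esub>"] cls_ops(7)[OF ok] by (simp add: lift_simps idt_simps)
  then show ?case using ok c \<tau> D_oper[of "E.cls f" c \<tau>]
    by (simp add: tgt_simps tgt_idt \<Delta>_simps(1) cls_ops)
next
  case (Cmp k f g)
  then have ok: "E.ok f" "E.ok g" and c: "c \<in> cells A 0" by simp_all
  note co = ok_Cmp_A[OF Cmp.prems(1)]
  have k: "k \<le> n" using co by (simp add: composable_def)
  define z where "z = lift A k n (ktgt A k (Suc n) (E.cls f))"
  have z: "z \<in> cells A n" using k cls_ops(7)[OF ok(1)] by (simp add: z_def del: ktgt.simps)
  have "E.cls (Cmp k f g) = E.cls f \<ominus>\<^bsub>K\<^esub> idt A n z \<oplus>\<^bsub>K\<^esub> E.cls g"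
    unfolding cls_ops(5)[OF Cmp.prems(1)] cmp_formula[OF co] using k by (simp add: z_def del: ktgt.simps)
  moreover have "D (idt A n z \<otimes>\<^bsub>K\<^esub> up (Suc n) c) = \<zero>\<^bsub>K\<^esub>"
    using z c D_idt[of "z \<otimes>\<^bsub>L n\<^esub> up n c"] by (simp add: idt_simps)
  ultimately show ?case using Cmp z ok c
    by (simp add: tgt_simps \<Delta>_simps(1) cls_ops(7) K.l_distr K.diff_simps(5) D_simps D_closed del: lift.simps)
qed simp

text \<open>For \<open>k = 0\<close> the \<open>0\<close>-sources of the two factors are the
  \<open>0\<close>-source and the \<open>0\<close>-target of \<open>f\<close>; for \<open>k > 0\<close> they
  are equal.\<close>

lemma Cmp_source_diff:
  assumes "E.ok (Cmp k f g)"
  shows "s0 n (E.sc f) \<ominus>\<^bsub>L 0\<^esub> s0 n (E.sc g) \<in> I"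
    "s0 n (E.sc (Cmp k f g)) = s0 n (E.sc f)"
proof -
  have ok: "E.ok f" "E.ok g" and k: "k \<le> n" "ktgt A k n (E.tg f) = ksrc A k n (E.sc g)"
    using assms by (simp_all add: F_A)
  have tg: "E.tg f \<in> cells A n" using E.tg_closed[OF ok(1)] by (simp add: F_A)
  have f: "s0 n (E.sc f) \<ominus>\<^bsub>L 0\<^esub> t0 n (E.tg f) \<in> I"
    using kboundary_diff_I[OF cls_ops(7)[OF ok(1)]] ok by (simp add: cls_ops)
  show "s0 n (E.sc f) \<ominus>\<^bsub>L 0\<^esub> s0 n (E.sc g) \<in> I"
  proof (cases "k = 0")
    case True
    then show ?thesis using f k by simp
  next
    case False
    have "s0 n (E.sc g) = s0 k (ksrc A k n (E.sc g))" using k(1) by (simp add: ksrc_ksrc)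
    also have "\<dots> = s0 n (E.tg f)" using ksrc_ktgt[of 0 k n "E.tg f"] False k tg by simp
    also have "\<dots> = s0 n (E.sc f)"
      using E.parallel_ksrc[OF E.sc_tg_parallel[OF ok(1)], of 0] False k by (simp add: F_A)
    finally show ?thesis using sc_closed(2)[OF ok(1)] by (simp add: I.zero_closed)
  qed
  show "s0 n (E.sc (Cmp k f g)) = s0 n (E.sc f)"
    using E.ktgt_tg_Cmp(2)[OF assms, of 0] by (simp add: F_A del: tm_src.simps)
qed

lemma act_cong:
  assumes "y \<in> cells A (Suc (Suc n))" "src A (Suc n) y = \<zero>\<^bsub>K\<^esub>"
    and "a \<in> cells A 0" "b \<in> cells A 0" "a \<ominus>\<^bsub>L 0\<^esub> b \<in> I"
  shows "up (Suc (Suc n)) a \<otimes>\<^bsub>K2\<^esub> y = up (Suc (Suc n)) b \<otimes>\<^bsub>K2\<^esub> y"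
proof -
  have "(up (Suc (Suc n)) a \<ominus>\<^bsub>K2\<^esub> up (Suc (Suc n)) b) \<otimes>\<^bsub>K2\<^esub> y =
      \<zero>\<^bsub>K2\<^esub>"
    using kill(2)[OF assms(1,2,5)] assms(3,4) by (simp add: lift_simps(7) del: lift.simps)
  then show ?thesis using assms(1,3,4) by (simp add: K2.diff_simps(5) K2.diff_eq_iff del: lift.simps)
qed

lemma \<Delta>_cong_I:
  assumes "E.ok f" "c \<in> cells A 0" "c' \<in> cells A 0" "c \<ominus>\<^bsub>L 0\<^esub> c' \<in> I"
  shows "\<Delta> f c = \<Delta> f c'"
proof -
  have "\<Delta> f c \<ominus>\<^bsub>K2\<^esub> \<Delta> f c' = \<zero>\<^bsub>K2\<^esub>"
    using \<Delta>_I[OF assms(1,4)] assms by (simp add: \<Delta>_simps)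
  then show ?thesis using assms by (simp add: K2.diff_eq_iff \<Delta>_simps(1))
qed

text \<open>Most rules of the congruence turn into linear identities. The exception is the exchange of
  product and composition: in \<open>(f \<star> g)(f' \<star> g')\<close> the \<open>0\<close>-sources of
  \<open>f\<close> and \<open>f'\<close> act on all terms, but in \<open>(f f') \<star> (g g')\<close> the
  second product sees those of \<open>g\<close> and \<open>g'\<close> instead. They agree modulo relations,
  which is enough by \<open>act_cong\<close> and \<open>\<Delta>_cong_I\<close>.\<close>

lemma \<Delta>_eqv: "E.eqv f g \<Longrightarrow> c \<in> cells A 0 \<Longrightarrow> \<Delta> f c = \<Delta> g c"
proof (induction arbitrary: c rule: tm_eq.induct)
  note sd [simp] = \<Delta>_simps(1) sc_closed(2)
  note [simp del] = lift.simps
  note ok_cmp = tm_ok.simps(8)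
  note [simp del] = tm_ok.simps(8)
  have ok_CmpD: "E.ok (Cmp k f g) \<Longrightarrow> E.ok f \<and> E.ok g" for k f g by (simp add: ok_cmp)
  {
    case (cong_mul f f' g g')
    then show ?case using E.eqv_sound[OF cong_mul(1)] E.eqv_sound[OF cong_mul(2)] by simp
  next
    case (idt_mul a b u v w)
    then have "E.ok (Idt u)" "E.ok (Idt v)" by (auto simp: F_A)
    with idt_mul show ?case by (simp del: tm_src.simps)
  next
    case (idt_opr \<tau> a u w)
    then show ?case by (simp add: K2.oper_zero)
  next
    case (idt_scl a u w c)
    then show ?case by (simp add: K2.smult_zero_right)
  next
    case (add_assoc f g h)
    then show ?case by (simp add: K2.a_assoc)
  next
    case (add_comm f g)
    then show ?case by (simp add: K2.a_comm)
  next
    case (add_neg f u)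
    then show ?case by (simp add: K2.a_inv_eq_smult[symmetric] K2.r_neg)
  next
    case (scl_add_right f g r)
    then show ?case by (simp add: K2.smult_r_distr)
  next
    case (scl_add_left f r s)
    then show ?case by (simp add: K2.smult_l_distr)
  next
    case (scl_scl f r s)
    then show ?case by (simp add: K2.smult_assoc)
  next
    case (scl_one f)
    then show ?case by (simp add: K2.smult_one)
  next
    case (mul_assoc f g h)
    have "s0 n (E.sc f \<otimes>\<^bsub>L n\<^esub> E.sc g) = s0 n (E.sc f) \<otimes>\<^bsub>L 0\<^esub> s0 n (E.sc g)"
      "s0 n (E.sc g \<otimes>\<^bsub>L n\<^esub> E.sc h) = s0 n (E.sc g) \<otimes>\<^bsub>L 0\<^esub> s0 n (E.sc h)"
      using mul_assoc by (simp_all add: ksrc_simps sc_closed(1))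
    with mul_assoc show ?case
      by (simp add: F_A lift_simps K2.r_distr K2.m_assoc K2.a_assoc L0.m_assoc)
  next
    case (mul_one_left f u)
    have o: "\<one>\<^bsub>L n\<^esub> \<in> cells A n" by simp
    have "cell_of n (F n) u = \<one>\<^bsub>L n\<^esub>"
      using E.cell_of_eq[of "\<one>\<^bsub>L n\<^esub>" u] mul_one_left unfolding F_A by simp
    with mul_one_left show ?case by (simp add: ksrc_simps lift_simps)
  next
    case (mul_one_right f u)
    have "cell_of n (F n) u = \<one>\<^bsub>L n\<^esub>"
      using E.cell_of_eq[of "\<one>\<^bsub>L n\<^esub>" u] mul_one_right unfolding F_A by simp
    with mul_one_right show ?case by (simp add: ksrc_simps)
  next
    case (mul_add_left f g h)
    then show ?case
      by (simp add: F_A ksrc_simps lift_simps sc_closed(1) K2.l_distr K2.a_ac)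
  next
    case (mul_add_right f g h)
    then show ?case
      by (simp add: F_A ksrc_simps sc_closed(1) K2.r_distr L0.l_distr K2.a_ac \<Delta>_simps(2))
  next
    case (mul_scl_left f g r)
    then show ?case
      by (simp add: F_A ksrc_simps lift_simps sc_closed(1) K2.smult_mult_l K2.smult_r_distr)
  next
    case (mul_scl_right f g r)
    then show ?case
      by (simp add: F_A ksrc_simps sc_closed(1) K2.smult_mult_r L0.smult_mult_l K2.smult_r_distr \<Delta>_simps(3))
  next
    case (opr_add \<tau> f g)
    then show ?case by (simp add: K2.oper_add K2.l_distr)
  next
    case (opr_scl \<tau> f r)
    then show ?case by (simp add: K2.oper_smult K2.smult_mult_l)
  next
    case (cmp_assoc k f g h)
    then have "E.ok f" "E.ok g" "E.ok h" using ok_CmpD by blast+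
    with cmp_assoc show ?case by (simp add: K2.a_assoc)
  next
    case (exchange l k f g f' g')
    then have "E.ok f" "E.ok g" "E.ok f'" "E.ok g'" using ok_CmpD by blast+
    with exchange show ?case by (simp add: K2.a_ac)
  next
    case (cmp_add k f g f' g')
    then have "E.ok f" "E.ok g" "E.ok f'" "E.ok g'" using ok_CmpD by blast+
    with cmp_add show ?case by (simp add: K2.a_ac)
  next
    case (cmp_scl k f g r)
    then have "E.ok f" "E.ok g" using ok_CmpD by blast+
    with cmp_scl show ?case by (simp add: K2.smult_r_distr)
  next
    case (cmp_opr \<tau> k f g)
    then have "E.ok f" "E.ok g" using ok_CmpD by blast+
    with cmp_opr show ?case by (simp add: K2.oper_add K2.l_distr)
  next
    case (cmp_mul k f g f' g')
    then have ok: "E.ok f" "E.ok g" "E.ok f'" "E.ok g'" using ok_CmpD by blast+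
    define a a' b b' where "a = s0 n (E.sc f)" and "a' = s0 n (E.sc g)"
      and "b = s0 n (E.sc f')" and "b' = s0 n (E.sc g')"
    have cl: "a \<in> cells A 0" "a' \<in> cells A 0" "b \<in> cells A 0" "b' \<in> cells A 0"
      using ok by (simp_all add: a_def a'_def b_def b'_def)
    have i: "a \<ominus>\<^bsub>L 0\<^esub> a' \<in> I" "b \<ominus>\<^bsub>L 0\<^esub> b' \<in> I"
      using Cmp_source_diff(1)[OF cmp_mul(1)] Cmp_source_diff(1)[OF cmp_mul(2)]
      by (simp_all add: a_def a'_def b_def b'_def)
    have 1: "up (Suc (Suc n)) a \<otimes>\<^bsub>K2\<^esub> \<Delta> g' c =
        up (Suc (Suc n)) a' \<otimes>\<^bsub>K2\<^esub> \<Delta> g' c"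
      using ok cmp_mul.prems cl i by (intro act_cong) (simp_all add: \<Delta>_src)
    have 2: "\<Delta> g (b \<otimes>\<^bsub>L 0\<^esub> c) = \<Delta> g (b' \<otimes>\<^bsub>L 0\<^esub> c)"
      using ok cmp_mul.prems cl i by (intro \<Delta>_cong_I diff_mult_I) (simp_all add: I.zero_closed)
    have "\<Delta> (Mul (Cmp k f g) (Cmp k f' g')) c =
        up (Suc (Suc n)) a \<otimes>\<^bsub>K2\<^esub> (\<Delta> f' c \<oplus>\<^bsub>K2\<^esub> \<Delta> g' c)
        \<oplus>\<^bsub>K2\<^esub> (\<Delta> f (b \<otimes>\<^bsub>L 0\<^esub> c) \<oplus>\<^bsub>K2\<^esub> \<Delta> g (b \<otimes>\<^bsub>L 0\<^esub> c))"
      using Cmp_source_diff(2)[OF cmp_mul(1)] Cmp_source_diff(2)[OF cmp_mul(2)]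
      by (simp add: a_def b_def del: tm_src.simps)
    also have "\<dots> = (up (Suc (Suc n)) a \<otimes>\<^bsub>K2\<^esub> \<Delta> f' c \<oplus>\<^bsub>K2\<^esub> \<Delta> f (b \<otimes>\<^bsub>L 0\<^esub> c))
        \<oplus>\<^bsub>K2\<^esub>
        (up (Suc (Suc n)) a' \<otimes>\<^bsub>K2\<^esub> \<Delta> g' c \<oplus>\<^bsub>K2\<^esub> \<Delta> g (b' \<otimes>\<^bsub>L 0\<^esub> c))"
      unfolding 1[symmetric] 2[symmetric] using ok cl cmp_mul.prems by (simp add: K2.r_distr K2.a_ac)
    finally show ?case by (simp add: a_def a'_def b_def b'_def)
  }
qed (simp_all add: \<Delta>_simps(1))

text \<open>The homotopy before normalisation: it may fail to vanish on the values of
  \<open>e\<close>.\<close>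

definition \<delta>' :: "('z, 'o, 'k, 'x) cell \<Rightarrow> ('z, 'o, 'k, 'x) cell" where
  "\<delta>' a = \<Delta> (SOME f. f \<in> a) \<one>\<^bsub>L 0\<^esub>"

lemma \<delta>'_cls: "E.ok f \<Longrightarrow> \<delta>' (E.cls f) = \<Delta> f \<one>\<^bsub>L 0\<^esub>"
  unfolding \<delta>'_def using \<Delta>_eqv[OF E.some_cls[of f], of "\<one>\<^bsub>L 0\<^esub>"] by simp

lemma cellE:
  assumes "a \<in> cells A (Suc n)"
  obtains f where "E.ok f" "a = E.cls f"
  using assms E.new_cellE[of a] unfolding A'_F F_A by blast

lemma \<delta>'_linear: "linear_map K K2 \<delta>'"
  unfolding linear_map_def
proof (intro conjI ballI allI; elim cellE; hypsubst)
  fix f assume f: "E.ok f"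
  then show "\<delta>' (E.cls f) \<in> cells A (Suc (Suc n))" by (simp add: \<delta>'_cls \<Delta>_simps(1))
  show "\<delta>' (c \<odot>\<^bsub>K\<^esub> E.cls f) = c \<odot>\<^bsub>K2\<^esub> \<delta>' (E.cls f)" for c
    using f \<delta>'_cls[of "Scl c f"] by (simp add: cls_ops \<delta>'_cls)
  fix g assume g: "E.ok g"
  show "\<delta>' (E.cls f \<oplus>\<^bsub>K\<^esub> E.cls g) = \<delta>' (E.cls f) \<oplus>\<^bsub>K2\<^esub> \<delta>' (E.cls g)"
    using f g \<delta>'_cls[of "Add f g"] by (simp add: cls_ops \<delta>'_cls)
qed

lemmas \<delta>'_simps = linear_mapD[OF \<delta>'_linear] linear_map_minus[OF \<delta>'_linear level_alg level_alg]

lemma \<delta>'_src: "a \<in> cells A (Suc n) \<Longrightarrow> src A (Suc n) (\<delta>' a) = \<zero>\<^bsub>K\<^esub>"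
  by (elim cellE) (simp add: \<delta>'_cls \<Delta>_src)

lemma \<delta>'_tgt: "a \<in> cells A (Suc n) \<Longrightarrow> tgt A (Suc n) (\<delta>' a) = D a"
  by (elim cellE) (simp add: \<delta>'_cls \<Delta>_tgt lift_simps idt_simps cls_ops)

lemma idt_term:
  assumes "a \<in> cells A n"
  obtains u where "E.ok (Idt u)" "E.cls (Idt u) = idt A n a" "E.sc (Idt u) = a"
proof -
  have a: "a \<in> cells (F n) n" using assms by (simp add: F_A)
  obtain u where "u \<in> a" "E.ok (Idt u)" "idt E.A' n a = E.cls (Idt u)" "cell_of n (F n) u = a"
    by (rule E.cell_termE[OF a])
  then show thesis using that[of u] unfolding A'_F F_A by simp
qed

lemma \<delta>'_left:
  assumes x: "x \<in> cells A 0" and a: "a \<in> cells A (Suc n)"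
  shows "\<delta>' (up (Suc n) x \<otimes>\<^bsub>K\<^esub> a) = up (Suc (Suc n)) x \<otimes>\<^bsub>K2\<^esub> \<delta>' a"
proof -
  obtain f where f: "E.ok f" "a = E.cls f" using a by (rule cellE)
  have "up n x \<in> cells A n" using x by simp
  then obtain u where u: "E.ok (Idt u)" "E.cls (Idt u) = idt A n (up n x)" "E.sc (Idt u) = up n x"
    by (rule idt_term)
  have "up (Suc n) x \<otimes>\<^bsub>K\<^esub> a = E.cls (Mul (Idt u) f)"
    using cls_ops(2)[OF u(1) f(1)] u f by simp
  then show ?thesis using \<delta>'_cls[of "Mul (Idt u) f"] \<delta>'_cls[of f] u f x
    by (simp add: ksrc_lift \<Delta>_simps(1))
qed

lemma \<delta>'_oper:
  assumes a: "a \<in> cells A (Suc n)" and v: "v \<in> cells A 0" and \<tau>: "\<tau> \<in> \<Omega>"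
  shows "\<delta>' (oper K \<tau> a \<otimes>\<^bsub>K\<^esub> up (Suc n) v) =
    oper K2 \<tau> (\<delta>' a) \<otimes>\<^bsub>K2\<^esub> up (Suc (Suc n)) v"
proof -
  obtain f where f: "E.ok f" "a = E.cls f" using a by (rule cellE)
  have "up n v \<in> cells A n" using v by simp
  then obtain u where u: "E.ok (Idt u)" "E.cls (Idt u) = idt A n (up n v)" "E.sc (Idt u) = up n v"
    by (rule idt_term)
  have s: "s0 n (E.sc (Opr \<tau> f)) \<in> cells A 0" using f \<tau> sc_closed(2)[of "Opr \<tau> f"] by simp
  have "oper K \<tau> a \<otimes>\<^bsub>K\<^esub> up (Suc n) v = E.cls (Mul (Opr \<tau> f) (Idt u))"
    using cls_ops(2)[of "Opr \<tau> f" "Idt u"] cls_ops(4)[OF \<tau> f(1)] u f \<tau> by simp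
  then show ?thesis using \<delta>'_cls[of "Mul (Opr \<tau> f) (Idt u)"] \<delta>'_cls[of f] u f v \<tau> s
    by (simp add: ksrc_lift \<Delta>_simps(1))
qed

text \<open>The values of \<open>D\<close> are cycles, and \<open>D\<close> is \<open>-1\<close> on cycles;
  therefore \<open>- \<delta>'(D a)\<close> still has target \<open>D a\<close>. It vanishes wherever
  \<open>D\<close> does, in particular on the values of \<open>e\<close>.\<close>

definition d :: "('z, 'o, 'k, 'x) cell \<Rightarrow> ('z, 'o, 'k, 'x) cell" where
  "d a = (- 1) \<odot>\<^bsub>K2\<^esub> \<delta>' (D a)"

lemma d_linear: "linear_map K K2 d"
  unfolding linear_map_def
  by (auto simp: d_def D_simps \<delta>'_simps K2.smult_r_distr D_closed K2.smult_assoc[symmetric])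

lemmas d_simps = linear_mapD[OF d_linear] linear_map_minus[OF d_linear level_alg level_alg]

lemma d_src: "a \<in> cells A (Suc n) \<Longrightarrow> src A (Suc n) (d a) = \<zero>\<^bsub>K\<^esub>"
  by (simp add: d_def src_simps \<delta>'_simps(1) D_closed \<delta>'_src K.smult_zero_right)

lemma D_D: "a \<in> cells A (Suc n) \<Longrightarrow> D (D a) = (- 1) \<odot>\<^bsub>K\<^esub> D a"
  by (simp add: D_cycle D_src D_tgt D_closed K.a_inv_eq_smult)

lemma d_tgt: "a \<in> cells A (Suc n) \<Longrightarrow> tgt A (Suc n) (d a) = D a"
  by (simp add: d_def tgt_simps \<delta>'_simps(1) D_closed \<delta>'_tgt D_D K.smult_assoc[symmetric] K.smult_one)

lemma d_idt: "a \<in> cells A n \<Longrightarrow> d (idt A n a) = \<zero>\<^bsub>K2\<^esub>"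
  by (simp add: d_def D_idt \<delta>'_simps(4) K2.smult_zero_right)

lemma d_e: "a \<in> cells A n \<Longrightarrow> d (e a) = \<zero>\<^bsub>K2\<^esub>"
  by (simp add: d_def D_e \<delta>'_simps(4) K2.smult_zero_right)

lemma good_d: "good (Suc n) d"
  unfolding good_def
proof (intro conjI ballI impI)
  note [simp del] = lift.simps ksrc.simps
  show "linear_map K K2 d" by (rule d_linear)
  fix a assume a: "a \<in> cells A (Suc n)"
  show "src A (Suc n) (d a) = \<zero>\<^bsub>K\<^esub>" using a by (rule d_src)
  show "d (tgt A (Suc n) (d a)) \<oplus>\<^bsub>K2\<^esub> d a = \<zero>\<^bsub>K2\<^esub>"
  proof -
    have "d (D a) = \<ominus>\<^bsub>K2\<^esub> d a"
      using a by (simp add: d_def D_D \<delta>'_simps(3) D_closed K2.a_inv_eq_smult \<delta>'_simps(1))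
    then show ?thesis using a by (simp add: d_tgt K2.l_neg d_simps(1))
  qed
  { fix g assume g: "g \<in> cells A (Suc n)"
    define x where "x = s0 (Suc n) a"
    define B where "B = up (Suc n) (h (s0 (Suc n) g))"
    have x: "x \<in> cells A 0" "B \<in> cells A (Suc n)" using a g by (simp_all add: x_def B_def h_closed)
    show "d (a \<otimes>\<^bsub>K\<^esub> g) =
      up (Suc (Suc n)) (s0 (Suc n) a) \<otimes>\<^bsub>K2\<^esub> d g \<oplus>\<^bsub>K2\<^esub>
      d (a \<otimes>\<^bsub>K\<^esub> up (Suc n) (h (s0 (Suc n) g)))"
      unfolding d_def D_mult[OF a g] x_def[symmetric] B_def[symmetric] using a g x
      by (simp add: \<delta>'_simps(1,2) D_closed \<delta>'_left K2.smult_r_distr K2.smult_mult_r)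
  }
  fix v \<tau> assume v: "v \<in> cells A 0" and \<tau>: "\<tau> \<in> \<Omega>"
  define c where "c = oper (L 0) \<tau> (h (s0 (Suc n) a)) \<otimes>\<^bsub>L 0\<^esub> v"
  have c: "c \<in> cells A 0" using a v \<tau> by (simp add: c_def h_closed)
  have "d (up (Suc n) c) = \<zero>\<^bsub>K2\<^esub>"
    using d_idt[of "up n c"] c by (simp add: lift.simps)
  then show "d (oper K \<tau> a \<otimes>\<^bsub>K\<^esub> up (Suc n) v) =
      oper K2 \<tau> (d a) \<otimes>\<^bsub>K2\<^esub> up (Suc (Suc n)) v \<oplus>\<^bsub>K2\<^esub>
      d (up (Suc n) (oper (L 0) \<tau> (h (s0 (Suc n) a)) \<otimes>\<^bsub>L 0\<^esub> v))"
    unfolding c_def[symmetric] d_def[of "oper K \<tau> a \<otimes>\<^bsub>K\<^esub> up (Suc n) v"]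
      D_oper[OF a v \<tau>] using a v \<tau>
    by (simp add: \<delta>'_oper D_closed d_def K2.oper_smult K2.smult_mult_l \<delta>'_simps(1))
next
  fix a assume a: "a \<in> cells A (Suc (Suc n))"
  have "src A n (src A (Suc n) a \<ominus>\<^bsub>K\<^esub> tgt A (Suc n) a) = \<zero>\<^bsub>L n\<^esub>"
    "tgt A n (src A (Suc n) a \<ominus>\<^bsub>K\<^esub> tgt A (Suc n) a) = \<zero>\<^bsub>L n\<^esub>"
    using a by (simp_all add: src_simps tgt_simps glob_src glob_tgt)
  then show "tgt A (Suc n) (d (src A (Suc n) a \<ominus>\<^bsub>K\<^esub> tgt A (Suc n) a)) =
      tgt A (Suc n) a \<ominus>\<^bsub>K\<^esub> src A (Suc n) a"
    using a by (simp add: d_tgt D_cycle K.group_simps)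
qed simp

end

context homotopy
begin

text \<open>For a generating cell \<open>y\<close>, fillers \<open>0 \<rightarrow> D(y u)\<close> are chosen
  for all monomials \<open>u\<close> and extended linearly to \<open>0\<close>-cells. Precomposing with
  \<open>h\<close> preserves targets by \<open>D_right_h\<close> and makes the choice vanish on
  relations.\<close>

lemma homotopy_extension:
  assumes res: "polygraphic_resolution \<Omega> X (presented_alg \<Omega> X)"
  shows "\<exists>d. good (Suc n) d \<and> (\<forall>a\<in>cells A (Suc n). tgt A (Suc n) (d a) = D a) \<and>
    (\<forall>a\<in>cells A n. d (idt A n a) = \<zero>\<^bsub>K2\<^esub>) \<and>
    (\<forall>a\<in>cells A n. d (e a) = \<zero>\<^bsub>K2\<^esub>)"
proof -
  interpret K2: omega_algebra "K2" \<Omega> by (rule level_alg)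
  have fill: "\<exists>w\<in>cells A (Suc (Suc n)). src A (Suc n) w = \<zero>\<^bsub>K\<^esub> \<and> tgt A (Suc n) w = D a"
    if a: "a \<in> cells A (Suc n)" for a
  proof -
    have "parallel (F (Suc n)) (Suc n) \<zero>\<^bsub>K\<^esub> (D a)"
      unfolding parallel_def using a
      by (simp add: D_src D_tgt src_simps tgt_simps src_F[of n "Suc n", symmetric]
        tgt_F[of n "Suc n", symmetric] del: free_n_alg.simps)
    moreover have "\<zero>\<^bsub>K\<^esub> \<in> cells (F (Suc n)) (Suc n)" "D a \<in> cells (F (Suc n)) (Suc n)"
      using a D_closed by (simp_all add: level_F[of "Suc n" "Suc n", symmetric] del: free_n_alg.simps)
    ultimately have "\<exists>w\<in>cells (F (Suc (Suc n))) (Suc (Suc n)).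
        src (F (Suc (Suc n))) (Suc n) w = \<zero>\<^bsub>K\<^esub> \<and> tgt (F (Suc (Suc n))) (Suc n) w = D a"
      using res unfolding polygraphic_resolution_def by (simp del: free_n_alg.simps)
    then show ?thesis
      using level_F[of "Suc (Suc n)" "Suc (Suc n)"] src_F[of "Suc n" "Suc (Suc n)"] tgt_F[of "Suc n" "Suc (Suc n)"]
      by (simp del: free_n_alg.simps)
  qed
  have "\<exists>G. linear_map (L 0) K2 G \<and>
      (\<forall>c\<in>cells A 0. src A (Suc n) (G c) = \<zero>\<^bsub>K\<^esub> \<and>
        tgt A (Suc n) (G c) = D (gen_cell n y \<otimes>\<^bsub>K\<^esub> up (Suc n) c)) \<and>
      (\<forall>i\<in>I. G i = \<zero>\<^bsub>K2\<^esub>)" if y: "y \<in> gens X (Suc n)" for y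
  proof -
    define g where "g = gen_cell n y"
    have g: "g \<in> cells A (Suc n)" using gen_cell(1)[OF y] by (simp add: g_def)
    have "\<exists>w. \<forall>u\<in>M. w u \<in> cells A (Suc (Suc n)) \<and> src A (Suc n) (w u) = \<zero>\<^bsub>K\<^esub> \<and>
        tgt A (Suc n) (w u) = D (g \<otimes>\<^bsub>K\<^esub> up (Suc n) (mon_cell u))"
    proof (rule bchoice, rule ballI)
      fix u assume "u \<in> M"
      then have "g \<otimes>\<^bsub>K\<^esub> up (Suc n) (mon_cell u) \<in> cells A (Suc n)"
        using g by (simp add: mon_cell_0)
      from fill[OF this] show "\<exists>w. w \<in> cells A (Suc (Suc n)) \<and> src A (Suc n) w = \<zero>\<^bsub>K\<^esub> \<and>
        tgt A (Suc n) w = D (g \<otimes>\<^bsub>K\<^esub> up (Suc n) (mon_cell u))" by blast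
    qed
    then obtain w where w: "\<And>u. u \<in> M \<Longrightarrow> w u \<in> cells A (Suc (Suc n))"
      "\<And>u. u \<in> M \<Longrightarrow> src A (Suc n) (w u) = \<zero>\<^bsub>K\<^esub>"
      "\<And>u. u \<in> M \<Longrightarrow> tgt A (Suc n) (w u) = D (g \<otimes>\<^bsub>K\<^esub> up (Suc n) (mon_cell u))"
      by blast
    obtain H where H: "linear_map (L 0) K2 H" and Hw: "\<And>u. u \<in> M \<Longrightarrow> H (mon_cell u) = w u"
      unfolding level_0
      using linear_extension[where Z = "gens0 X" and e = w, OF K2.omega_algebra_axioms w(1)] by auto
    note H_simps = linear_mapD[OF H] linear_map_minus[OF H level_alg level_alg]
    have H_src: "src A (Suc n) (H c) = \<zero>\<^bsub>K\<^esub>" if "c \<in> cells A 0" for c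
      using that by (induction rule: cell_0_induct) (simp_all add: Hw w H_simps src_simps K.smult_zero_right)
    have H_tgt: "tgt A (Suc n) (H c) = D (g \<otimes>\<^bsub>K\<^esub> up (Suc n) c)" if "c \<in> cells A 0" for c
      using that g
      by (induction rule: cell_0_induct)
        (simp_all add: Hw w H_simps tgt_simps D_simps lift_simps idt_simps K.r_distr K.smult_mult_r)
    define G where "G c = H (h c)" for c
    have "linear_map (L 0) K2 G"
      unfolding linear_map_def G_def by (auto simp: H_simps h_simps h_closed)
    moreover have "src A (Suc n) (G c) = \<zero>\<^bsub>K\<^esub>"
      "tgt A (Suc n) (G c) = D (g \<otimes>\<^bsub>K\<^esub> up (Suc n) c)" if "c \<in> cells A 0" for c
    proof -
      show "src A (Suc n) (G c) = \<zero>\<^bsub>K\<^esub>" using that by (simp add: G_def H_src h_closed)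
      have "D (g \<otimes>\<^bsub>K\<^esub> up (Suc n) (h c)) = D (g \<otimes>\<^bsub>K\<^esub> up (Suc n) c)"
        using g that by (rule D_right_h)
      then show "tgt A (Suc n) (G c) = D (g \<otimes>\<^bsub>K\<^esub> up (Suc n) c)"
        using that by (simp add: G_def H_tgt h_closed)
    qed
    moreover have "G i = \<zero>\<^bsub>K2\<^esub>" if "i \<in> I" for i
      using that by (simp add: G_def h_I H_simps(4))
    ultimately show ?thesis by (auto simp: g_def)
  qed
  then obtain G where G: "\<And>y. y \<in> gens X (Suc n) \<Longrightarrow> linear_map (L 0) K2 (G y) \<and>
      (\<forall>c\<in>cells A 0. src A (Suc n) (G y c) = \<zero>\<^bsub>K\<^esub> \<and>
        tgt A (Suc n) (G y c) = D (gen_cell n y \<otimes>\<^bsub>K\<^esub> up (Suc n) c)) \<and>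
      (\<forall>i\<in>I. G y i = \<zero>\<^bsub>K2\<^esub>)"
    by metis
  interpret homotopy_step \<Omega> X \<iota> n e G
    by unfold_locales (use G in auto)
  show ?thesis using good_d d_tgt d_idt d_e by blast
qed

end

section \<open>Resolutions are contractible\<close>

context polygraph_section
begin

text \<open>Dependent choice: each homotopy is chosen with regard to the previous one, whose values
  prescribe its targets.\<close>

theorem resolution_imp_contraction:
  assumes res: "polygraphic_resolution \<Omega> X (presented_alg \<Omega> X)"
  shows "\<exists>\<sigma>. contraction \<Omega> X \<iota> \<sigma> \<and> right_contraction \<Omega> X \<iota> \<sigma> \<and> bracketed_contraction \<Omega> X \<iota> \<sigma>"
proof -
  obtain d0 where d0: "good 0 d0" "\<And>a. a \<in> cells A 0 \<Longrightarrow> d0 (h a) = \<zero>\<^bsub>L (Suc 0)\<^esub>"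
    using zero_homotopy by blast
  define Q where "Q n e d \<longleftrightarrow> (\<forall>a\<in>cells A (Suc n). tgt A (Suc n) (d a) =
      idt A n (src A n a) \<ominus>\<^bsub>L (Suc n)\<^esub> a \<oplus>\<^bsub>L (Suc n)\<^esub> e (src A n a \<ominus>\<^bsub>L n\<^esub> tgt A n a)) \<and>
    (\<forall>a\<in>cells A n. d (idt A n a) = \<zero>\<^bsub>L (Suc (Suc n))\<^esub>) \<and>
    (\<forall>a\<in>cells A n. d (e a) = \<zero>\<^bsub>L (Suc (Suc n))\<^esub>)" for n e d
  define P where "P n d \<longleftrightarrow> good n d \<and>
    (n = 0 \<longrightarrow> (\<forall>a\<in>cells A 0. d (h a) = \<zero>\<^bsub>L (Suc 0)\<^esub>))" for n d
  have "\<exists>\<delta>. \<forall>n. P n (\<delta> n) \<and> Q n (\<delta> n) (\<delta> (Suc n))"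
  proof (rule dependent_nat_choice)
    show "\<exists>d. P 0 d" using d0 by (auto simp: P_def)
    fix e n assume e: "P n e"
    interpret homotopy \<Omega> X \<iota> n e by unfold_locales (use e in \<open>simp add: P_def\<close>)
    show "\<exists>d. P (Suc n) d \<and> Q n e d"
      using homotopy_extension[OF res] by (simp add: P_def Q_def D_def)
  qed
  then obtain \<delta> where \<delta>: "\<And>n. P n (\<delta> n)" "\<And>n. Q n (\<delta> n) (\<delta> (Suc n))" by blast
  have g: "good n (\<delta> n)" for n using \<delta>(1) by (simp add: P_def)
  have g0: "a \<in> cells A 0 \<Longrightarrow> tgt A 0 (\<delta> 0 a) = h a \<ominus>\<^bsub>L 0\<^esub> a" for a
    using g[of 0] by (simp add: good_def)
  interpret R: reduced_contraction \<Omega> X \<iota> \<delta>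
  proof unfold_locales
    fix n f g \<tau> v
    show "linear_map (L n) (L (Suc n)) (\<delta> n)" using g[of n] unfolding good_def by blast
    show "f \<in> cells A n \<Longrightarrow> src A n (\<delta> n f) = \<zero>\<^bsub>L n\<^esub>" using g[of n] unfolding good_def by blast
    show "f \<in> cells A n \<Longrightarrow> g \<in> cells A n \<Longrightarrow> \<delta> n (f \<otimes>\<^bsub>L n\<^esub> g) =
      up (Suc n) (s0 n f) \<otimes>\<^bsub>L (Suc n)\<^esub> \<delta> n g \<oplus>\<^bsub>L (Suc n)\<^esub>
      \<delta> n (f \<otimes>\<^bsub>L n\<^esub> up n (h (s0 n g)))"
      using g[of n] unfolding good_def by blast
    show "f \<in> cells A n \<Longrightarrow> v \<in> cells A 0 \<Longrightarrow> \<tau> \<in> \<Omega> \<Longrightarrow>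
      \<delta> n (oper (L n) \<tau> f \<otimes>\<^bsub>L n\<^esub> up n v) =
      oper (L (Suc n)) \<tau> (\<delta> n f) \<otimes>\<^bsub>L (Suc n)\<^esub> up (Suc n) v \<oplus>\<^bsub>L (Suc n)\<^esub>
      \<delta> n (up n (oper (L 0) \<tau> (h (s0 n f)) \<otimes>\<^bsub>L 0\<^esub> v))"
      using g[of n] unfolding good_def by blast
  qed (use \<delta>(1)[of 0] \<delta>(2) g0 in \<open>simp_all add: P_def Q_def\<close>)
  show ?thesis
    using R.contraction_\<sigma> R.right_contraction_\<sigma> R.bracketed_contraction_\<sigma> by blast
qed

end

theorem proposition5p2p3:
  fixes \<Omega> :: "'o set"
    and X :: "('z, 'o, 'k::field_char_0, 'x) polygraph"
    and \<iota> :: "nat \<Rightarrow> ('z, 'o, 'k, 'x) cell set \<Rightarrow> ('z, 'o, 'k, 'x) cell"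
  assumes "omega_polygraph \<Omega> X"
    and "unital_section \<Omega> X \<iota>"
  shows "polygraphic_resolution \<Omega> X (presented_alg \<Omega> X) \<longleftrightarrow>
    (\<exists>\<sigma>. contraction \<Omega> X \<iota> \<sigma> \<and> right_contraction \<Omega> X \<iota> \<sigma> \<and> bracketed_contraction \<Omega> X \<iota> \<sigma>)"
proof -
  interpret polygraph_section \<Omega> X \<iota>
    by unfold_locales (fact assms)+
  show ?thesis
    using contraction_imp_resolution resolution_imp_contraction by blast
qed

end
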